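(* In the explicit metric setting, for each of the two problems Robust Facility Location and Facility Location with Penalties, there is a (randomized, succeeding with high probability) $O(1)$-approximation algorithm in the $k$-machine model running in $\tilde O(n/k)$ rounds.
   Context: Both problems have as input a set $F$ of facilities with opening costs $f_i\ge 0$, a set $C$ of clients, and a metric $d$ on $F\cup C$; write $d(j,F')=\min_{i\in F'}d(i,j)$, $d(j,\emptyset)=+\infty$. Robust Facility Location: given additionally an integer $0\le p\le|C|$, find $F'\subseteq F$, $C'\subseteq C$ with $|C'|\ge p$ minimizing $\sum_{i\in F'}f_i+\sum_{j\in C'}d(j,F')$. Facility Location with Penalties: given additionally penalties $p_j\ge 0$ ($j\in C$), find $F'\subseteq F$, $C'\subseteq C$ minimizing $\sum_{i\in F'}f_i+\sum_{j\in C'}d(j,F')+\sum_{j\in C\setminus C'}p_j$. An $\alpha$-approximation algorithm outputs a feasible solution of cost at most $\alpha$ times the minimum cost. Assume $|F|=|C|=n$ and that every individual number in the input can be represented in $O(\log n)$ bits. $k$-machine model: there are $k$ machines communicating in synchronous rounds; in each round each machine may send a (possibly distinct) message of $\mathrm{poly}(\log n)$ bits to each of the other $k-1$ machines; local computation is free. Each facility and each client is assigned to a machine chosen uniformly at random. Explicit metric setting: the machine hosting facility $i$ knows $f_i$ and $d(i,j)$ for all $j\in C$; the machine hosting client $j$ knows $d(i,j)$ for all $i\in F$ (and $p_j$ in the penalty problem). "With high probability" means with probability at least $1-1/\mathrm{poly}(n)$; $\tilde O(g(n))=O(g(n)\cdot\mathrm{poly}(\log n))$.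
   Formalization: The number of machines is restricted to 1 ≤ k ≤ n (and n ≥ 2), so that the round bound n/k is at least 1; for k far larger than n the bound would allow no communication at all and the claim would fail. *)

theory Defs
  imports "HOL-Probability.Probability"
begin

section \<open>The two optimization problems\<close>

text \<open>
  Facilities and clients are points of one metric space, named by natural numbers. The two sets
  need not be disjoint: a point may be both a facility and a client.
\<close>

record fl_instance =
  facilities :: "nat set"
  clients :: "nat set"
  open_cost :: "nat \<Rightarrow> real"
  metric :: "nat \<Rightarrow> nat \<Rightarrow> real"

text \<open>
  A number has \<open>O(log n)\<close> bits if it is a fraction whose numerator and denominator
  are at most \<open>n ^ c\<close>, for a constant \<open>c\<close>.
\<close>

definition short_number :: "nat \<Rightarrow> nat \<Rightarrow> real \<Rightarrow> bool" where
  "short_number c n x \<longleftrightarrow>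
     (\<exists>a b::nat. x = real a / real b \<and> a \<le> n ^ c \<and> 0 < b \<and> b \<le> n ^ c)"

definition valid_instance :: "nat \<Rightarrow> nat \<Rightarrow> fl_instance \<Rightarrow> bool" where
  "valid_instance c n I \<longleftrightarrow>
     finite (facilities I) \<and> finite (clients I) \<and>
     card (facilities I) = n \<and> card (clients I) = n \<and>
     (\<forall>v \<in> facilities I \<union> clients I. v \<le> n ^ c) \<and>
     Metric_space (facilities I \<union> clients I) (metric I) \<and>
     (\<forall>v \<in> facilities I \<union> clients I. \<forall>w \<in> facilities I \<union> clients I.
        short_number c n (metric I v w)) \<and>
     (\<forall>i \<in> facilities I. 0 \<le> open_cost I i \<and> short_number c n (open_cost I i))"

definition valid_penalties :: "nat \<Rightarrow> nat \<Rightarrow> fl_instance \<Rightarrow> (nat \<Rightarrow> real) \<Rightarrow> bool" where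
  "valid_penalties c n I pen \<longleftrightarrow>
     (\<forall>j \<in> clients I. 0 \<le> pen j \<and> short_number c n (pen j))"

text \<open>The infimum over the empty set is \<open>\<infinity>\<close>.\<close>

definition dist_to :: "fl_instance \<Rightarrow> nat \<Rightarrow> nat set \<Rightarrow> ereal" where
  "dist_to I j F' = (INF i\<in>F'. ereal (metric I i j))"

type_synonym solution = "nat set \<times> nat set"

definition robust_feasible :: "fl_instance \<Rightarrow> nat \<Rightarrow> solution set" where
  "robust_feasible I p =
     {(F', C'). F' \<subseteq> facilities I \<and> C' \<subseteq> clients I \<and> p \<le> card C'}"

definition robust_cost :: "fl_instance \<Rightarrow> solution \<Rightarrow> ereal" where
  "robust_cost I = (\<lambda>(F', C').
     (\<Sum>i\<in>F'. ereal (open_cost I i)) + (\<Sum>j\<in>C'. dist_to I j F'))"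

definition penalty_feasible :: "fl_instance \<Rightarrow> solution set" where
  "penalty_feasible I = {(F', C'). F' \<subseteq> facilities I \<and> C' \<subseteq> clients I}"

definition penalty_cost :: "fl_instance \<Rightarrow> (nat \<Rightarrow> real) \<Rightarrow> solution \<Rightarrow> ereal" where
  "penalty_cost I pen = (\<lambda>(F', C').
     (\<Sum>i\<in>F'. ereal (open_cost I i)) + (\<Sum>j\<in>C'. dist_to I j F')
     + (\<Sum>j\<in>clients I - C'. ereal (pen j)))"

definition approx_solution :: "real \<Rightarrow> 's set \<Rightarrow> ('s \<Rightarrow> ereal) \<Rightarrow> 's \<Rightarrow> bool" where
  "approx_solution \<alpha> S cost s \<longleftrightarrow> s \<in> S \<and> cost s \<le> ereal \<alpha> * (INF t\<in>S. cost t)"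


section \<open>The \<open>k\<close>-machine model\<close>

text \<open>
  Machines are \<open>0, \<dots>, k - 1\<close>. Since local computation is free, the state of a machine is all
  that it has seen: its local input (of type \<open>'x\<close>), its private fair coin flips and, for every
  past round, the messages received from each of the machines. The arguments of \<open>send\<close> are
  \<open>n\<close>, \<open>k\<close>, the name of the machine, its local input, coins and history, and the name of the
  recipient; those of \<open>result\<close> are the same without the recipient.
\<close>

type_synonym history = "(nat \<Rightarrow> bool list) list"

record 'x algorithm =
  rounds :: "nat \<Rightarrow> nat \<Rightarrow> nat"
  coins :: "nat \<Rightarrow> nat \<Rightarrow> nat"
  send :: "nat \<Rightarrow> nat \<Rightarrow> nat \<Rightarrow> 'x \<Rightarrow> bool list \<Rightarrow> history \<Rightarrow> nat \<Rightarrow> bool list"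
  result :: "nat \<Rightarrow> nat \<Rightarrow> nat \<Rightarrow> 'x \<Rightarrow> bool list \<Rightarrow> history \<Rightarrow> solution"

definition message_length_le :: "'x algorithm \<Rightarrow> nat \<Rightarrow> nat \<Rightarrow> real \<Rightarrow> bool" where
  "message_length_le A n k w \<longleftrightarrow>
     (\<forall>m x r H m'. real (length (send A n k m x r H m')) \<le> w)"

primrec history_after ::
  "'x algorithm \<Rightarrow> nat \<Rightarrow> nat \<Rightarrow> (nat \<Rightarrow> 'x) \<Rightarrow> (nat \<Rightarrow> bool list) \<Rightarrow> nat \<Rightarrow> nat \<Rightarrow> history"
where
  "history_after A n k x r 0 = (\<lambda>m. [])"
| "history_after A n k x r (Suc t) = (\<lambda>m.
     history_after A n k x r t m @
       [\<lambda>m'. if m' < k \<and> m' \<noteq> m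
             then send A n k m' (x m') (r m') (history_after A n k x r t m') m
             else []])"

definition machine_result ::
  "'x algorithm \<Rightarrow> nat \<Rightarrow> nat \<Rightarrow> (nat \<Rightarrow> 'x) \<Rightarrow> (nat \<Rightarrow> bool list) \<Rightarrow> nat \<Rightarrow> solution"
where
  "machine_result A n k x r m =
     result A n k m (x m) (r m) (history_after A n k x r (rounds A n k) m)"

text \<open>
  The functions \<open>h\<close> and \<open>g\<close> give the machines hosting the facilities and the clients. The output
  is distributed: the host of a facility decides whether it is opened, and the host of a client
  decides whether it belongs to \<open>C'\<close>.
\<close>

definition output_solution ::
  "'x algorithm \<Rightarrow> nat \<Rightarrow> nat \<Rightarrow> fl_instance \<Rightarrow> (nat \<Rightarrow> 'x) \<Rightarrow>
   (nat \<Rightarrow> nat) \<Rightarrow> (nat \<Rightarrow> nat) \<Rightarrow> (nat \<Rightarrow> bool list) \<Rightarrow> solution"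
where
  "output_solution A n k I x h g r =
     ({i \<in> facilities I. i \<in> fst (machine_result A n k x r (h i))},
      {j \<in> clients I. j \<in> snd (machine_result A n k x r (g j))})"

text \<open>
  Hosts of facilities, hosts of clients and the coins of the machines, all independent and uniform.
\<close>

definition random_choices ::
  "'x algorithm \<Rightarrow> nat \<Rightarrow> nat \<Rightarrow> fl_instance \<Rightarrow>
   ((nat \<Rightarrow> nat) \<times> (nat \<Rightarrow> nat) \<times> (nat \<Rightarrow> bool list)) pmf"
where
  "random_choices A n k I =
     pair_pmf (Pi_pmf (facilities I) 0 (\<lambda>_. pmf_of_set {..<k}))
       (pair_pmf (Pi_pmf (clients I) 0 (\<lambda>_. pmf_of_set {..<k}))
          (Pi_pmf {..<k} [] (\<lambda>_. pmf_of_set {bs. length bs = coins A n k})))"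


section \<open>Local inputs in the explicit metric setting\<close>

text \<open>
  Partial maps, so that a machine sees exactly the data of the facilities and clients it hosts:
  distances to all clients for a facility, distances to all facilities for a client.
\<close>

type_synonym facility_view = "nat \<rightharpoonup> (real \<times> (nat \<rightharpoonup> real))"

definition facility_view :: "fl_instance \<Rightarrow> (nat \<Rightarrow> nat) \<Rightarrow> nat \<Rightarrow> facility_view" where
  "facility_view I h m =
     (\<lambda>i. Some (open_cost I i, (\<lambda>j. Some (metric I i j)) |` clients I))
       |` {i \<in> facilities I. h i = m}"

type_synonym client_view = "nat \<rightharpoonup> (nat \<rightharpoonup> real)"

definition client_view :: "fl_instance \<Rightarrow> (nat \<Rightarrow> nat) \<Rightarrow> nat \<Rightarrow> client_view" where
  "client_view I g m =
     (\<lambda>j. Some ((\<lambda>i. Some (metric I i j)) |` facilities I)) |` {j \<in> clients I. g j = m}"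

text \<open>The integer \<open>p\<close> is a global parameter, known to all machines.\<close>

type_synonym robust_input = "nat \<times> facility_view \<times> client_view"

definition robust_input ::
  "fl_instance \<Rightarrow> nat \<Rightarrow> (nat \<Rightarrow> nat) \<Rightarrow> (nat \<Rightarrow> nat) \<Rightarrow> nat \<Rightarrow> robust_input"
where
  "robust_input I p h g m = (p, facility_view I h m, client_view I g m)"

type_synonym penalty_input = "facility_view \<times> client_view \<times> (nat \<rightharpoonup> real)"

definition penalty_input ::
  "fl_instance \<Rightarrow> (nat \<Rightarrow> real) \<Rightarrow> (nat \<Rightarrow> nat) \<Rightarrow> (nat \<Rightarrow> nat) \<Rightarrow> nat \<Rightarrow> penalty_input"
where
  "penalty_input I pen h g m =
     (facility_view I h m, client_view I g m,
      (\<lambda>j. Some (pen j)) |` {j \<in> clients I. g j = m})"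

definition robust_success_prob ::
  "robust_input algorithm \<Rightarrow> real \<Rightarrow> nat \<Rightarrow> nat \<Rightarrow> fl_instance \<Rightarrow> nat \<Rightarrow> real"
where
  "robust_success_prob A \<alpha> n k I p =
     measure_pmf.prob (random_choices A n k I)
       {(h, g, r). approx_solution \<alpha> (robust_feasible I p) (robust_cost I)
                     (output_solution A n k I (robust_input I p h g) h g r)}"

definition penalty_success_prob ::
  "penalty_input algorithm \<Rightarrow> real \<Rightarrow> nat \<Rightarrow> nat \<Rightarrow> fl_instance \<Rightarrow> (nat \<Rightarrow> real) \<Rightarrow> real"
where
  "penalty_success_prob A \<alpha> n k I pen =
     measure_pmf.prob (random_choices A n k I)
       {(h, g, r). approx_solution \<alpha> (penalty_feasible I) (penalty_cost I pen)
                     (output_solution A n k I (penalty_input I pen h g) h g r)}"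

end

(*
  With local computation free, a protocol in which every facility and every client announces a few
  O(log n)-bit messages to everybody, for polylogarithmically many times, runs in the k-machine model
  in O~(n/k) rounds: with high probability every machine hosts O~(n/k) points. The announcements are
  deterministic; randomness enters only through this load bound.

  The algorithm is that of Mettu and Plaxton. Facility i has a radius r(i), up to a factor 2 the one at
  which the clients in its ball would pay f(i), i.e. sum_j (min(r(i), p_j) - d(i,j))^+ = f(i). Then
  alpha_j = min(p_j, min_i max(r(i), d(i,j))) is a feasible dual solution. The facilities opened form a
  net: their balls share no client, and every facility i has an open one of no larger radius within
  4 r(i); so the clients pay for the open facilities and their connections with O(alpha_j) each.

  The net is built radius by radius. Among the facilities of one radius whose ball avoids the clients
  already close to an open facility, let every client be in at most 2^s balls. A sample of rate
  O(log n) / 2^s leaves O(log n) sampled balls at each client, few enough for the clients to announce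
  them, so that everybody can pick the same maximal packing of sampled balls. A client in more than
  2^(s-1) balls is in a sampled one, hence close to the packing, and all balls around it are discarded:
  only 2^(s-1) balls per client survive. The sample is taken from a fixed family of polynomial size in
  which almost every member works for any given client; binary search finds one that works for all.

  For robust facility location there are no penalties, but p clients of smallest alpha_j are to be
  served. With q their largest alpha_j, opening the net facilities of radius at most q is paid for,
  and of those of radius in (q, 2q] as many are opened as needed to serve p clients; all but the last of
  them are paid for. The last one costs at most the largest opening cost of an optimal solution, which
  is guessed up to a factor 2 before the net is built. All candidate solutions are compared publicly
  by means of the rounded distances announced by the clients.
*)

theory Submission
  imports Defs
begin

section \<open>Broadcast protocols and their simulation\<close>

text \<open>The obstacle is that a node may announce only O~(1) messages: a client may lie in n
  balls and cannot list them, while the host of a facility knows no distance to another facility.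
  Conflicts between balls are visible only at the clients they share, so the number of balls per
  client has to shrink before it can be spoken about. The machines share no random string. A family
  of samples that exists by the probabilistic method is fixed by a choice operator as part of the
  algorithm; one member suits all n clients because each client rejects less than a 1/n fraction of
  the family. The analysis is dual fitting. Opening costs are paid at the first radius at which the
  ball pays enough, while feasibility of \<open>\<alpha>\<close> needs the last radius at which it
  does not; consecutive radii differ by the factor 2. Hence the constants: 9 = 1 + 4 * 2 for the
  distance to a net facility, 18 = 9 + 9 with the opening costs, 36 after rounding the penalties; in
  the robust problem 38 = 9 + 9 + 18 + 2, and 76 after rounding.\<close>

datatype ('l, 'a) prot =
    Ret 'a
  | Bcast "'l \<Rightarrow> nat list set" "nat list set \<Rightarrow> ('l, 'a) prot"

primrec bind_prot :: "('l, 'a) prot \<Rightarrow> ('a \<Rightarrow> ('l, 'b) prot) \<Rightarrow> ('l, 'b) prot" where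
  "bind_prot (Ret a) f = f a"
| "bind_prot (Bcast e c) f = Bcast e (\<lambda>P. bind_prot (c P) f)"

primrec loop_prot :: "(nat \<Rightarrow> 's \<Rightarrow> ('l, 's) prot) \<Rightarrow> nat \<Rightarrow> 's \<Rightarrow> ('l, 's) prot" where
  "loop_prot f 0 s = Ret s"
| "loop_prot f (Suc n) s = bind_prot (loop_prot f n s) (f n)"

text \<open>A continuation sees only the union of all announcements, so the state of a protocol is
  public and one run over the node set \<open>V\<close> describes all machines. \<open>R\<close> is
  a budget of broadcasts and \<open>\<kappa>\<close> bounds what a single node says in one of them;
  both turn into rounds in \<open>sim_result\<close>.\<close>

primrec hoare ::
  "'l set \<Rightarrow> nat \<Rightarrow> nat list set \<Rightarrow> ('l, 'a) prot \<Rightarrow> nat \<Rightarrow> ('a \<Rightarrow> bool) \<Rightarrow> bool"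
where
  "hoare V \<kappa> Ms (Ret a) = (\<lambda>R Q. Q a)"
| "hoare V \<kappa> Ms (Bcast e c) = (\<lambda>R Q. 0 < R \<and>
     (\<forall>v\<in>V. e v \<subseteq> Ms \<and> finite (e v) \<and> card (e v) \<le> \<kappa>) \<and>
     hoare V \<kappa> Ms (c (\<Union>v\<in>V. e v)) (R - 1) Q)"

lemma hoare_mono:
  assumes "hoare V \<kappa> Ms p R Q" "R \<le> R'" "\<And>a. Q a \<Longrightarrow> Q' a"
  shows "hoare V \<kappa> Ms p R' Q'"
  using assms(1,2)
proof (induction p arbitrary: R R')
  case (Ret a)
  then show ?case using assms(3) by simp
next
  case (Bcast e c)
  show ?case using Bcast.prems Bcast.IH[OF rangeI, of _ "R - 1" "R' - 1"] by auto
qed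

lemma hoare_bind:
  assumes "hoare V \<kappa> Ms p R1 Q1" "\<And>a. Q1 a \<Longrightarrow> hoare V \<kappa> Ms (f a) R2 Q2"
  shows "hoare V \<kappa> Ms (bind_prot p f) (R1 + R2) Q2"
  using assms(1)
proof (induction p arbitrary: R1)
  case (Ret a)
  then show ?case using assms(2)[of a] hoare_mono[of V \<kappa> Ms "f a" R2 Q2 "R1 + R2" Q2] by simp
next
  case (Bcast e c)
  then have "hoare V \<kappa> Ms (bind_prot (c (\<Union>v\<in>V. e v)) f) (R1 - 1 + R2) Q2"
    by (intro Bcast.IH) auto
  moreover have "R1 - 1 + R2 = R1 + R2 - 1" using Bcast.prems by simp
  ultimately show ?case using Bcast.prems by auto
qed

lemma hoare_Bcast:
  assumes "\<And>v. v \<in> V \<Longrightarrow> e v \<subseteq> Ms \<and> finite (e v) \<and> card (e v) \<le> \<kappa>"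
    and "hoare V \<kappa> Ms (c (\<Union>v\<in>V. e v)) R Q"
  shows "hoare V \<kappa> Ms (Bcast e c) (Suc R) Q"
  using assms by simp

lemma hoare_loop:
  assumes "Inv 0 s" "\<And>i s. i < n \<Longrightarrow> Inv i s \<Longrightarrow> hoare V \<kappa> Ms (f i s) R (Inv (Suc i))"
  shows "hoare V \<kappa> Ms (loop_prot f n s) (n * R) (Inv n)"
  using assms(2)
proof (induction n)
  case 0
  then show ?case using assms(1) by simp
next
  case (Suc n)
  have "hoare V \<kappa> Ms (bind_prot (loop_prot f n s) (f n)) (n * R + R) (Inv (Suc n))"
    by (rule hoare_bind[OF Suc.IH]) (use Suc.prems in auto)
  then show ?case by (simp add: add.commute)
qed

text \<open>Any fixed order of sending will do, because the receivers collect the messages of a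
  block as a set.\<close>

definition enum_set :: "'b set \<Rightarrow> 'b list" where
  "enum_set Y = (SOME xs. set xs = Y \<and> distinct xs)"

lemma enum_set: "finite Y \<Longrightarrow> set (enum_set Y) = Y \<and> length (enum_set Y) = card Y"
proof -
  assume "finite Y"
  then have "\<exists>xs. set xs = Y \<and> distinct xs" by (rule finite_distinct_list)
  then have "set (enum_set Y) = Y \<and> distinct (enum_set Y)"
    unfolding enum_set_def by (rule someI_ex)
  then show ?thesis using distinct_card by fastforce
qed

text \<open>
  One broadcast takes \<open>cap\<close> rounds: in round \<open>q\<close> of the block every machine sends to all others
  the encoding of the \<open>q\<close>-th message announced by its nodes. \<open>local_state p x m H s\<close> is what
  machine \<open>m\<close> with history \<open>H\<close> knows to be left of the protocol \<open>p\<close> after \<open>s\<close> broadcasts.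
\<close>

record ('x, 'l, 'a) simulation =
  nodes :: "'x \<Rightarrow> 'l set"
  protocol :: "nat \<Rightarrow> ('l, 'a) prot"
  messages :: "nat \<Rightarrow> nat list set"
  encode :: "nat \<Rightarrow> nat list \<Rightarrow> bool list"
  broadcasts :: "nat \<Rightarrow> nat"
  block :: "nat \<Rightarrow> nat \<Rightarrow> nat"
  answer :: "nat \<Rightarrow> 'x \<Rightarrow> 'a \<Rightarrow> solution"

definition announced :: "('x, 'l, 'a, 'z) simulation_scheme \<Rightarrow> ('l \<Rightarrow> nat list set) \<Rightarrow> 'x \<Rightarrow> nat list set"
  where "announced \<Sigma> e x = (\<Union>v\<in>nodes \<Sigma> x. e v)"

text \<open>Decoding asks which messages could have produced what arrived. Idle slots carry
  \<open>[]\<close>, so this is exact only for an injective \<open>encode\<close> that never takes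
  the value \<open>[]\<close>. What \<open>m\<close> itself announces is added in
  \<open>local_state\<close>.\<close>

definition received ::
  "('x, 'l, 'a, 'z) simulation_scheme \<Rightarrow> nat \<Rightarrow> nat \<Rightarrow> nat \<Rightarrow> history \<Rightarrow> nat list set" where
  "received \<Sigma> n k m H =
     {x \<in> messages \<Sigma> n. \<exists>m'<k. m' \<noteq> m \<and> (\<exists>u\<in>set H. u m' = encode \<Sigma> n x)}"

primrec local_state ::
  "('x, 'l, 'a, 'z) simulation_scheme \<Rightarrow> nat \<Rightarrow> nat \<Rightarrow> 'x \<Rightarrow> nat \<Rightarrow> history \<Rightarrow> nat \<Rightarrow> ('l, 'a) prot"
where
  "local_state \<Sigma> n k x m H 0 = protocol \<Sigma> n"
| "local_state \<Sigma> n k x m H (Suc s) = (case local_state \<Sigma> n k x m H s of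
      Ret a \<Rightarrow> Ret a
    | Bcast e c \<Rightarrow> c (announced \<Sigma> e x \<union>
        received \<Sigma> n k m (take (block \<Sigma> n k) (drop (s * block \<Sigma> n k) H))))"

text \<open>The test that the message lies in \<open>messages \<Sigma> n\<close> makes the length
  bound hold for all inputs and histories, even impossible ones, as \<open>message_length_le\<close>
  demands. The result \<open>({}, {})\<close> stands for a protocol that has not ended within its
  budget.\<close>

definition sim_algorithm :: "('x, 'l, 'a, 'z) simulation_scheme \<Rightarrow> 'x algorithm" where
  "sim_algorithm \<Sigma> = \<lparr>
     rounds = (\<lambda>n k. broadcasts \<Sigma> n * block \<Sigma> n k),
     coins = (\<lambda>n k. 0),
     send = (\<lambda>n k m x r H m'.
       case local_state \<Sigma> n k x m H (length H div block \<Sigma> n k) of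
         Ret a \<Rightarrow> []
       | Bcast e c \<Rightarrow>
           (let Y = announced \<Sigma> e x; q = length H mod block \<Sigma> n k
            in if q < card Y \<and> enum_set Y ! q \<in> messages \<Sigma> n
               then encode \<Sigma> n (enum_set Y ! q) else [])),
     result = (\<lambda>n k m x r H. case local_state \<Sigma> n k x m H (broadcasts \<Sigma> n) of
         Ret a \<Rightarrow> answer \<Sigma> n x a
       | Bcast e c \<Rightarrow> ({}, {}))\<rparr>"

section \<open>Correctness of the simulation\<close>

lemma length_history_after [simp]: "length (history_after A n k x r t m) = t"
  by (induction t) auto

lemma nth_history_after:
  "u < t \<Longrightarrow> history_after A n k x r t m ! u =
    (\<lambda>m'. if m' < k \<and> m' \<noteq> m
          then send A n k m' (x m') (r m') (history_after A n k x r u m') m else [])"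
  by (induction t) (auto simp: nth_append less_Suc_eq)

lemma message_length_sim:
  assumes "\<And>y. y \<in> messages \<Sigma> n \<Longrightarrow> real (length (encode \<Sigma> n y)) \<le> w" "0 \<le> w"
  shows "message_length_le (sim_algorithm \<Sigma>) n k w"
  using assms unfolding message_length_le_def sim_algorithm_def
  by (auto simp: Let_def split: prot.splits)

definition step_prot :: "'l set \<Rightarrow> ('l, 'a) prot \<Rightarrow> ('l, 'a) prot" where
  "step_prot V p = (case p of Ret a \<Rightarrow> Ret a | Bcast e c \<Rightarrow> c (\<Union>v\<in>V. e v))"

lemma step_prot_simps [simp]:
  "step_prot V (Ret a) = Ret a"
  "step_prot V (Bcast e c) = c (\<Union>v\<in>V. e v)"
  by (simp_all add: step_prot_def)

lemma hoare_step:
  "hoare V \<kappa> Ms p R Q \<Longrightarrow> hoare V \<kappa> Ms (step_prot V p) (R - 1) Q"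
  by (cases p) auto

lemma hoare_steps:
  "hoare V \<kappa> Ms p R Q \<Longrightarrow> hoare V \<kappa> Ms ((step_prot V ^^ s) p) (R - s) Q"
proof (induction s)
  case (Suc s)
  then show ?case using hoare_step[of V \<kappa> Ms "(step_prot V ^^ s) p" "R - s" Q] by simp
qed simp

text \<open>All machines and all later times are treated in one induction on \<open>s\<close>: the
  message in slot \<open>q\<close> of block \<open>s\<close> is computed by \<open>m'\<close> from
  its history at that moment, when its state is already the common one. The load bound lets every
  machine finish its announcements within the block.\<close>

lemma local_state_correct:
  fixes \<Sigma> :: "('x, 'l, 'a, 'z) simulation_scheme" and x :: "nat \<Rightarrow> 'x" and k n :: nat
  defines "V \<equiv> \<Union>m<k. nodes \<Sigma> (x m)" and "A \<equiv> sim_algorithm \<Sigma>"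
  assumes hoare: "hoare V \<kappa> (messages \<Sigma> n) (protocol \<Sigma> n) R Q"
    and enc: "inj_on (encode \<Sigma> n) (messages \<Sigma> n)" "[] \<notin> encode \<Sigma> n ` messages \<Sigma> n"
    and fin: "\<And>m. m < k \<Longrightarrow> finite (nodes \<Sigma> (x m))"
    and load: "\<And>m. m < k \<Longrightarrow> card (nodes \<Sigma> (x m)) * \<kappa> \<le> block \<Sigma> n k"
    and pos: "0 < block \<Sigma> n k"
    and "m < k" "s * block \<Sigma> n k \<le> t"
  shows "local_state \<Sigma> n k (x m) m (history_after A n k x r t m) s =
    (step_prot V ^^ s) (protocol \<Sigma> n)"
  using \<open>m < k\<close> \<open>s * block \<Sigma> n k \<le> t\<close>
proof (induction s arbitrary: m t)
  case (Suc s)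
  let ?c = "block \<Sigma> n k"
  let ?H = "\<lambda>t m. history_after A n k x r t m"
  have le: "s * ?c + ?c \<le> t" using Suc.prems by (simp add: add.commute)
  have IH: "local_state \<Sigma> n k (x m) m (?H t m) s = (step_prot V ^^ s) (protocol \<Sigma> n)"
    using Suc le by simp
  show ?case
  proof (cases "(step_prot V ^^ s) (protocol \<Sigma> n)")
    case (Ret a)
    then show ?thesis using IH by simp
  next
    case (Bcast e c)
    have "hoare V \<kappa> (messages \<Sigma> n) (Bcast e c) (R - s) Q"
      using hoare_steps[OF hoare, of s] Bcast by simp
    then have e: "\<And>v. v \<in> V \<Longrightarrow> e v \<subseteq> messages \<Sigma> n \<and> finite (e v) \<and> card (e v) \<le> \<kappa>" by auto
    have ann: "announced \<Sigma> e (x m') \<subseteq> messages \<Sigma> n \<and> finite (announced \<Sigma> e (x m')) \<and>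
        card (announced \<Sigma> e (x m')) \<le> ?c" if "m' < k" for m'
    proof -
      have sub: "nodes \<Sigma> (x m') \<subseteq> V" using that by (auto simp: V_def)
      have "card (announced \<Sigma> e (x m')) \<le> (\<Sum>v\<in>nodes \<Sigma> (x m'). card (e v))"
        unfolding announced_def by (rule card_UN_le[OF fin[OF that]])
      also have "\<dots> \<le> (\<Sum>v\<in>nodes \<Sigma> (x m'). \<kappa>)" by (rule sum_mono) (use e sub in auto)
      also have "\<dots> \<le> ?c" using load[OF that] by simp
      finally show ?thesis using e sub fin[OF that] by (auto simp: announced_def)
    qed
    have slice: "set (take ?c (drop (s * ?c) (?H t m))) = (\<lambda>q. ?H t m ! (s * ?c + q)) ` {..<?c}"
    proof -
      have len: "length (take ?c (drop (s * ?c) (?H t m))) = ?c" using le by simp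
      have "set (take ?c (drop (s * ?c) (?H t m))) =
        (\<lambda>q. take ?c (drop (s * ?c) (?H t m)) ! q) ` {..<?c}"
        unfolding set_conv_nth len by blast
      also have "\<dots> = (\<lambda>q. ?H t m ! (s * ?c + q)) ` {..<?c}"
        using le by (intro image_cong) auto
      finally show ?thesis .
    qed
    have sent: "(?H t m ! (s * ?c + q)) m' =
        (if q < card (announced \<Sigma> e (x m'))
         then encode \<Sigma> n (enum_set (announced \<Sigma> e (x m')) ! q) else [])"
      if "q < ?c" "m' < k" "m' \<noteq> m" for q m'
    proof -
      let ?u = "s * ?c + q" and ?Y = "announced \<Sigma> e (x m')"
      have div: "?u div ?c = s" "?u mod ?c = q" using that by auto
      have "local_state \<Sigma> n k (x m') m' (?H ?u m') s = Bcast e c"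
        using Suc.IH[of m' ?u] that Bcast by simp
      moreover have "enum_set ?Y ! q \<in> messages \<Sigma> n" if "q < card ?Y"
        using enum_set[of ?Y] ann[OF \<open>m' < k\<close>] nth_mem[of q "enum_set ?Y"] that by auto
      ultimately have "send A n k m' (x m') (r m') (?H ?u m') m =
          (if q < card ?Y then encode \<Sigma> n (enum_set ?Y ! q) else [])"
        unfolding A_def sim_algorithm_def using div by (simp add: Let_def)
      then show ?thesis using that le by (subst nth_history_after) auto
    qed
    have "received \<Sigma> n k m (take ?c (drop (s * ?c) (?H t m))) =
        (\<Union>m'\<in>{..<k} - {m}. announced \<Sigma> e (x m'))" (is "?L = ?R")
    proof (intro equalityI subsetI)
      fix y assume "y \<in> ?L"
      then obtain m' q where y: "y \<in> messages \<Sigma> n" "m' < k" "m' \<noteq> m" "q < ?c"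
        "(?H t m ! (s * ?c + q)) m' = encode \<Sigma> n y"
        unfolding received_def slice by auto
      let ?Y = "announced \<Sigma> e (x m')"
      have q: "q < card ?Y" and eq: "encode \<Sigma> n (enum_set ?Y ! q) = encode \<Sigma> n y"
        using sent[OF y(4,2,3)] y(1,5) enc(2) by (auto split: if_splits) (metis imageI)+
      have mem: "enum_set ?Y ! q \<in> ?Y"
        using q enum_set[of ?Y] ann[OF y(2)] nth_mem[of q "enum_set ?Y"] by auto
      then have "enum_set ?Y ! q = y"
        using inj_onD[OF enc(1) eq] ann[OF y(2)] y(1) by auto
      then show "y \<in> ?R" using mem y by auto
    next
      fix y assume "y \<in> ?R"
      then obtain m' where m': "m' < k" "m' \<noteq> m" and y: "y \<in> announced \<Sigma> e (x m')" by auto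
      then obtain q where q: "q < card (announced \<Sigma> e (x m'))"
        "enum_set (announced \<Sigma> e (x m')) ! q = y"
        using enum_set[of "announced \<Sigma> e (x m')"] ann[OF m'(1)] by (metis in_set_conv_nth)
      have "q < ?c" using q ann[OF m'(1)] by auto
      then have "(?H t m ! (s * ?c + q)) m' = encode \<Sigma> n y" using sent[OF _ m'] q by simp
      moreover have "y \<in> messages \<Sigma> n" using y ann[OF m'(1)] by auto
      ultimately show "y \<in> ?L" unfolding received_def slice using m' \<open>q < ?c\<close> by auto
    qed
    moreover have "announced \<Sigma> e (x m) \<union> (\<Union>m'\<in>{..<k} - {m}. announced \<Sigma> e (x m')) =
        (\<Union>v\<in>V. e v)"
      using Suc.prems by (auto simp: V_def announced_def)
    ultimately show ?thesis using IH Bcast by simp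
  qed
qed simp

theorem sim_result:
  fixes \<Sigma> :: "('x, 'l, 'a, 'z) simulation_scheme" and x :: "nat \<Rightarrow> 'x"
  assumes hoare: "hoare (\<Union>m<k. nodes \<Sigma> (x m)) \<kappa> (messages \<Sigma> n) (protocol \<Sigma> n) (broadcasts \<Sigma> n) Q"
    and "inj_on (encode \<Sigma> n) (messages \<Sigma> n)" "[] \<notin> encode \<Sigma> n ` messages \<Sigma> n"
    and "\<And>m. m < k \<Longrightarrow> finite (nodes \<Sigma> (x m))"
    and "\<And>m. m < k \<Longrightarrow> card (nodes \<Sigma> (x m)) * \<kappa> \<le> block \<Sigma> n k"
    and "0 < block \<Sigma> n k"
  shows "\<exists>a. Q a \<and> (\<forall>m<k. machine_result (sim_algorithm \<Sigma>) n k x r m = answer \<Sigma> n (x m) a)"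
proof -
  define V where "V = (\<Union>m<k. nodes \<Sigma> (x m))"
  define p where "p = (step_prot V ^^ broadcasts \<Sigma> n) (protocol \<Sigma> n)"
  have "hoare V \<kappa> (messages \<Sigma> n) p 0 Q"
    using hoare_steps[OF hoare, of "broadcasts \<Sigma> n"] by (simp add: V_def p_def)
  then obtain a where a: "p = Ret a" "Q a" by (cases p) auto
  have "machine_result (sim_algorithm \<Sigma>) n k x r m = answer \<Sigma> n (x m) a" if "m < k" for m
  proof -
    let ?t = "broadcasts \<Sigma> n * block \<Sigma> n k"
    have "local_state \<Sigma> n k (x m) m (history_after (sim_algorithm \<Sigma>) n k x r ?t m) (broadcasts \<Sigma> n) =
        Ret a"
      using local_state_correct[OF assms(1-6) that order.refl] a
      by (simp add: p_def V_def)
    then show ?thesis unfolding machine_result_def by (simp add: sim_algorithm_def)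
  qed
  then show ?thesis using a by blast
qed

section \<open>Families of samples\<close>

lemma one_add_le_powr: "0 \<le> x \<Longrightarrow> 1 + x \<le> 2 powr (2 * x)" for x :: real
proof -
  assume "0 \<le> x"
  have "1 + x \<le> exp x" by (rule exp_ge_add_one_self)
  also have "\<dots> \<le> exp (2 * x * ln 2)"
  proof -
    have "x * 1 \<le> x * (2 * ln 2)"
      using \<open>0 \<le> x\<close> ln2_ge_two_thirds by (intro mult_left_mono) auto
    then show ?thesis by simp
  qed
  finally show ?thesis by (simp add: powr_def mult.commute)
qed

text \<open>Markov's inequality for \<open>2\<close> to the number of events that happen.\<close>

lemma prob_many_events_le:
  fixes p :: "'i \<Rightarrow> 'b pmf" and \<pi> :: "'i \<Rightarrow> real"
  assumes "finite A" "\<And>x. x \<in> A \<Longrightarrow> measure_pmf.prob (p x) (E x) \<le> \<pi> x"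
  shows "measure_pmf.prob (Pi_pmf A d p) {y. T \<le> real (card {x \<in> A. y x \<in> E x})}
    \<le> 2 powr (2 * sum \<pi> A - T)"
proof -
  define f :: "'i \<Rightarrow> 'b \<Rightarrow> real" where "f = (\<lambda>x v. if v \<in> E x then 2 else 1)"
  let ?M = "Pi_pmf A d p"
  let ?S = "{y. T \<le> real (card {x \<in> A. y x \<in> E x})}"
  have int: "integrable (measure_pmf (p x)) (f x)" for x
    by (rule measure_pmf.integrable_const_bound[where B = 2]) (auto simp: f_def)
  have prod: "(\<Prod>x\<in>A. f x (y x)) = 2 ^ card {x \<in> A. y x \<in> E x}" for y
    using assms(1) by (simp add: f_def prod.If_cases Int_def)
  have exp1: "measure_pmf.expectation (p x) (f x) = 1 + measure_pmf.prob (p x) (E x)" for x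
  proof -
    have "f x = (\<lambda>v. 1 + indicator (E x) v)" by (auto simp: f_def)
    moreover have "integrable (measure_pmf (p x)) (indicator (E x) :: 'b \<Rightarrow> real)"
      by (rule measure_pmf.integrable_const_bound[where B = 1]) auto
    ultimately show ?thesis by simp
  qed
  have \<pi>: "0 \<le> \<pi> x" if "x \<in> A" for x
    using assms(2)[OF that] measure_nonneg[of "measure_pmf (p x)" "E x"] by linarith
  have "measure_pmf.expectation ?M (\<lambda>y. \<Prod>x\<in>A. f x (y x)) =
      (\<Prod>x\<in>A. measure_pmf.expectation (p x) (f x))"
    by (rule expectation_prod_Pi_pmf[OF assms(1) int]) (auto simp: f_def)
  also have "\<dots> \<le> (\<Prod>x\<in>A. 2 powr (2 * \<pi> x))"
  proof (rule prod_mono)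
    fix x assume "x \<in> A"
    then show "0 \<le> measure_pmf.expectation (p x) (f x) \<and>
        measure_pmf.expectation (p x) (f x) \<le> 2 powr (2 * \<pi> x)"
      using assms(2)[of x] one_add_le_powr[OF \<pi>[of x]] unfolding exp1
      by (auto intro: add_nonneg_nonneg)
  qed
  also have "\<dots> = 2 powr (2 * sum \<pi> A)"
    by (simp add: powr_sum sum_distrib_left)
  finally have E: "measure_pmf.expectation ?M (\<lambda>y. \<Prod>x\<in>A. f x (y x)) \<le> 2 powr (2 * sum \<pi> A)" .
  have "measure_pmf.prob ?M ?S = measure_pmf.expectation ?M (indicator ?S)" by simp
  also have "\<dots> \<le> measure_pmf.expectation ?M (\<lambda>y. 2 powr (- T) * (\<Prod>x\<in>A. f x (y x)))"
  proof (rule integral_mono)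
    show "integrable ?M (\<lambda>y. 2 powr (- T) * (\<Prod>x\<in>A. f x (y x)))"
      by (intro integrable_mult_right integrable_prod_Pi_pmf assms int)
    show "indicator ?S y \<le> 2 powr (- T) * (\<Prod>x\<in>A. f x (y x))" for y
    proof (cases "y \<in> ?S")
      case True
      then have "2 powr T \<le> 2 powr real (card {x \<in> A. y x \<in> E x})" by simp
      then have "1 \<le> 2 powr (- T) * 2 powr real (card {x \<in> A. y x \<in> E x})"
        by (simp add: powr_minus field_simps)
      then show ?thesis using True unfolding prod by (simp add: powr_realpow)
    qed (simp add: prod)
  qed (auto intro: measure_pmf.integrable_const_bound[where B = 1])
  also have "\<dots> \<le> 2 powr (- T) * 2 powr (2 * sum \<pi> A)" using E by simp
  also have "\<dots> = 2 powr (2 * sum \<pi> A - T)" by (simp add: powr_add[symmetric])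
  finally show ?thesis .
qed

text \<open>To be used for sets \<open>N\<close> of at most \<open>2 ^ s\<close> points.\<close>

definition bad_sample :: "nat \<Rightarrow> nat \<Rightarrow> nat set \<Rightarrow> nat set \<Rightarrow> bool" where
  "bad_sample K s N D \<longleftrightarrow> K < card (N \<inter> D) \<or> 2 ^ s < 2 * card N \<and> N \<inter> D = {}"

text \<open>The rate \<open>2 * \<nu> / 2 ^ s\<close> gives a mean of at most
  \<open>2 * \<nu>\<close>, so more than \<open>K\<close> hits have probability at most
  \<open>2 powr (4 * \<nu> - K)\<close>; this is where \<open>5 * \<nu> \<le> K\<close> comes from.
  If \<open>N\<close> has more than half of \<open>2 ^ s\<close> points, the mean exceeds
  \<open>\<nu>\<close>, and missing \<open>N\<close> has probability at most
  \<open>exp (- \<nu>)\<close>. The bound \<open>K < 2 ^ s\<close> keeps the rate below 1.\<close>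

lemma prob_bad_sample_le:
  fixes U :: "nat set"
  assumes "finite U" "N \<subseteq> U" "card N \<le> 2 ^ s" "1 \<le> \<nu>" "5 * \<nu> \<le> K" "K < 2 ^ s"
  shows "measure_pmf.prob (Pi_pmf U False (\<lambda>_. bernoulli_pmf (2 * real \<nu> / 2 ^ s)))
    {y. bad_sample K s N {x \<in> U. y x}} \<le> 2 * 2 powr (- real \<nu>)"
proof -
  define p where "p = 2 * real \<nu> / 2 ^ s"
  let ?M = "Pi_pmf U False (\<lambda>_. bernoulli_pmf p)"
  have "2 * \<nu> \<le> 2 ^ s" using assms by linarith
  then have "real (2 * \<nu>) \<le> 2 ^ s" by (simp only: of_nat_le_numeral_power_cancel_iff)
  then have "2 * real \<nu> \<le> 2 ^ s" by simp
  then have p: "0 \<le> p" "p \<le> 1" by (simp_all add: p_def)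
  have finN: "finite N" using assms finite_subset by blast
  have 1: "measure_pmf.prob ?M {y. K < card (N \<inter> {x \<in> U. y x})} \<le> 2 powr (- real \<nu>)"
  proof -
    define E where "E x = (if x \<in> N then {True} else {})" for x
    define \<pi> where "\<pi> x = (if x \<in> N then p else 0)" for x
    have eq: "N \<inter> {x \<in> U. y x} = {x \<in> U. y x \<in> E x}" for y
      using assms(2) by (auto simp: E_def)
    have "measure_pmf.prob ?M {y. K < card (N \<inter> {x \<in> U. y x})} \<le>
        measure_pmf.prob ?M {y. real K \<le> real (card {x \<in> U. y x \<in> E x})}"
      unfolding eq by (intro measure_pmf.finite_measure_mono) auto
    also have "\<dots> \<le> 2 powr (2 * sum \<pi> U - real K)"
    proof (rule prob_many_events_le[OF assms(1)])
      show "measure_pmf.prob (bernoulli_pmf p) (E x) \<le> \<pi> x" for x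
        using p by (simp add: E_def \<pi>_def measure_pmf_single)
    qed
    also have "sum \<pi> U = p * real (card N)"
    proof -
      have "U \<inter> {x. x \<in> N} = N" using assms(2) by auto
      then show ?thesis using assms(1) by (simp add: \<pi>_def sum.If_cases)
    qed
    also have "2 powr (2 * (p * real (card N)) - real K) \<le> 2 powr (- real \<nu>)"
    proof -
      have "real (card N) \<le> 2 ^ s" using assms(3) by simp
      then have "p * real (card N) \<le> p * 2 ^ s" using p by (intro mult_left_mono)
      also have "\<dots> = 2 * real \<nu>" by (simp add: p_def)
      finally have "p * real (card N) \<le> 2 * real \<nu>" .
      moreover have "5 * real \<nu> \<le> real K" using assms(5) by linarith
      ultimately show ?thesis by simp
    qed
    finally show ?thesis .
  qed
  have 2: "measure_pmf.prob ?M {y. 2 ^ s < 2 * card N \<and> N \<inter> {x \<in> U. y x} = {}} \<le> 2 powr (- real \<nu>)"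
  proof (cases "2 ^ s < 2 * card N")
    case True
    have "measure_pmf.prob ?M {y. 2 ^ s < 2 * card N \<and> N \<inter> {x \<in> U. y x} = {}} \<le>
        measure_pmf.prob ?M (Pi U (\<lambda>x. if x \<in> N then {False} else UNIV))"
      using assms(2) by (intro measure_pmf.finite_measure_mono) (auto simp: Pi_def)
    also have "\<dots> = (\<Prod>x\<in>U. measure_pmf.prob (bernoulli_pmf p) (if x \<in> N then {False} else UNIV))"
      by (rule measure_Pi_pmf_Pi[OF assms(1)])
    also have "\<dots> = (\<Prod>x\<in>U. if x \<in> N then 1 - p else 1)"
      using p by (intro prod.cong) (auto simp: measure_pmf_single)
    also have "\<dots> = (1 - p) ^ card N"
    proof -
      have "U \<inter> {x. x \<in> N} = N" using assms(2) by auto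
      then show ?thesis using assms(1) by (simp add: prod.If_cases)
    qed
    also have "\<dots> \<le> exp (- p) ^ card N"
      using p exp_ge_add_one_self[of "- p"] by (intro power_mono) auto
    also have "\<dots> = exp (real (card N) * - p)" by (simp only: exp_of_nat_mult)
    also have "\<dots> = exp (- (p * real (card N)))" by (simp add: mult.commute)
    also have "\<dots> \<le> exp (- real \<nu>)"
    proof -
      have "2 ^ s \<le> real (2 * card N)"
        using True by (simp only: numeral_power_le_of_nat_cancel_iff)
      then have "2 ^ s \<le> 2 * real (card N)" by simp
      then have "p * 2 ^ s \<le> p * (2 * real (card N))" using p by (intro mult_left_mono)
      then show ?thesis by (simp add: p_def)
    qed
    also have "\<dots> \<le> exp (- real \<nu> * ln 2)"
    proof -
      have "ln 2 \<le> (1::real)" using ln_2_less_1 by simp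
      then have "real \<nu> * ln 2 \<le> real \<nu> * 1" by (intro mult_left_mono) auto
      then show ?thesis by simp
    qed
    also have "\<dots> = 2 powr (- real \<nu>)" by (simp add: powr_def)
    finally show ?thesis .
  qed simp
  have "measure_pmf.prob ?M {y. bad_sample K s N {x \<in> U. y x}} \<le>
      measure_pmf.prob ?M {y. K < card (N \<inter> {x \<in> U. y x})} +
      measure_pmf.prob ?M {y. 2 ^ s < 2 * card N \<and> N \<inter> {x \<in> U. y x} = {}}"
    by (rule order_trans[OF measure_pmf.finite_measure_mono measure_Un_le])
       (auto simp: bad_sample_def)
  then show ?thesis using 1 2 by (simp add: p_def)
qed

text \<open>Probabilistic method with \<open>2 ^ q\<close> independent samples. Taking
  \<open>l + 4\<close> for \<open>\<nu>\<close> makes one sample bad for \<open>N\<close> with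
  probability at most 1 / (8 n), so a 1 / n fraction of bad ones has probability at most 2 to the
  power - (3/4) 2^q / n. This beats the union bound over the subsets of \<open>U\<close>, because
  \<open>2 ^ q\<close> is at least \<open>n ^ (c + 4)\<close>.\<close>

lemma sample_family_exists:
  fixes U :: "nat set"
  assumes U: "finite U" "card U + 1 \<le> n ^ (c + 2)" and n: "2 \<le> n" "n \<le> 2 ^ l"
    and K: "5 * (l + 4) \<le> K" and q: "q = (c + 4) * l"
  shows "\<exists>D :: nat \<Rightarrow> nat set. \<forall>N \<subseteq> U. card N \<le> 2 ^ s \<longrightarrow>
    card {\<sigma>. \<sigma> < 2 ^ q \<and> bad_sample K s N (D \<sigma>)} * n < 2 ^ q"
proof (cases "K < 2 ^ s")
  \<comment> \<open>For \<open>K\<close> at least \<open>2 ^ s\<close> the whole of \<open>U\<close>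
    serves as the sample, since no admissible \<open>N\<close> has more than \<open>K\<close>
    points.\<close>
  case False
  have "\<not> bad_sample K s N U" if "N \<subseteq> U" "card N \<le> 2 ^ s" for N
    using that False by (auto simp: bad_sample_def Int_absorb2)
  then show ?thesis by (intro exI[of _ "\<lambda>_. U"]) auto
next
  case True
  define P where "P = map_pmf (\<lambda>y. {x \<in> U. y x})
    (Pi_pmf U False (\<lambda>_. bernoulli_pmf (2 * real (l + 4) / 2 ^ s)))"
  define M where "M = Pi_pmf {..<2 ^ q} {} (\<lambda>_::nat. P)"
  define \<N> where "\<N> = {N. N \<subseteq> U \<and> card N \<le> 2 ^ s}"
  define Q :: real where "Q = 2 ^ q"
  have nl: "real n \<le> 2 ^ l" using n(2) by simp
  have one: "measure_pmf.prob P {D. bad_sample K s N D} \<le> 1 / (8 * real n)" if "N \<in> \<N>" for N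
  proof -
    have "measure_pmf.prob P {D. bad_sample K s N D} \<le> 2 * 2 powr (- real (l + 4))"
      unfolding P_def measure_map_pmf vimage_def
      using prob_bad_sample_le[of U N s "l + 4" K] that U K True by (simp add: \<N>_def)
    also have "2 powr (- real (l + 4)) = 1 / 2 ^ (l + 4)"
      by (simp only: powr_minus_divide powr_realpow zero_less_numeral)
    also have "2 * (1 / 2 ^ (l + 4)) = (1 / (8 * 2 ^ l) :: real)" by (simp add: power_add)
    also have "\<dots> \<le> 1 / (8 * real n)" using nl n by (intro divide_left_mono) auto
    finally show ?thesis .
  qed
  let ?B = "\<lambda>N. {F. Q / real n \<le> real (card {\<sigma> \<in> {..<(2::nat) ^ q}. F \<sigma> \<in> {D. bad_sample K s N D}})}"
  have two: "measure_pmf.prob M (?B N) \<le> 2 powr (- (3 / 4) * Q / real n)" if "N \<in> \<N>" for N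
  proof -
    have "measure_pmf.prob M (?B N) \<le>
        2 powr (2 * (\<Sum>\<sigma>\<in>{..<2 ^ q::nat}. 1 / (8 * real n)) - Q / real n)"
      unfolding M_def by (rule prob_many_events_le) (use one[OF that] in auto)
    also have "2 * (\<Sum>\<sigma>\<in>{..<2 ^ q::nat}. 1 / (8 * real n)) - Q / real n = - (3 / 4) * Q / real n"
      using n by (simp add: Q_def field_simps)
    finally show ?thesis .
  qed
  have fin: "finite \<N>" and "\<N> \<subseteq> Pow U" using U by (auto simp: \<N>_def)
  then have card\<N>: "real (card \<N>) \<le> 2 powr real (card U)"
    using card_mono[of "Pow U" \<N>] U
    by (simp add: card_Pow powr_realpow)
  have Qn: "real (card U) < (3 / 4) * Q / real n"
  proof -
    have "real n ^ (c + 4) \<le> (2 ^ l) ^ (c + 4)" using nl by (intro power_mono) auto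
    also have "\<dots> = Q" unfolding Q_def q by (simp only: power_mult[symmetric] mult.commute)
    finally have "real n ^ (c + 4) / real n \<le> Q / real n" by (intro divide_right_mono) auto
    moreover have "real n ^ (c + 4) / real n = real n ^ (c + 2) * real n"
      using n by (simp add: power_add power2_eq_square eval_nat_numeral)
    moreover have "real n ^ (c + 2) * 2 \<le> real n ^ (c + 2) * real n"
      using n by (intro mult_left_mono) auto
    moreover have "real (card U) + 1 \<le> real n ^ (c + 2)"
    proof -
      have "real (card U + 1) \<le> real (n ^ (c + 2))" using U(2) by (simp only: of_nat_le_iff)
      then show ?thesis by simp
    qed
    ultimately show ?thesis by simp
  qed
  have "measure_pmf.prob M (\<Union>N\<in>\<N>. ?B N) \<le> (\<Sum>N\<in>\<N>. measure_pmf.prob M (?B N))"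
    by (rule measure_pmf.finite_measure_subadditive_finite[OF fin]) auto
  also have "\<dots> \<le> (\<Sum>N\<in>\<N>. 2 powr (- (3 / 4) * Q / real n))" by (rule sum_mono) (rule two)
  also have "\<dots> = real (card \<N>) * 2 powr (- (3 / 4) * Q / real n)" by simp
  also have "\<dots> \<le> 2 powr real (card U) * 2 powr (- (3 / 4) * Q / real n)"
    using card\<N> by (intro mult_right_mono) auto
  also have "\<dots> = 2 powr (real (card U) - (3 / 4) * Q / real n)" by (simp add: powr_add[symmetric])
  also have "\<dots> < 2 powr 0" using Qn by (intro powr_less_mono) auto
  finally have "measure_pmf.prob M (\<Union>N\<in>\<N>. ?B N) < 1" by simp
  then have "(\<Union>N\<in>\<N>. ?B N) \<noteq> UNIV" by auto
  then obtain F where F: "\<And>N. N \<in> \<N> \<Longrightarrow> F \<notin> ?B N" by auto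
  have "card {\<sigma>. \<sigma> < 2 ^ q \<and> bad_sample K s N (F \<sigma>)} * n < 2 ^ q" if "N \<subseteq> U" "card N \<le> 2 ^ s" for N
  proof -
    have "real (card {\<sigma>. \<sigma> < 2 ^ q \<and> bad_sample K s N (F \<sigma>)}) < Q / real n"
      using F[of N] that by (simp add: \<N>_def)
    then have "real (card {\<sigma>. \<sigma> < 2 ^ q \<and> bad_sample K s N (F \<sigma>)} * n) < real (2 ^ q)"
      using n by (simp add: Q_def field_simps)
    then show ?thesis by (simp only: of_nat_less_iff)
  qed
  then show ?thesis by blast
qed

lemma prob_overload_le:
  assumes "finite A" "1 \<le> k" "m < k" "2 * real (card A) / real k + real s \<le> real T"
  shows "measure_pmf.prob (Pi_pmf A 0 (\<lambda>_. pmf_of_set {..<k})) {h. T \<le> card {x \<in> A. h x = m}}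
    \<le> 1 / 2 ^ s"
proof -
  have "measure_pmf.prob (Pi_pmf A 0 (\<lambda>_. pmf_of_set {..<k}))
      {h. real T \<le> real (card {x \<in> A. h x \<in> {m}})} \<le> 2 powr (2 * (\<Sum>x\<in>A. 1 / real k) - real T)"
    by (rule prob_many_events_le[OF assms(1)]) (use assms in \<open>auto simp: measure_pmf_of_set lessThan_empty_iff\<close>)
  also have "\<dots> \<le> 2 powr (- real s)" using assms(4) by simp
  also have "\<dots> = 1 / 2 ^ s" by (simp add: powr_minus powr_realpow field_simps)
  finally show ?thesis by simp
qed

section \<open>Construction of the net\<close>

text \<open>Both problems share one type of nodes; the last argument of a client is its penalty, set
  to 0 in the robust problem. The partial maps are the distances known to the host.\<close>

datatype node = Fac nat real "nat \<rightharpoonup> real" | Cli nat "nat \<rightharpoonup> real" real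

primrec fac_says :: "(nat \<Rightarrow> real \<Rightarrow> (nat \<rightharpoonup> real) \<Rightarrow> nat list set) \<Rightarrow> node \<Rightarrow> nat list set" where
  "fac_says \<phi> (Fac i a \<delta>) = \<phi> i a \<delta>"
| "fac_says \<phi> (Cli j \<delta> u) = {}"

primrec cli_says :: "(nat \<Rightarrow> (nat \<rightharpoonup> real) \<Rightarrow> real \<Rightarrow> nat list set) \<Rightarrow> node \<Rightarrow> nat list set" where
  "cli_says \<phi> (Fac i a \<delta>) = {}"
| "cli_says \<phi> (Cli j \<delta> u) = \<phi> j \<delta> u"

definition Msgs :: "nat \<Rightarrow> nat list set" where
  "Msgs \<beta> = {xs. set xs \<subseteq> {..<2 ^ \<beta>} \<and> length xs \<le> 5}"

text \<open>
  Binary search for a \<open>\<sigma>\<close> that is bad for no client. It succeeds if there are fewer bad pairs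
  \<open>(j, \<sigma>)\<close> than seeds \<open>\<sigma>\<close>, since halving the interval at least halves the number of bad pairs.
\<close>

primrec search :: "(nat \<Rightarrow> (nat \<rightharpoonup> real) \<Rightarrow> nat \<Rightarrow> bool) \<Rightarrow> nat \<Rightarrow> nat \<Rightarrow> (node, nat) prot" where
  "search b 0 y = Ret y"
| "search b (Suc r) y = Bcast
     (cli_says (\<lambda>j \<delta> u. {[j, card {\<sigma> \<in> {y..<y + 2 ^ r}. b j \<delta> \<sigma>},
                            card {\<sigma> \<in> {y + 2 ^ r..<y + 2 ^ Suc r}. b j \<delta> \<sigma>}]}))
     (\<lambda>P. search b r (if (\<Sum>x\<in>P. x ! 1) \<le> (\<Sum>x\<in>P. x ! 2) then y else y + 2 ^ r))"

definition max_packing :: "(nat \<times> nat) set \<Rightarrow> nat set \<Rightarrow> nat set" where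
  "max_packing inc D = (SOME M. M \<subseteq> D \<and>
     (\<forall>i\<in>M. \<forall>i'\<in>M. \<forall>j. i \<noteq> i' \<longrightarrow> (j, i) \<in> inc \<longrightarrow> (j, i') \<notin> inc) \<and>
     (\<forall>i\<in>D. i \<in> M \<or> (\<exists>i'\<in>M. \<exists>j. (j, i) \<in> inc \<and> (j, i') \<in> inc)))"

lemma max_packing:
  assumes "finite D"
  shows "max_packing inc D \<subseteq> D"
    and "\<lbrakk>i \<in> max_packing inc D; i' \<in> max_packing inc D; i \<noteq> i'; (j, i) \<in> inc\<rbrakk> \<Longrightarrow> (j, i') \<notin> inc"
    and "i \<in> D \<Longrightarrow> i \<in> max_packing inc D \<or>
          (\<exists>i'\<in>max_packing inc D. \<exists>j. (j, i) \<in> inc \<and> (j, i') \<in> inc)"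
proof -
  define ok where "ok M \<longleftrightarrow> M \<subseteq> D \<and>
    (\<forall>i\<in>M. \<forall>i'\<in>M. \<forall>j. i \<noteq> i' \<longrightarrow> (j, i) \<in> inc \<longrightarrow> (j, i') \<notin> inc)" for M
  have "finite {M. ok M}" by (rule finite_subset[of _ "Pow D"]) (use assms in \<open>auto simp: ok_def\<close>)
  moreover have "ok {}" by (simp add: ok_def)
  ultimately obtain M where M: "ok M" "\<And>M'. ok M' \<Longrightarrow> M \<subseteq> M' \<Longrightarrow> M = M'"
    using finite_has_maximal[of "{M. ok M}"] by auto
  have "i \<in> M \<or> (\<exists>i'\<in>M. \<exists>j. (j, i) \<in> inc \<and> (j, i') \<in> inc)" if "i \<in> D" for i
  proof (rule ccontr)
    assume neg: "\<not> ?thesis"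
    then have "ok (insert i M)" using M(1) that unfolding ok_def by blast
    then show False using M(2) neg by blast
  qed
  then have "\<exists>M. M \<subseteq> D \<and>
     (\<forall>i\<in>M. \<forall>i'\<in>M. \<forall>j. i \<noteq> i' \<longrightarrow> (j, i) \<in> inc \<longrightarrow> (j, i') \<notin> inc) \<and>
     (\<forall>i\<in>D. i \<in> M \<or> (\<exists>i'\<in>M. \<exists>j. (j, i) \<in> inc \<and> (j, i') \<in> inc))"
    using M(1) unfolding ok_def by blast
  note * = someI_ex[OF this, folded max_packing_def]
  show "max_packing inc D \<subseteq> D"
    and "\<lbrakk>i \<in> max_packing inc D; i' \<in> max_packing inc D; i \<noteq> i'; (j, i) \<in> inc\<rbrakk> \<Longrightarrow> (j, i') \<notin> inc"
    and "i \<in> D \<Longrightarrow> i \<in> max_packing inc D \<or>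
          (\<exists>i'\<in>max_packing inc D. \<exists>j. (j, i) \<in> inc \<and> (j, i') \<in> inc)"
    using * by blast+
qed

text \<open>
  All numbers are rounded up to one of the levels \<open>L t\<close>. Level \<open>0\<close> is exact, so rounding loses a factor
  of at most \<open>2\<close> also for numbers that may be zero.
\<close>

locale params =
  fixes \<epsilon> :: real and T l K q :: nat and samples :: "nat \<Rightarrow> nat \<Rightarrow> nat set"
begin

definition L :: "nat \<Rightarrow> real" where
  "L t = (if t = 0 then 0 else 2 ^ t * \<epsilon>)"

text \<open>Which facilities of level \<open>t\<close> are still in play can be answered locally:
  \<open>X\<close> is a public set of clients, and each host knows the ball of its facility.\<close>

definition ask_active ::
  "nat \<Rightarrow> (nat \<times> nat) set \<Rightarrow> nat set \<Rightarrow> (nat set \<Rightarrow> (node, 'b) prot) \<Rightarrow> (node, 'b) prot"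
where
  "ask_active t levs X rest = Bcast
     (fac_says (\<lambda>i a \<delta>. if (i, t) \<in> levs \<and> (\<forall>j\<in>dom \<delta>. the (\<delta> j) < L t \<longrightarrow> j \<notin> X) then {[i]} else {}))
     (\<lambda>P. rest {i. [i] \<in> P})"

definition near :: "nat \<Rightarrow> nat set \<Rightarrow> (nat \<rightharpoonup> real) \<Rightarrow> nat set" where
  "near t A \<delta> = {i \<in> A \<inter> dom \<delta>. the (\<delta> i) < L t}"

definition phase ::
  "nat \<Rightarrow> (nat \<times> nat) set \<Rightarrow> nat \<Rightarrow> nat set \<times> nat set \<Rightarrow> (node, nat set \<times> nat set) prot"
where
  "phase t levs s = (\<lambda>(S, X). ask_active t levs X (\<lambda>A.
     bind_prot (search (\<lambda>j \<delta> \<sigma>. bad_sample K s (near t A \<delta>) (samples s \<sigma>)) q 0) (\<lambda>\<sigma>.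
     Bcast (cli_says (\<lambda>j \<delta> u. (\<lambda>i. [j, i]) ` (near t A \<delta> \<inter> samples s \<sigma>)))
       (\<lambda>P. Ret (S \<union> max_packing {(j, i). [j, i] \<in> P} (A \<inter> samples s \<sigma>),
                 X \<union> fst ` {(j, i). [j, i] \<in> P})))))"

text \<open>The phases run through \<open>s = l, ..., 0\<close>. The last question adds the
  facilities whose ball of radius \<open>L t\<close> contains no client; with the radii
  \<open>lev pl\<close> used later these can only be free facilities of level 0.\<close>

definition level :: "(nat \<times> nat) set \<Rightarrow> nat \<Rightarrow> nat set \<Rightarrow> (node, nat set) prot" where
  "level levs t S = Bcast
     (cli_says (\<lambda>j \<delta> u. if \<exists>i\<in>S \<inter> dom \<delta>. the (\<delta> i) \<le> L t then {[j]} else {}))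
     (\<lambda>P. bind_prot (loop_prot (\<lambda>r. phase t levs (l - r)) (l + 1) (S, {j. [j] \<in> P}))
       (\<lambda>(S, X). ask_active t levs X (\<lambda>A. Ret (S \<union> A))))"

definition net_rounds :: nat where
  "net_rounds = (T + 1) * ((l + 1) * (q + 2) + 2)"

end

text \<open>The bounds on \<open>\<beta>\<close> and \<open>\<kappa>\<close> are dictated by the
  messages: numbers sent are names, cutoffs up to \<open>Suc v\<close> for a name \<open>v\<close>,
  levels up to \<open>T + 1\<close> and counts of seeds; a client names up to \<open>K\<close>
  sampled balls, or sends one message for each of \<open>T + 2\<close> thresholds and
  \<open>T + 1\<close> distance levels. The factor \<open>n\<close> in \<open>small\<close> serves
  \<open>lev_neq_1\<close>.\<close>

locale fl_nodes = params \<epsilon> T l K q samples + Metric_space "F \<union> C" d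
  for \<epsilon> T l K q samples and F C :: "nat set" and d :: "nat \<Rightarrow> nat \<Rightarrow> real" +
  fixes f :: "nat \<Rightarrow> real" and pen :: "nat \<Rightarrow> real" and n \<beta> \<kappa> :: nat
  assumes fin: "finite F" "finite C" and card_FC: "card F = n" "card C = n"
    and n: "2 \<le> n" "n \<le> 2 ^ l"
    and names: "\<And>v. v \<in> F \<union> C \<Longrightarrow> Suc v < 2 ^ \<beta>"
    and eps: "0 < \<epsilon>" and q_less: "q < \<beta>" and T: "0 < T" "T + 1 < 2 ^ \<beta>"
    and \<kappa>: "1 \<le> \<kappa>" "K \<le> \<kappa>" "(T + 2) * (T + 1) \<le> \<kappa>"
    and samples: "\<And>s N. N \<subseteq> F \<Longrightarrow> card N \<le> 2 ^ s \<Longrightarrow>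
      card {\<sigma>. \<sigma> < 2 ^ q \<and> bad_sample K s N (samples s \<sigma>)} * n < 2 ^ q"
    and f_nonneg: "\<And>i. i \<in> F \<Longrightarrow> 0 \<le> f i"
    and small: "\<And>i. i \<in> F \<Longrightarrow> 0 < f i \<Longrightarrow> 2 * \<epsilon> * real n < f i"
      "\<And>i j. i \<in> F \<Longrightarrow> j \<in> C \<Longrightarrow> 0 < d i j \<Longrightarrow> 2 * \<epsilon> \<le> d i j"
    and big: "\<And>i j. i \<in> F \<Longrightarrow> j \<in> C \<Longrightarrow> f i + d i j \<le> 2 ^ T * \<epsilon>"
    and pen: "\<And>j. j \<in> C \<Longrightarrow> pen j = 0 \<or> 2 * \<epsilon> \<le> pen j" "\<And>j. j \<in> C \<Longrightarrow> pen j \<le> 2 ^ T * \<epsilon>"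
begin

section \<open>Doubling levels and elementary announcements\<close>

lemma L_0 [simp]: "L 0 = 0" by (simp add: L_def)

lemma L_nonneg [simp]: "0 \<le> L t" using eps by (simp add: L_def)

lemma L_mono: "s \<le> t \<Longrightarrow> L s \<le> L t"
proof -
  assume "s \<le> t"
  then have "(2::real) ^ s \<le> 2 ^ t" by simp
  then show ?thesis using eps \<open>s \<le> t\<close> by (auto simp: L_def)
qed

lemma L_strict_mono: "s < t \<Longrightarrow> L s < L t"
  using eps by (auto simp: L_def)

text \<open>Only the step from 0 to \<open>L 1\<close> fails to double; at \<open>t = 0\<close> the
  truncated predecessor gives \<open>0 = 2 * 0\<close>.\<close>

lemma L_pred: "t \<noteq> 1 \<Longrightarrow> L t = 2 * L (t - 1)"
  by (cases t) (auto simp: L_def)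

definition fnode :: "nat \<Rightarrow> node" where
  "fnode i = Fac i (f i) ((\<lambda>j. Some (d i j)) |` C)"

definition cnode :: "nat \<Rightarrow> node" where
  "cnode j = Cli j ((\<lambda>i. Some (d i j)) |` F) (pen j)"

definition V :: "node set" where
  "V = fnode ` F \<union> cnode ` C"

abbreviation protocol_holds :: "(node, 'b) prot \<Rightarrow> nat \<Rightarrow> ('b \<Rightarrow> bool) \<Rightarrow> bool" where
  "protocol_holds \<equiv> hoare V \<kappa> (Msgs \<beta>)"

lemma UN_V: "(\<Union>v\<in>V. e v) = (\<Union>i\<in>F. e (fnode i)) \<union> (\<Union>j\<in>C. e (cnode j))"
  by (auto simp: V_def)

lemma says_fnode [simp]:
  "fac_says \<phi> (fnode i) = \<phi> i (f i) ((\<lambda>j. Some (d i j)) |` C)" "cli_says \<psi> (fnode i) = {}"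
  by (simp_all add: fnode_def)

lemma says_cnode [simp]:
  "fac_says \<phi> (cnode j) = {}" "cli_says \<psi> (cnode j) = \<psi> j ((\<lambda>i. Some (d i j)) |` F) (pen j)"
  by (simp_all add: cnode_def)

lemma holds_fac_says:
  assumes "\<And>i. i \<in> F \<Longrightarrow> \<phi> i (f i) ((\<lambda>j. Some (d i j)) |` C) \<subseteq> Msgs \<beta> \<and>
      finite (\<phi> i (f i) ((\<lambda>j. Some (d i j)) |` C)) \<and> card (\<phi> i (f i) ((\<lambda>j. Some (d i j)) |` C)) \<le> \<kappa>"
    and "protocol_holds (c (\<Union>i\<in>F. \<phi> i (f i) ((\<lambda>j. Some (d i j)) |` C))) R Q"
  shows "protocol_holds (Bcast (fac_says \<phi>) c) (Suc R) Q"
proof (rule hoare_Bcast)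
  show "fac_says \<phi> v \<subseteq> Msgs \<beta> \<and> finite (fac_says \<phi> v) \<and> card (fac_says \<phi> v) \<le> \<kappa>"
    if "v \<in> V" for v
    using that assms(1) unfolding V_def by (elim UnE imageE) simp_all
qed (use assms(2) in \<open>simp add: UN_V\<close>)

lemma holds_cli_says:
  assumes "\<And>j. j \<in> C \<Longrightarrow> \<psi> j ((\<lambda>i. Some (d i j)) |` F) (pen j) \<subseteq> Msgs \<beta> \<and>
      finite (\<psi> j ((\<lambda>i. Some (d i j)) |` F) (pen j)) \<and>
      card (\<psi> j ((\<lambda>i. Some (d i j)) |` F) (pen j)) \<le> \<kappa>"
    and "protocol_holds (c (\<Union>j\<in>C. \<psi> j ((\<lambda>i. Some (d i j)) |` F) (pen j))) R Q"
  shows "protocol_holds (Bcast (cli_says \<psi>) c) (Suc R) Q"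
proof (rule hoare_Bcast)
  show "cli_says \<psi> v \<subseteq> Msgs \<beta> \<and> finite (cli_says \<psi> v) \<and> card (cli_says \<psi> v) \<le> \<kappa>"
    if "v \<in> V" for v
    using that assms(1) unfolding V_def by (elim UnE imageE) simp_all
qed (use assms(2) in \<open>simp add: UN_V\<close>)

lemma dom_restrict_Some [simp]: "dom ((\<lambda>x. Some (h x)) |` A) = A"
  by (auto simp: dom_def restrict_map_def)

lemma name_less: "v \<in> F \<union> C \<Longrightarrow> v < 2 ^ \<beta>"
  using names by (meson Suc_lessD)

lemma search_holds:
  assumes "(\<Sum>j\<in>C. card {\<sigma> \<in> {y..<y + 2 ^ r}. b j ((\<lambda>i. Some (d i j)) |` F) \<sigma>}) < 2 ^ r" "r \<le> q"
  shows "protocol_holds (search b r y) r (\<lambda>\<sigma>. \<forall>j\<in>C. \<not> b j ((\<lambda>i. Some (d i j)) |` F) \<sigma>)"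
  using assms
proof (induction r arbitrary: y)
  case 0
  have "card {\<sigma> \<in> {y..<y + 2 ^ 0}. b j ((\<lambda>i. Some (d i j)) |` F) \<sigma>} = 0" if "j \<in> C" for j
    using 0 fin that by simp
  then show ?case by auto
next
  case (Suc r)
  let ?b = "\<lambda>j. b j ((\<lambda>i. Some (d i j)) |` F)"
  define a1 where "a1 j = card {\<sigma> \<in> {y..<y + 2 ^ r}. ?b j \<sigma>}" for j
  define a2 where "a2 j = card {\<sigma> \<in> {y + 2 ^ r..<y + 2 ^ Suc r}. ?b j \<sigma>}" for j
  have "(2::nat) ^ r < 2 ^ \<beta>" using Suc.prems q_less by (intro power_strict_increasing) auto
  moreover have "a1 j \<le> 2 ^ r" for j
    unfolding a1_def by (rule order_trans[OF card_mono[of "{y..<y + 2 ^ r}"]]) auto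
  moreover have "a2 j \<le> 2 ^ r" for j
    unfolding a2_def by (rule order_trans[OF card_mono[of "{y + 2 ^ r..<y + 2 ^ Suc r}"]]) auto
  ultimately have a_less: "a1 j < 2 ^ \<beta>" "a2 j < 2 ^ \<beta>" for j
    by (meson le_less_trans)+
  have split: "card {\<sigma> \<in> {y..<y + 2 ^ Suc r}. ?b j \<sigma>} = a1 j + a2 j" for j
    unfolding a1_def a2_def by (subst card_Un_disjoint[symmetric]) (auto intro!: arg_cong[where f = card])
  let ?P = "\<Union>j\<in>C. {[j, a1 j, a2 j]}"
  have P: "?P = (\<lambda>j. [j, a1 j, a2 j]) ` C" by auto
  \<comment> \<open>The client name keeps equal counts of different clients apart, since the
    announcements are merged into one set.\<close>
  have inj: "inj_on (\<lambda>j. [j, a1 j, a2 j]) C" by (auto simp: inj_on_def)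
  have sums: "(\<Sum>x\<in>?P. x ! 1) = sum a1 C" "(\<Sum>x\<in>?P. x ! 2) = sum a2 C"
    unfolding P by (simp_all add: sum.reindex[OF inj])
  have total: "sum a1 C + sum a2 C < 2 * 2 ^ r"
    using Suc.prems(1) unfolding split by (simp add: sum.distrib)
  have "protocol_holds (search b r (if sum a1 C \<le> sum a2 C then y else y + 2 ^ r)) r
      (\<lambda>\<sigma>. \<forall>j\<in>C. \<not> ?b j \<sigma>)"
  proof (rule Suc.IH)
    show "(\<Sum>j\<in>C. card {\<sigma> \<in> {(if sum a1 C \<le> sum a2 C then y else y + 2 ^ r)..<
        (if sum a1 C \<le> sum a2 C then y else y + 2 ^ r) + 2 ^ r}. ?b j \<sigma>}) < 2 ^ r"
      using total by (auto simp: a1_def a2_def mult_2 add.assoc)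
  qed (use Suc.prems in simp)
  note IH = this
  show ?case
    unfolding search.simps
  proof (rule holds_cli_says, goal_cases)
    case (1 j)
    then show ?case
      unfolding a1_def[symmetric] a2_def[symmetric] using a_less name_less \<kappa> by (simp add: Msgs_def)
  next
    case 2
    show ?case unfolding a1_def[symmetric] a2_def[symmetric] sums by (rule IH)
  qed
qed

section \<open>Separation and covering: the invariants of the net\<close>

context
  fixes F0 :: "nat set" and lev :: "nat \<Rightarrow> nat"
begin

text \<open>More than disjointness of the balls: the larger of the two radii counts around both
  centres. This lets \<open>representative\<close> bound the share paid to a large ball by the
  distance to the centre of a smaller one.\<close>

definition separated :: "nat set \<Rightarrow> bool" where
  "separated S \<longleftrightarrow> (\<forall>i\<in>S. \<forall>i'\<in>S. \<forall>j\<in>C. i \<noteq> i' \<longrightarrow> lev i' \<le> lev i \<longrightarrow> d i j < L (lev i) \<longrightarrow>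
     L (lev i) \<le> d i' j)"

definition covers_below :: "nat \<Rightarrow> nat set \<Rightarrow> bool" where
  "covers_below t S \<longleftrightarrow>
     (\<forall>i\<in>F0. lev i < t \<longrightarrow> (\<exists>i'\<in>S. lev i' \<le> lev i \<and> d i i' \<le> 4 * L (lev i)))"

abbreviation levels_of :: "(nat \<times> nat) set" where
  "levels_of \<equiv> (\<lambda>i. (i, lev i)) ` F0"

definition activef :: "nat \<Rightarrow> nat set \<Rightarrow> nat set" where
  "activef t X = {i \<in> F0. lev i = t \<and> (\<forall>j\<in>C. d i j < L t \<longrightarrow> j \<notin> X)}"

definition nbh :: "nat \<Rightarrow> nat set \<Rightarrow> nat \<Rightarrow> nat set" where
  "nbh t X j = {i \<in> activef t X. d i j < L t}"

text \<open>The factor 2 in the last clause makes the bound 1, and so the number of balls 0, after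
  \<open>l + 1\<close> phases. That \<open>X\<close> contains all clients within \<open>L t\<close>
  of \<open>S\<close> separates the new facilities from the old ones.\<close>

definition phase_inv :: "nat \<Rightarrow> nat \<Rightarrow> nat set \<times> nat set \<Rightarrow> bool" where
  "phase_inv t r = (\<lambda>(S, X). S \<subseteq> F0 \<and> (\<forall>i\<in>S. lev i \<le> t) \<and> covers_below t S \<and> separated S \<and>
     (\<forall>j\<in>X. j \<in> C \<and> (\<exists>i\<in>S. d i j \<le> 3 * L t)) \<and>
     (\<forall>i\<in>S. \<forall>j\<in>C. d i j < L t \<longrightarrow> j \<in> X) \<and>
     (\<forall>j\<in>C. 2 * card (nbh t X j) \<le> 2 ^ (l + 1 - r)))"

definition level_inv :: "nat \<Rightarrow> nat set \<Rightarrow> bool" where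
  "level_inv t S \<longleftrightarrow> S \<subseteq> F0 \<and> (\<forall>i\<in>S. lev i < t) \<and> covers_below t S \<and> separated S"

definition net :: "nat set \<Rightarrow> bool" where
  "net S \<longleftrightarrow> S \<subseteq> F0 \<and> separated S \<and>
    (\<forall>i\<in>F0. \<exists>i'\<in>S. lev i' \<le> lev i \<and> d i i' \<le> 4 * L (lev i))"

context
  assumes F0: "F0 \<subseteq> F"
begin

lemma ask_active_holds:
  assumes "protocol_holds (rest (activef t X)) R Q"
  shows "protocol_holds (ask_active t levels_of X rest) (Suc R) Q"
  unfolding ask_active_def
proof (rule holds_fac_says)
  let ?\<phi> = "\<lambda>i \<delta>. if (i, t) \<in> levels_of \<and>
    (\<forall>j\<in>dom \<delta>. the (\<delta> j) < L t \<longrightarrow> j \<notin> X) then {[i]} else {}"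
  have "{i. [i] \<in> (\<Union>i\<in>F. ?\<phi> i ((\<lambda>j. Some (d i j)) |` C))} = activef t X"
    using F0 by (auto simp: activef_def split: if_splits)
  then show "protocol_holds (rest {i. [i] \<in> (\<Union>i\<in>F. ?\<phi> i ((\<lambda>j. Some (d i j)) |` C))}) R Q"
    using assms by simp
qed (use name_less \<kappa> in \<open>auto simp: Msgs_def\<close>)

lemma phase_holds:
  assumes inv: "phase_inv t r (S, X)" and r: "r \<le> l"
  shows "protocol_holds (phase t levels_of (l - r) (S, X)) (q + 2) (phase_inv t (Suc r))"
proof -
  define s where "s = l - r"
  define A where "A = activef t X"
  have A: "A \<subseteq> F0" "A \<subseteq> F" using F0 by (auto simp: A_def activef_def)
  have finA: "finite A" using A fin finite_subset by blast
  have near: "near t A ((\<lambda>i. Some (d i j)) |` F) = nbh t X j" for j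
    using A by (auto simp: near_def nbh_def A_def)
  have nbhF: "nbh t X j \<subseteq> F" and fin_nbh: "finite (nbh t X j)" for j
    using A finA by (auto simp: nbh_def A_def)
  have "l + 1 - r = Suc s" using r by (simp add: s_def)
  then have deg: "card (nbh t X j) \<le> 2 ^ s" if "j \<in> C" for j
    using inv that by (auto simp: phase_inv_def)
  let ?b = "\<lambda>j \<delta> \<sigma>. bad_sample K s (near t A \<delta>) (samples s \<sigma>)"
  \<comment> \<open>Each client rejects fewer than \<open>2 ^ q / n\<close> seeds and there are
    \<open>n\<close> clients, so there are fewer bad pairs than seeds, as the binary search
    requires.\<close>
  have "(\<Sum>j\<in>C. card {\<sigma> \<in> {0..<0 + 2 ^ q}. ?b j ((\<lambda>i. Some (d i j)) |` F) \<sigma>}) < 2 ^ q"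
  proof -
    let ?c = "\<lambda>j. card {\<sigma>. \<sigma> < 2 ^ q \<and> bad_sample K s (nbh t X j) (samples s \<sigma>)}"
    have "C \<noteq> {}" using card_FC n by auto
    then have "(\<Sum>j\<in>C. ?c j * n) < (\<Sum>j\<in>C. 2 ^ q)"
      by (intro sum_strict_mono fin samples nbhF deg)
    moreover have "(\<Sum>j\<in>C. ?c j * n) = sum ?c C * n" by (simp only: sum_distrib_right)
    moreover have "(\<Sum>j\<in>C. 2 ^ q) = 2 ^ q * n" using card_FC by simp
    ultimately have "sum ?c C < 2 ^ q" by (simp only: mult_less_cancel2)
    then show ?thesis by (simp add: near)
  qed
  then have search: "protocol_holds (search ?b q 0) q
      (\<lambda>\<sigma>. \<forall>j\<in>C. \<not> bad_sample K s (nbh t X j) (samples s \<sigma>))"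
    using search_holds[of 0 q ?b] by (simp add: near)
  have final: "protocol_holds (Bcast (cli_says (\<lambda>j \<delta> u. (\<lambda>i. [j, i]) ` (near t A \<delta> \<inter> samples s \<sigma>)))
       (\<lambda>P. Ret (S \<union> max_packing {(j, i). [j, i] \<in> P} (A \<inter> samples s \<sigma>),
                 X \<union> fst ` {(j, i). [j, i] \<in> P}))) (Suc 0) (phase_inv t (Suc r))"
    if \<sigma>: "\<forall>j\<in>C. \<not> bad_sample K s (nbh t X j) (samples s \<sigma>)" for \<sigma>
  proof (rule holds_cli_says)
    fix j assume j: "j \<in> C"
    let ?E = "(\<lambda>i. [j, i]) ` (near t A ((\<lambda>i. Some (d i j)) |` F) \<inter> samples s \<sigma>)"
    have "card ?E \<le> card (nbh t X j \<inter> samples s \<sigma>)"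
      unfolding near using fin_nbh by (intro card_image_le) auto
    also have "card (nbh t X j \<inter> samples s \<sigma>) \<le> \<kappa>" using \<sigma> j \<kappa> by (auto simp: bad_sample_def)
    finally have "card ?E \<le> \<kappa>" .
    moreover have "\<forall>i\<in>nbh t X j. i < 2 ^ \<beta>" using nbhF[of j] name_less by blast
    ultimately show "?E \<subseteq> Msgs \<beta> \<and> finite ?E \<and> card ?E \<le> \<kappa>"
      using j name_less fin_nbh[of j] by (auto simp: Msgs_def near)
  next
    define inc where "inc = {(j, i). j \<in> C \<and> i \<in> nbh t X j \<inter> samples s \<sigma>}"
    define M where "M = max_packing inc (A \<inter> samples s \<sigma>)"
    have eq: "{(j, i). [j, i] \<in>
        (\<Union>j\<in>C. (\<lambda>i. [j, i]) ` (near t A ((\<lambda>i. Some (d i j)) |` F) \<inter> samples s \<sigma>))} = inc"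
      unfolding near by (auto simp: inc_def)
    note M = max_packing[where D = "A \<inter> samples s \<sigma>" and inc = inc, folded M_def,
        OF finite_Int[OF disjI1[OF finA]]]
    have "phase_inv t (Suc r) (S \<union> M, X \<union> fst ` inc)"
      unfolding phase_inv_def prod.case
    proof (intro conjI)
      have inv': "S \<subseteq> F0" "\<forall>i\<in>S. lev i \<le> t" "covers_below t S" "separated S"
        "\<forall>j\<in>X. j \<in> C \<and> (\<exists>i\<in>S. d i j \<le> 3 * L t)" "\<forall>i\<in>S. \<forall>j\<in>C. d i j < L t \<longrightarrow> j \<in> X"
        using inv by (auto simp: phase_inv_def)
      have MA: "M \<subseteq> A" "M \<subseteq> samples s \<sigma>" using M(1) by auto
      have levM: "lev i = t" if "i \<in> M" for i using MA that by (auto simp: A_def activef_def)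
      have M_inc: "(j, i) \<in> inc" if "i \<in> M" "j \<in> C" "d i j < L t" for i j
        using that MA by (auto simp: inc_def nbh_def A_def)
      show "S \<union> M \<subseteq> F0" using inv'(1) MA A by blast
      show "\<forall>i\<in>S \<union> M. lev i \<le> t" using inv'(2) levM by (metis UnE order.refl)
      show "covers_below t (S \<union> M)" using inv'(3) unfolding covers_below_def by (meson UnI1)
      show "separated (S \<union> M)"
        unfolding separated_def
      proof (intro ballI impI)
        fix i i' j assume i: "i \<in> S \<union> M" "i' \<in> S \<union> M" "j \<in> C" "i \<noteq> i'" "lev i' \<le> lev i"
          "d i j < L (lev i)"
        show "L (lev i) \<le> d i' j"
        proof (cases "i \<in> M")
          case iM: True
          then have lt: "lev i = t" by (rule levM)
          then have less: "d i j < L t" using i(6) by simp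
          have "i \<in> activef t X" using iM MA by (auto simp: A_def)
          then have nX: "j \<notin> X" using i(3) less by (auto simp: activef_def)
          have ji: "(j, i) \<in> inc" by (rule M_inc[OF iM i(3) less])
          show ?thesis
          proof (cases "i' \<in> M")
            case True
            then have "(j, i') \<notin> inc" using M(2)[OF iM True i(4) ji] by simp
            then have "\<not> d i' j < L t" using M_inc[OF True i(3)] by blast
            then show ?thesis using lt by simp
          next
            case False
            then have "i' \<in> S" using i(2) by blast
            then have "\<not> d i' j < L t" using inv'(6) nX i(3) by blast
            then show ?thesis using lt by simp
          qed
        next
          case False
          then have iS: "i \<in> S" using i(1) by blast
          show ?thesis
          proof (cases "i' \<in> M")
            case True
            then have "i' \<in> activef t X" "lev i' = t" using MA levM by (auto simp: A_def)
            moreover have "lev i \<le> t" using inv'(2) iS by blast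
            \<comment> \<open>A new facility has the current level \<open>t\<close>, the largest so
              far, so only a tie remains: then the clients of the ball of \<open>i\<close> are in
              \<open>X\<close>, which an active \<open>i'\<close> avoids.\<close>
            ultimately have lt: "lev i = t" using i(5) by simp
            then have "j \<in> X" using inv'(6) iS i(3,6) by simp
            then have "\<not> d i' j < L t" using \<open>i' \<in> activef t X\<close> i(3) by (auto simp: activef_def)
            then show ?thesis using lt by simp
          next
            case False
            then show ?thesis using inv'(4) iS i unfolding separated_def by blast
          qed
        qed
      qed
      show "\<forall>j\<in>X \<union> fst ` inc. j \<in> C \<and> (\<exists>i\<in>S \<union> M. d i j \<le> 3 * L t)"
      proof
        fix j assume "j \<in> X \<union> fst ` inc"
        then consider "j \<in> X" | i where "(j, i) \<in> inc" by auto
        then show "j \<in> C \<and> (\<exists>i\<in>S \<union> M. d i j \<le> 3 * L t)"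
        proof cases
          case 1
          then show ?thesis using inv'(5) by blast
        next
          case 2
          then have j: "j \<in> C" "i \<in> A \<inter> samples s \<sigma>" "d i j < L t"
            by (auto simp: inc_def nbh_def A_def)
          from M(3)[OF j(2)] show ?thesis
          proof
            assume "i \<in> M"
            moreover have "d i j \<le> 3 * L t" using j(3) L_nonneg[of t] by linarith
            ultimately show ?thesis using j(1) by blast
          next
            assume "\<exists>i'\<in>M. \<exists>j'. (j', i) \<in> inc \<and> (j', i') \<in> inc"
            then obtain i' j' where i': "i' \<in> M" "(j', i) \<in> inc" "(j', i') \<in> inc" by blast
            then have j': "j' \<in> C" "d i j' < L t" "d i' j' < L t" by (auto simp: inc_def nbh_def)
            have mem: "i \<in> F \<union> C" "i' \<in> F \<union> C" "j \<in> F \<union> C" "j' \<in> F \<union> C"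
              using i'(1) MA(1) A(2) j(1,2) j'(1) by blast+
            \<comment> \<open>The path from \<open>i'\<close> over the common client
              \<open>j'\<close> and the sampled facility \<open>i\<close> to \<open>j\<close> has
              three hops, each below \<open>L t\<close>.\<close>
            have "d i' j \<le> 3 * L t"
              using triangle[OF mem(2,4,3)] triangle[OF mem(4,1,3)] commute[of j' i] j j' by linarith
            then show ?thesis using i' j by blast
          qed
        qed
      qed
      show "\<forall>i\<in>S \<union> M. \<forall>j\<in>C. d i j < L t \<longrightarrow> j \<in> X \<union> fst ` inc"
      proof (intro ballI impI)
        fix i j assume "i \<in> S \<union> M" "j \<in> C" "d i j < L t"
        then show "j \<in> X \<union> fst ` inc" using inv'(6) M_inc[of i j] by (cases "i \<in> M") force+
      qed
      show "\<forall>j\<in>C. 2 * card (nbh t (X \<union> fst ` inc) j) \<le> 2 ^ (l + 1 - Suc r)"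
      proof
        fix j assume j: "j \<in> C"
        show "2 * card (nbh t (X \<union> fst ` inc) j) \<le> 2 ^ (l + 1 - Suc r)"
        \<comment> \<open>Either the sample misses all balls at \<open>j\<close>, and then there
          were at most half of \<open>2 ^ s\<close> of them, or \<open>j\<close> enters
          \<open>X\<close> and no active ball contains it any more.\<close>
        proof (cases "nbh t X j \<inter> samples s \<sigma> = {}")
          case True
          have "nbh t (X \<union> fst ` inc) j \<subseteq> nbh t X j" by (auto simp: nbh_def activef_def)
          then have "card (nbh t (X \<union> fst ` inc) j) \<le> card (nbh t X j)"
            using fin_nbh by (intro card_mono)
          moreover have "2 * card (nbh t X j) \<le> 2 ^ s"
            using \<sigma> j True by (auto simp: bad_sample_def)
          ultimately show ?thesis by (simp add: s_def)
        next
          case False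
          then have "j \<in> fst ` inc" using j by (force simp: inc_def)
          then have "nbh t (X \<union> fst ` inc) j = {}" using j by (auto simp: nbh_def activef_def)
          then show ?thesis by simp
        qed
      qed
    qed
    then show "protocol_holds (Ret (S \<union> max_packing {(j, i). [j, i] \<in>
        (\<Union>j\<in>C. (\<lambda>i. [j, i]) ` (near t A ((\<lambda>i. Some (d i j)) |` F) \<inter> samples s \<sigma>))} (A \<inter> samples s \<sigma>),
       X \<union> fst ` {(j, i). [j, i] \<in>
        (\<Union>j\<in>C. (\<lambda>i. [j, i]) ` (near t A ((\<lambda>i. Some (d i j)) |` F) \<inter> samples s \<sigma>))})) 0 (phase_inv t (Suc r))"
      unfolding eq M_def by simp
  qed
  have "protocol_holds (phase t levels_of s (S, X)) (Suc (q + Suc 0)) (phase_inv t (Suc r))"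
    unfolding phase_def prod.case
    by (rule ask_active_holds, rule hoare_bind[OF search[unfolded A_def]],
        rule final[unfolded A_def])
  then show ?thesis by (simp add: s_def)
qed

lemma level_holds:
  assumes inv: "level_inv t S"
  shows "protocol_holds (level levels_of t S) ((l + 1) * (q + 2) + 2) (level_inv (Suc t))"
proof -
  define X where "X = {j \<in> C. \<exists>i\<in>S. d i j \<le> L t}"
  have S: "S \<subseteq> F0" "S \<subseteq> F" "\<forall>i\<in>S. lev i < t" "covers_below t S" "separated S"
    using inv F0 by (auto simp: level_inv_def)
  have "card (nbh t X' j) \<le> 2 ^ l" for X' j
  proof -
    have "card (nbh t X' j) \<le> card F"
      using F0 fin by (intro card_mono) (auto simp: nbh_def activef_def)
    then show ?thesis using card_FC n by simp
  qed
  moreover have "\<exists>i\<in>S. d i j \<le> 3 * L t" if "j \<in> X" for j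
  proof -
    obtain i where "i \<in> S" "d i j \<le> L t" using \<open>j \<in> X\<close> by (auto simp: X_def)
    moreover have "L t \<le> 3 * L t" using L_nonneg[of t] by linarith
    ultimately show ?thesis by (intro bexI[of _ i]) linarith+
  qed
  ultimately have "phase_inv t 0 (S, X)"
    unfolding phase_inv_def prod.case using S less_imp_le[of _ t]
    by (force simp: X_def)
  then have loop: "protocol_holds (loop_prot (\<lambda>r. phase t levels_of (l - r)) (l + 1) (S, X))
      ((l + 1) * (q + 2)) (phase_inv t (l + 1))"
    by (rule hoare_loop) (use phase_holds in \<open>auto simp: less_Suc_eq_le\<close>)
  have final: "protocol_holds ((\<lambda>(S, X). ask_active t levels_of X (\<lambda>A. Ret (S \<union> A))) SX) (Suc 0)
      (level_inv (Suc t))" if SX: "phase_inv t (l + 1) SX" for SX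
  proof (cases SX)
    case (Pair S X)
    have inv': "S \<subseteq> F0" "\<forall>i\<in>S. lev i \<le> t" "covers_below t S" "separated S"
      "\<forall>j\<in>X. j \<in> C \<and> (\<exists>i\<in>S. d i j \<le> 3 * L t)" "\<forall>i\<in>S. \<forall>j\<in>C. d i j < L t \<longrightarrow> j \<in> X"
      "\<forall>j\<in>C. 2 * card (nbh t X j) \<le> 1"
      using SX Pair by (auto simp: phase_inv_def)
    have "nbh t X j = {}" if "j \<in> C" for j
    proof -
      have "finite (nbh t X j)"
        by (rule finite_subset[OF _ fin(1)]) (use F0 in \<open>auto simp: nbh_def activef_def\<close>)
      moreover have "card (nbh t X j) = 0" using inv'(7) that by fastforce
      ultimately show ?thesis by simp
    qed
    then have far: "L t \<le> d i j" if "i \<in> activef t X" "j \<in> C" for i j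
      using that by (force simp: nbh_def)
    have levA: "lev i = t" "i \<in> F0" if "i \<in> activef t X" for i using that by (auto simp: activef_def)
    have "level_inv (Suc t) (S \<union> activef t X)"
      unfolding level_inv_def
    proof (intro conjI)
      show "S \<union> activef t X \<subseteq> F0" using inv' levA by auto
      show "\<forall>i\<in>S \<union> activef t X. lev i < Suc t" using inv' levA by (auto simp: less_Suc_eq_le)
      show "covers_below (Suc t) (S \<union> activef t X)"
        unfolding covers_below_def
      proof (intro ballI impI)
        fix i assume i: "i \<in> F0" "lev i < Suc t"
        consider "lev i < t" | "lev i = t" "i \<in> activef t X" | "lev i = t" "i \<notin> activef t X"
          using i by linarith
        then show "\<exists>i'\<in>S \<union> activef t X. lev i' \<le> lev i \<and> d i i' \<le> 4 * L (lev i)"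
        proof cases
          case 1
          then show ?thesis using inv'(3) i unfolding covers_below_def by blast
        next
          case 2
          then show ?thesis using i F0 by (intro bexI[of _ i]) auto
        next
          case 3
          then obtain j where j: "j \<in> C" "d i j < L t" "j \<in> X" using i by (auto simp: activef_def)
          then obtain i' where i': "i' \<in> S" "d i' j \<le> 3 * L t" using inv' by blast
          \<comment> \<open>The factor 4 of the covering: one radius from \<open>i\<close> to a
            client of its ball in \<open>X\<close>, three more from there to an open
            facility.\<close>
          have "d i i' \<le> d i j + d j i'" "d j i' = d i' j"
            using i i' j F0 inv'(1) by (auto intro!: triangle commute)
          then show ?thesis using i' j 3 inv'(2) by (intro bexI[of _ i']) auto
        qed
      qed
      show "separated (S \<union> activef t X)"
        unfolding separated_def
      proof (intro ballI impI)
        fix i i' j assume i: "i \<in> S \<union> activef t X" "i' \<in> S \<union> activef t X" "j \<in> C" "i \<noteq> i'"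
          "lev i' \<le> lev i" "d i j < L (lev i)"
        have "i \<notin> activef t X" using far[of i j] levA[of i] i by auto
        then have iS: "i \<in> S" using i by auto
        show "L (lev i) \<le> d i' j"
        proof (cases "i' \<in> S")
          case True
          then show ?thesis using inv'(4) iS i unfolding separated_def by blast
        next
          case False
          then have "i' \<in> activef t X" using i by auto
          moreover from this have "lev i = t" using levA[of i'] i iS inv'(2) by force
          ultimately show ?thesis using far i by auto
        qed
      qed
    qed
    then have "protocol_holds (ask_active t levels_of X (\<lambda>A. Ret (S \<union> A))) (Suc 0) (level_inv (Suc t))"
      by (intro ask_active_holds) simp
    then show ?thesis using Pair by simp
  qed
  have eq: "{j. [j] \<in> (\<Union>j\<in>C. if \<exists>i\<in>S \<inter> dom ((\<lambda>i. Some (d i j)) |` F).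
      the (((\<lambda>i. Some (d i j)) |` F) i) \<le> L t then {[j]} else {})} = X"
    using S(2) by (auto simp: X_def split: if_splits)
  have "protocol_holds (level levels_of t S) (Suc ((l + 1) * (q + 2) + Suc 0)) (level_inv (Suc t))"
    unfolding level_def
  proof (rule holds_cli_says)
    show "protocol_holds (bind_prot (loop_prot (\<lambda>r. phase t levels_of (l - r)) (l + 1)
       (S, {j. [j] \<in> (\<Union>j\<in>C. if \<exists>i\<in>S \<inter> dom ((\<lambda>i. Some (d i j)) |` F).
      the (((\<lambda>i. Some (d i j)) |` F) i) \<le> L t then {[j]} else {})}))
       (\<lambda>(S, X). ask_active t levels_of X (\<lambda>A. Ret (S \<union> A)))) ((l + 1) * (q + 2) + Suc 0)
       (level_inv (Suc t))"
      unfolding eq by (rule hoare_bind[OF loop final])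
  qed (use name_less \<kappa> in \<open>auto simp: Msgs_def\<close>)
  then show ?thesis by simp
qed

lemma net_holds:
  assumes "\<And>i. i \<in> F0 \<Longrightarrow> lev i \<le> T"
  shows "protocol_holds (loop_prot (level levels_of) (T + 1) {}) net_rounds net"
proof -
  have "protocol_holds (loop_prot (level levels_of) (T + 1) {})
      ((T + 1) * ((l + 1) * (q + 2) + 2)) (level_inv (T + 1))"
  proof (rule hoare_loop)
    show "level_inv 0 {}" by (auto simp: level_inv_def covers_below_def separated_def)
  qed (rule level_holds)
  then show ?thesis
    unfolding net_rounds_def
    by (rule hoare_mono) (use assms in \<open>auto simp: level_inv_def covers_below_def net_def less_Suc_eq_le\<close>)
qed

end

end

end

section \<open>Approximation guarantees\<close>

lemma ex_smallest_subset:
  fixes \<alpha> :: "'a \<Rightarrow> real"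
  assumes "finite C" "p \<le> card C"
  shows "\<exists>X \<subseteq> C. card X = p \<and> (\<forall>j\<in>X. \<forall>j'\<in>C - X. \<alpha> j \<le> \<alpha> j')"
  using assms(2)
proof (induction p)
  case 0
  then show ?case by (intro exI[of _ "{}"]) auto
next
  case (Suc p)
  then obtain X where X: "X \<subseteq> C" "card X = p" "\<forall>j\<in>X. \<forall>j'\<in>C - X. \<alpha> j \<le> \<alpha> j'" by auto
  have "finite X" using X(1) assms(1) finite_subset by blast
  have ne: "C - X \<noteq> {}"
  proof
    assume "C - X = {}"
    then have "card C \<le> card X" using \<open>finite X\<close> by (intro card_mono) auto
    then show False using X(2) Suc.prems by simp
  qed
  then obtain a where a: "a \<in> C - X" "\<And>j. j \<in> C - X \<Longrightarrow> \<alpha> a \<le> \<alpha> j"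
    using assms(1) ex_min_if_finite[of "\<alpha> ` (C - X)"] by (force simp: not_less)
  show ?case
    using X a \<open>finite X\<close> by (intro exI[of _ "insert a X"]) auto
qed

lemma sum_smallest_subset_le:
  fixes \<alpha> :: "'a \<Rightarrow> real"
  assumes "finite C" "X \<subseteq> C" "D \<subseteq> C" "card X \<le> card D" "\<And>j. j \<in> C \<Longrightarrow> 0 \<le> \<alpha> j"
    and "\<forall>j\<in>X. \<forall>j'\<in>C - X. \<alpha> j \<le> \<alpha> j'"
  shows "sum \<alpha> X \<le> sum \<alpha> D"
proof -
  have fin: "finite X" "finite D" using assms finite_subset by blast+
  have card: "card (X - D) \<le> card (D - X)"
  proof -
    have "card X = card (X \<inter> D) + card (X - D)" "card D = card (X \<inter> D) + card (D - X)"
      using fin by (metis card_Int_Diff, metis card_Int_Diff Int_commute)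
    then show ?thesis using assms(4) by linarith
  qed
  have "sum \<alpha> (X - D) \<le> sum \<alpha> (D - X)"
  proof (cases "X - D = {}")
    case True
    then have "sum \<alpha> (X - D) = 0" by (simp only: sum.empty)
    moreover have "0 \<le> sum \<alpha> (D - X)" using assms(3,5) by (auto intro!: sum_nonneg)
    ultimately show ?thesis by simp
  next
    case False
    \<comment> \<open>The value \<open>m\<close> separates \<open>X - D\<close> from
      \<open>D - X\<close>, so the two sums can be compared by cardinality.\<close>
    define m where "m = Max (\<alpha> ` (X - D))"
    have m: "\<And>j. j \<in> X - D \<Longrightarrow> \<alpha> j \<le> m" "m \<in> \<alpha> ` (X - D)"
      using fin False by (auto simp: m_def)
    then have m2: "\<And>j. j \<in> D - X \<Longrightarrow> m \<le> \<alpha> j" and m0: "0 \<le> m" using assms by auto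
    have "sum \<alpha> (X - D) \<le> real (card (X - D)) * m" by (rule sum_bounded_above) (rule m)
    also have "\<dots> \<le> real (card (D - X)) * m" using card m0 by (intro mult_right_mono) auto
    also have "\<dots> \<le> sum \<alpha> (D - X)" by (rule sum_bounded_below) (rule m2)
    finally show ?thesis .
  qed
  moreover have "sum \<alpha> X = sum \<alpha> (X \<inter> D) + sum \<alpha> (X - D)" "sum \<alpha> D = sum \<alpha> (X \<inter> D) + sum \<alpha> (D - X)"
    using fin by (metis sum.Int_Diff, metis sum.Int_Diff Int_commute)
  ultimately show ?thesis by linarith
qed

lemma ex_subset_between:
  assumes "finite B" "A \<subseteq> B" "card A \<le> p" "p \<le> card B"
  shows "\<exists>C. A \<subseteq> C \<and> C \<subseteq> B \<and> card C = p"
proof -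
  have fA: "finite A" using assms finite_subset by blast
  have "p - card A \<le> card (B - A)" using assms fA by (simp add: card_Diff_subset)
  then obtain E where E: "E \<subseteq> B - A" "card E = p - card A"
    using obtain_subset_with_card_n by metis
  then have "finite E" using assms finite_subset by blast
  then have "card (A \<union> E) = p" using E fA assms by (subst card_Un_disjoint) auto
  then show ?thesis using E assms by (intro exI[of _ "A \<union> E"]) auto
qed

lemma sum_Un_le:
  fixes f :: "'a \<Rightarrow> real"
  assumes "finite A" "finite B" "\<And>x. x \<in> A \<Longrightarrow> 0 \<le> f x"
  shows "sum f (A \<union> B) \<le> sum f A + sum f B"
proof -
  have "0 \<le> sum f (A \<inter> B)" by (rule sum_nonneg) (use assms(3) in blast)
  then show ?thesis using sum_Un[OF assms(1,2), of f] by linarith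
qed

section \<open>Radii of the facilities\<close>

context params
begin

definition reaches :: "(nat \<Rightarrow> nat) \<Rightarrow> real \<Rightarrow> (nat \<rightharpoonup> real) \<Rightarrow> nat \<Rightarrow> bool" where
  "reaches pl a \<delta> t \<longleftrightarrow> a \<le> (\<Sum>j\<in>dom \<delta>. max 0 (min (L t) (L (pl j)) - the (\<delta> j)))"

text \<open>The parameter \<open>g\<close> caps the opening costs: it is the guess in the robust
  problem, and \<open>g = T\<close> admits every cost in the penalty problem. A facility that is not
  paid for even at radius \<open>L T\<close> is never opened.\<close>

definition build_net :: "(nat \<Rightarrow> nat) \<Rightarrow> nat \<Rightarrow> (node, (nat \<times> nat) set \<times> nat set) prot" where
  "build_net pl g = Bcast
     (fac_says (\<lambda>i a \<delta>. if a \<le> L g \<and> (\<exists>t\<le>T. reaches pl a \<delta> t)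
                        then {[i, LEAST t. reaches pl a \<delta> t]} else {}))
     (\<lambda>P. bind_prot (loop_prot (level {(i, t). [i, t] \<in> P}) (T + 1) {})
       (\<lambda>S. Ret ({(i, t). [i, t] \<in> P}, S)))"

definition round_up :: "real \<Rightarrow> nat" where
  "round_up x = (LEAST t. x \<le> L t)"

end

context fl_nodes
begin

lemma round_up:
  assumes "x = 0 \<or> 2 * \<epsilon> \<le> x" "x \<le> 2 ^ T * \<epsilon>"
  shows "x \<le> L (round_up x)" "L (round_up x) \<le> 2 * x" "round_up x \<le> T"
proof -
  have "x \<le> L T" using assms eps by (cases T) (auto simp: L_def)
  then show 1: "x \<le> L (round_up x)" and "round_up x \<le> T"
    unfolding round_up_def by (auto intro: LeastI Least_le)
  show "L (round_up x) \<le> 2 * x"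
  proof (cases "round_up x \<le> 1")
    case True
    then consider "round_up x = 0" | "round_up x = 1" by linarith
    then show ?thesis
    proof cases
      case 1
      then show ?thesis using assms eps by auto
    next
      case 2
      have "x \<noteq> 0"
      proof
        assume "x = 0"
        then have "x \<le> L 0" by simp
        then have "round_up x \<le> 0" unfolding round_up_def by (rule Least_le)
        then show False using 2 by simp
      qed
      then show ?thesis using 2 assms eps by (simp add: L_def)
    qed
  next
    case False
    then have "round_up x - 1 < round_up x" by simp
    then have "\<not> x \<le> L (round_up x - 1)" unfolding round_up_def by (rule not_less_Least)
    then show ?thesis using L_pred[of "round_up x"] False by simp
  qed
qed

definition reach :: "(nat \<Rightarrow> nat) \<Rightarrow> nat \<Rightarrow> nat \<Rightarrow> bool" where
  "reach pl i t \<longleftrightarrow> f i \<le> (\<Sum>j\<in>C. max 0 (min (L t) (L (pl j)) - d i j))"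

definition lev :: "(nat \<Rightarrow> nat) \<Rightarrow> nat \<Rightarrow> nat" where
  "lev pl i = (LEAST t. reach pl i t)"

definition usable :: "(nat \<Rightarrow> nat) \<Rightarrow> nat \<Rightarrow> nat set" where
  "usable pl g = {i \<in> F. f i \<le> L g \<and> (\<exists>t\<le>T. reach pl i t)}"

lemma usable_F: "usable pl g \<subseteq> F" by (auto simp: usable_def)

lemma lev_le: "i \<in> usable pl g \<Longrightarrow> lev pl i \<le> T"
  unfolding usable_def lev_def by (auto intro: Least_le order_trans)

lemma reach_lev: "i \<in> usable pl g \<Longrightarrow> reach pl i (lev pl i)"
  unfolding usable_def lev_def by (auto intro: LeastI)

lemma not_reach: "t < lev pl i \<Longrightarrow> \<not> reach pl i t"
  unfolding lev_def by (rule not_less_Least)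

text \<open>At radius \<open>L 1\<close> all clients together pay at most
  \<open>2 * \<epsilon> * n\<close>, less than any positive opening cost, and a free facility
  already has level 0. Hence the preceding radius is always exactly half
  (\<open>L_lev\<close>).\<close>

lemma lev_neq_1: "i \<in> usable pl g \<Longrightarrow> lev pl i \<noteq> 1"
proof
  assume i: "i \<in> usable pl g" and 1: "lev pl i = 1"
  then have iF: "i \<in> F" using usable_F by blast
  have "(\<Sum>j\<in>C. max 0 (min (L 0) (L (pl j)) - d i j)) \<ge> 0" by (intro sum_nonneg) auto
  moreover have "\<not> reach pl i 0" using 1 not_reach[of 0 pl i] by simp
  ultimately have "0 < f i" by (simp add: reach_def)
  have "f i \<le> (\<Sum>j\<in>C. max 0 (min (L 1) (L (pl j)) - d i j))"
    using reach_lev[OF i] 1 by (simp add: reach_def)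
  also have "\<dots> \<le> (\<Sum>j\<in>C. L 1)"
  proof (rule sum_mono)
    fix j
    show "max 0 (min (L 1) (L (pl j)) - d i j) \<le> L 1"
      using nonneg[of i j] L_nonneg[of 1] by linarith
  qed
  also have "\<dots> = 2 * \<epsilon> * real n" using card_FC by (simp add: L_def)
  finally show False using small(1)[OF iF \<open>0 < f i\<close>] by simp
qed

lemma L_lev: "i \<in> usable pl g \<Longrightarrow> L (lev pl i) = 2 * L (lev pl i - 1)"
  using L_pred lev_neq_1 by blast

lemma build_net_holds:
  "protocol_holds (build_net pl g) (Suc net_rounds)
     (\<lambda>(levs, S). levs = (\<lambda>i. (i, lev pl i)) ` usable pl g \<and> net (usable pl g) (lev pl) S)"
  unfolding build_net_def
proof (rule holds_fac_says, goal_cases)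
  case (1 i)
  have "(LEAST t. reach pl i t) < 2 ^ \<beta>" if "reach pl i t" "t \<le> T" for t
    using Least_le[of "reach pl i", OF that(1)] that(2) T(2) by linarith
  moreover have "reaches pl (f i) ((\<lambda>j. Some (d i j)) |` C) = reach pl i"
    by (auto simp: reaches_def reach_def fun_eq_iff)
  ultimately show ?case
    using 1 name_less \<kappa> by (auto simp: Msgs_def)
next
  case 2
  have eq: "reaches pl (f i) ((\<lambda>j. Some (d i j)) |` C) = reach pl i" for i
    by (auto simp: reaches_def reach_def fun_eq_iff)
  let ?P = "\<Union>i\<in>F. if f i \<le> L g \<and> (\<exists>t\<le>T. reaches pl (f i) ((\<lambda>j. Some (d i j)) |` C) t)
      then {[i, LEAST t. reaches pl (f i) ((\<lambda>j. Some (d i j)) |` C) t]} else {}"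
  have levs: "{(i, t). [i, t] \<in> ?P} = (\<lambda>i. (i, lev pl i)) ` usable pl g"
    unfolding eq by (auto simp: usable_def lev_def split: if_splits)
  have "protocol_holds (bind_prot (loop_prot (level ((\<lambda>i. (i, lev pl i)) ` usable pl g)) (T + 1) {})
     (\<lambda>S. Ret ((\<lambda>i. (i, lev pl i)) ` usable pl g, S))) (net_rounds + 0)
     (\<lambda>(levs, S). levs = (\<lambda>i. (i, lev pl i)) ` usable pl g \<and> net (usable pl g) (lev pl) S)"
    by (rule hoare_bind[OF net_holds[OF usable_F lev_le]]) auto
  then show ?case unfolding levs by simp
qed

section \<open>The dual solution and weak duality\<close>

context
  fixes pl :: "nat \<Rightarrow> nat" and g :: nat
begin

text \<open>
  The dual solution of the facility location problem in which only usable facilities may be opened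
  and client \<open>j\<close> may be left out for the price \<open>L (pl j)\<close>.
\<close>

definition \<alpha> :: "nat \<Rightarrow> real" where
  "\<alpha> j = Min (insert (L (pl j)) ((\<lambda>i. max (L (lev pl i - 1)) (d i j)) ` usable pl g))"

lemma fin_usable: "finite (usable pl g)"
  using usable_F fin finite_subset by blast

lemma \<alpha>_le:
  "\<alpha> j \<le> L (pl j)" "i \<in> usable pl g \<Longrightarrow> \<alpha> j \<le> max (L (lev pl i - 1)) (d i j)"
  using fin_usable by (auto simp: \<alpha>_def)

lemma \<alpha>_cases:
  obtains "\<alpha> j = L (pl j)"
    | i where "i \<in> usable pl g" "\<alpha> j = max (L (lev pl i - 1)) (d i j)"
proof -
  have "\<alpha> j \<in> insert (L (pl j)) ((\<lambda>i. max (L (lev pl i - 1)) (d i j)) ` usable pl g)"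
    unfolding \<alpha>_def by (rule Min_in) (use fin_usable in auto)
  then show ?thesis using that by auto
qed

lemma \<alpha>_nonneg: "0 \<le> \<alpha> j"
  by (rule \<alpha>_cases[of j]) (auto intro: order_trans[OF nonneg max.cobounded2])

text \<open>This is why \<open>\<alpha>\<close> uses the predecessor of \<open>lev pl i\<close>: at
  that radius the clients do not yet pay for \<open>i\<close>. At level 0 there is no smaller
  radius, but then \<open>\<alpha> j\<close> is at most the distance to \<open>i\<close> and all
  terms vanish.\<close>

lemma \<alpha>_dual_usable:
  assumes i: "i \<in> usable pl g"
  shows "(\<Sum>j\<in>C. max 0 (\<alpha> j - d i j)) \<le> f i"
proof (cases "lev pl i = 0")
  case True
  have "max 0 (\<alpha> j - d i j) = 0" for j
    using \<alpha>_le(2)[OF i, of j] True nonneg[of i j] by auto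
  moreover have "0 \<le> f i" using f_nonneg usable_F i by blast
  ultimately show ?thesis by simp
next
  case False
  have "(\<Sum>j\<in>C. max 0 (\<alpha> j - d i j)) \<le> (\<Sum>j\<in>C. max 0 (min (L (lev pl i - 1)) (L (pl j)) - d i j))"
  proof (rule sum_mono)
    fix j
    show "max 0 (\<alpha> j - d i j) \<le> max 0 (min (L (lev pl i - 1)) (L (pl j)) - d i j)"
      using \<alpha>_le(1)[of j] \<alpha>_le(2)[OF i, of j] by linarith
  qed
  also have "\<dots> \<le> f i" using not_reach[of "lev pl i - 1" pl i] False by (simp add: reach_def)
  finally show ?thesis .
qed

text \<open>Even if every client offered its full price \<open>L (pl j)\<close>, which bounds
  \<open>\<alpha> j\<close>, the facility would not be paid for.\<close>

lemma \<alpha>_dual_unreached: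
  assumes i: "i \<in> F" "\<not> reach pl i T" and "\<And>j. pl j \<le> T"
  shows "(\<Sum>j\<in>C. max 0 (\<alpha> j - d i j)) \<le> f i"
proof -
  have "(\<Sum>j\<in>C. max 0 (\<alpha> j - d i j)) \<le> (\<Sum>j\<in>C. max 0 (min (L T) (L (pl j)) - d i j))"
  proof (rule sum_mono)
    fix j
    show "max 0 (\<alpha> j - d i j) \<le> max 0 (min (L T) (L (pl j)) - d i j)"
      using \<alpha>_le(1)[of j] L_mono[OF assms(3)[of j]] by linarith
  qed
  also have "\<dots> \<le> f i" using i by (simp add: reach_def)
  finally show ?thesis .
qed

lemma weak_duality:
  assumes "F' \<subseteq> F" "D \<subseteq> C" and "\<And>j. j \<in> D \<Longrightarrow> \<sigma> j \<in> F'"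
    and "\<And>i. i \<in> F' \<Longrightarrow> (\<Sum>j\<in>C. max 0 (\<alpha> j - d i j)) \<le> f i"
  shows "sum \<alpha> D \<le> sum f F' + (\<Sum>j\<in>D. d (\<sigma> j) j)"
proof -
  have fF: "finite F'" using assms fin finite_subset by blast
  have "sum \<alpha> D \<le> (\<Sum>j\<in>D. d (\<sigma> j) j + (\<Sum>i\<in>F'. max 0 (\<alpha> j - d i j)))"
  proof (rule sum_mono)
    fix j assume "j \<in> D"
    then have "max 0 (\<alpha> j - d (\<sigma> j) j) \<le> (\<Sum>i\<in>F'. max 0 (\<alpha> j - d i j))"
      using assms(3) fF by (intro member_le_sum) auto
    then show "\<alpha> j \<le> d (\<sigma> j) j + (\<Sum>i\<in>F'. max 0 (\<alpha> j - d i j))" by linarith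
  qed
  also have "\<dots> = (\<Sum>j\<in>D. d (\<sigma> j) j) + (\<Sum>i\<in>F'. \<Sum>j\<in>D. max 0 (\<alpha> j - d i j))"
    by (simp add: sum.distrib sum.swap[of _ F'])
  also have "(\<Sum>i\<in>F'. \<Sum>j\<in>D. max 0 (\<alpha> j - d i j)) \<le> sum f F'"
  proof (rule sum_mono)
    fix i assume "i \<in> F'"
    have "(\<Sum>j\<in>D. max 0 (\<alpha> j - d i j)) \<le> (\<Sum>j\<in>C. max 0 (\<alpha> j - d i j))"
      using assms fin by (intro sum_mono2) auto
    then show "(\<Sum>j\<in>D. max 0 (\<alpha> j - d i j)) \<le> f i" using assms(4)[OF \<open>i \<in> F'\<close>] by linarith
  qed
  finally show ?thesis by simp
qed

text \<open>What \<open>j\<close> contributes to \<open>i\<close> at the first radius at which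
  \<open>i\<close> is paid for, in contrast to the preceding radius in \<open>\<alpha>\<close>; by
  \<open>L_lev\<close> the two differ by a factor 2.\<close>

definition share :: "nat \<Rightarrow> nat \<Rightarrow> real" where
  "share j i = max 0 (min (L (lev pl i)) (L (pl j)) - d i j)"

lemma share_nonneg: "0 \<le> share j i" by (simp add: share_def)

lemma share_le: "share j i \<le> L (lev pl i)" "share j i \<le> L (pl j)"
  using nonneg[of i j] L_nonneg[of "lev pl i"] L_nonneg[of "pl j"] unfolding share_def by linarith+

lemma f_le_shares: "i \<in> usable pl g \<Longrightarrow> f i \<le> (\<Sum>j\<in>C. share j i)"
  using reach_lev by (simp add: reach_def share_def)

lemma share_pos: "share j i \<noteq> 0 \<Longrightarrow> d i j < L (lev pl i)"
  by (auto simp: share_def max_def split: if_splits)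

lemma \<alpha>_less:
  assumes "i \<in> usable pl g" "d i j < L (lev pl i)"
  shows "\<alpha> j < L (lev pl i)"
proof -
  have "lev pl i \<noteq> 0" using assms(2) nonneg[of i j] by (metis L_0 not_less)
  then have "L (lev pl i - 1) < L (lev pl i)" by (intro L_strict_mono) simp
  then show ?thesis using \<alpha>_le(2)[OF assms(1), of j] assms(2) by linarith
qed

text \<open>A prefix of \<open>S\<close> in the lexicographic order by level and name, so that
  raising \<open>v\<close> opens the facilities of level \<open>t\<close> one at a time.\<close>

definition opened :: "nat set \<Rightarrow> nat \<Rightarrow> nat \<Rightarrow> nat set" where
  "opened S t v = {i \<in> S. lev pl i < t \<or> lev pl i = t \<and> i < v}"

section \<open>Charging opening and connection costs to the clients\<close>

context
  fixes S assumes net: "net (usable pl g) (lev pl) S"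
begin

lemma S_usable: "S \<subseteq> usable pl g" and fin_S: "finite S"
  using net fin_usable finite_subset unfolding net_def by blast+

lemma separatedD:
  "\<lbrakk>i \<in> S; i' \<in> S; j \<in> C; i \<noteq> i'; lev pl i' \<le> lev pl i; d i j < L (lev pl i)\<rbrakk> \<Longrightarrow> L (lev pl i) \<le> d i' j"
  using net unfolding net_def separated_def by blast

lemma share_unique:
  assumes "i \<in> S" "i' \<in> S" "j \<in> C" "share j i \<noteq> 0" "share j i' \<noteq> 0"
  shows "i = i'"
proof (rule ccontr)
  assume "i \<noteq> i'"
  show False
  proof (cases "lev pl i' \<le> lev pl i")
    case True
    then show False
      using separatedD[of i i' j] assms share_pos[of j i] share_pos[of j i'] L_mono[OF True] \<open>i \<noteq> i'\<close>
      by force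
  next
    case False
    then have "lev pl i \<le> lev pl i'" by simp
    from separatedD[of i' i j] this L_mono[OF this] show False
      using assms share_pos[of j i] share_pos[of j i'] \<open>i \<noteq> i'\<close> by force
  qed
qed

text \<open>By \<open>share_unique\<close> the sum has at most one nonzero term.\<close>

lemma sum_share_le:
  assumes "S' \<subseteq> S" "j \<in> C" "0 \<le> b" "\<And>i. i \<in> S' \<Longrightarrow> d i j < L (lev pl i) \<Longrightarrow> share j i \<le> b"
  shows "(\<Sum>i\<in>S'. share j i) \<le> b"
proof (cases "\<exists>i\<in>S'. share j i \<noteq> 0")
  case True
  then obtain i where i: "i \<in> S'" "share j i \<noteq> 0" by blast
  have "(\<Sum>i\<in>S'. share j i) = (\<Sum>i\<in>{i}. share j i)"
    using i assms share_unique fin_S finite_subset[of S' S] by (intro sum.mono_neutral_right) blast+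
  then show ?thesis using assms(4)[OF i(1)] share_pos[OF i(2)] by simp
next
  case False
  then show ?thesis using assms(3) by simp
qed

text \<open>Here \<open>i'\<close> is the net facility near the \<open>i\<close> that determines
  \<open>\<alpha> j\<close>. Its distance to \<open>j\<close> is at most that of \<open>i\<close>
  plus 4 radii of \<open>i\<close>, each at most \<open>2 * \<alpha> j\<close>, which gives 9. A net
  facility whose ball contains \<open>j\<close> either has level at most that of \<open>i'\<close>,
  or by separation its radius is at most the distance from \<open>i'\<close> to
  \<open>j\<close>.\<close>

lemma representative:
  assumes "j \<in> C" "i \<in> usable pl g" "\<alpha> j = max (L (lev pl i - 1)) (d i j)"
  shows "\<exists>i'\<in>S. d i' j \<le> 9 * \<alpha> j \<and> L (lev pl i') \<le> 2 * \<alpha> j \<and> (\<Sum>i\<in>S. share j i) \<le> 9 * \<alpha> j"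
proof -
  obtain i' where i': "i' \<in> S" "lev pl i' \<le> lev pl i" "d i i' \<le> 4 * L (lev pl i)"
    using net assms(2) unfolding net_def by blast
  have Li: "L (lev pl i) \<le> 2 * \<alpha> j" using L_lev[OF assms(2)] assms(3) by simp
  then have Li': "L (lev pl i') \<le> 2 * \<alpha> j" using L_mono[OF i'(2)] by simp
  have mem: "i \<in> F \<union> C" "i' \<in> F \<union> C" "j \<in> F \<union> C"
    using assms i' S_usable usable_F by blast+
  have d': "d i' j \<le> 9 * \<alpha> j"
    using triangle[OF mem(2,1,3)] commute[of i i'] i'(3) Li assms(3) by simp
  have "(\<Sum>i\<in>S. share j i) \<le> 9 * \<alpha> j"
  proof (rule sum_share_le)
    fix i2 assume i2: "i2 \<in> S" "d i2 j < L (lev pl i2)"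
    note le = share_le(1)[of j i2]
    show "share j i2 \<le> 9 * \<alpha> j"
    proof (cases "lev pl i2 \<le> lev pl i'")
      case True
      then show ?thesis using L_mono[OF True] Li' le \<alpha>_nonneg[of j] by linarith
    next
      case False
      then have "i2 \<noteq> i'" "lev pl i' \<le> lev pl i2" by auto
      then show ?thesis using separatedD[OF i2(1) i'(1) assms(1) _ _ i2(2)] d' le by linarith
    qed
  next
    show "0 \<le> 9 * \<alpha> j" using \<alpha>_nonneg[of j] by simp
  qed (use assms(1) in auto)
  then show ?thesis using i' d' Li' by blast
qed

text \<open>Client by client: 9 for the shares and 9 for the connection. A client with
  \<open>\<alpha> j = L (pl j)\<close> pays at most this price for each of the two.\<close>

lemma penalty_bound:
  shows "sum f S + (\<Sum>j\<in>C. if \<exists>i\<in>S. d i j \<le> L (pl j) then Min ((\<lambda>i. d i j) ` S) else L (pl j))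
    \<le> 18 * sum \<alpha> C"
proof -
  have "sum f S \<le> (\<Sum>i\<in>S. \<Sum>j\<in>C. share j i)"
    by (rule sum_mono) (use f_le_shares S_usable in auto)
  also have "\<dots> = (\<Sum>j\<in>C. \<Sum>i\<in>S. share j i)" by (rule sum.swap)
  finally have "sum f S \<le> (\<Sum>j\<in>C. \<Sum>i\<in>S. share j i)" .
  moreover have "(\<Sum>i\<in>S. share j i) +
      (if \<exists>i\<in>S. d i j \<le> L (pl j) then Min ((\<lambda>i. d i j) ` S) else L (pl j)) \<le> 18 * \<alpha> j"
    if j: "j \<in> C" for j
  proof -
    have min_le: "(if \<exists>i\<in>S. d i j \<le> L (pl j) then Min ((\<lambda>i. d i j) ` S) else L (pl j)) \<le> L (pl j)"
      using fin_S by (auto intro: order_trans[OF Min_le])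
    have min_le': "(if \<exists>i\<in>S. d i j \<le> L (pl j) then Min ((\<lambda>i. d i j) ` S) else L (pl j)) \<le> d i j"
      if "i \<in> S" for i
      using fin_S that by auto
    show ?thesis
    proof (cases j rule: \<alpha>_cases)
      case 1
      have "(\<Sum>i\<in>S. share j i) \<le> L (pl j)"
        using j share_le(2) by (intro sum_share_le) auto
      then show ?thesis using min_le 1 L_nonneg[of "pl j"] by linarith
    next
      case (2 i)
      then obtain i' where "i' \<in> S" "d i' j \<le> 9 * \<alpha> j" "(\<Sum>i\<in>S. share j i) \<le> 9 * \<alpha> j"
        using representative[OF j] by blast
      then show ?thesis using min_le'[of i'] by linarith
    qed
  qed
  then have "(\<Sum>j\<in>C. (\<Sum>i\<in>S. share j i) +
      (if \<exists>i\<in>S. d i j \<le> L (pl j) then Min ((\<lambda>i. d i j) ` S) else L (pl j))) \<le> (\<Sum>j\<in>C. 18 * \<alpha> j)"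
    by (rule sum_mono)
  ultimately show ?thesis by (simp add: sum.distrib sum_distrib_left)
qed

text \<open>The clients finally served need not be the cheap set \<open>X\<close>, so the two are
  compared by number: those outside \<open>X1\<close> are charged multiples of \<open>qm\<close>,
  against equally many members of \<open>X - X1\<close>, whose \<open>\<alpha>\<close> is at least
  \<open>qm / 2\<close>. Facilities below level \<open>th\<close> and all but the last of level
  \<open>th\<close> cost 9 each, the last one at most \<open>2 * W\<close>, the connections
  18.\<close>

lemma robust_bound:
  assumes rep: "\<And>j. j \<in> C \<Longrightarrow> \<exists>i\<in>usable pl g. \<alpha> j = max (L (lev pl i - 1)) (d i j)"
    and D: "D \<subseteq> C" "p \<le> card D" "1 \<le> p" and W: "sum \<alpha> D \<le> W" "L g \<le> 2 * W"
  shows "\<exists>t v C' u. t \<le> T + 1 \<and> v \<le> 2 ^ \<beta> \<and> C' \<subseteq> C \<and> card C' = p \<and>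
    (\<forall>j\<in>C'. \<exists>i\<in>opened S t v. d i j \<le> u j) \<and> sum f (opened S t v) + sum u C' \<le> 38 * W"
proof -
  have repr: "\<exists>i'\<in>S. d i' j \<le> 9 * \<alpha> j \<and> L (lev pl i') \<le> 2 * \<alpha> j \<and> (\<Sum>i\<in>S. share j i) \<le> 9 * \<alpha> j"
    if "j \<in> C" for j
    using rep[OF that] representative[OF that] by blast
  have "p \<le> card C" using D card_mono fin by (meson le_trans)
  then obtain X where X: "X \<subseteq> C" "card X = p" "\<forall>j\<in>X. \<forall>j'\<in>C - X. \<alpha> j \<le> \<alpha> j'"
    using ex_smallest_subset[OF fin(2)] by metis
  have finX: "finite X" and Xne: "X \<noteq> {}" using X(1,2) D(3) fin finite_subset by auto
  have sumX: "sum \<alpha> X \<le> W"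
    using sum_smallest_subset_le[OF fin(2) X(1) D(1) _ \<alpha>_nonneg X(3)] X(2) D(2) W(1) by linarith
  define qm where "qm = Max (\<alpha> ` X)"
  have qm: "\<And>j. j \<in> X \<Longrightarrow> \<alpha> j \<le> qm" "qm \<in> \<alpha> ` X" using finX Xne by (auto simp: qm_def)
  have qm0: "0 \<le> qm" using qm(2) \<alpha>_nonneg by auto
  have small_in_X: "j \<in> X" if "j \<in> C" "\<alpha> j < qm" for j
  proof -
    obtain j0 where "j0 \<in> X" "qm = \<alpha> j0" using qm(2) by blast
    then show ?thesis using X(3) that by (meson DiffI not_less)
  qed
  have "qm < L (T + 1)"
  proof -
    obtain j where "j \<in> X" "qm = \<alpha> j" using qm(2) by blast
    then obtain i where i: "i \<in> usable pl g" "qm = max (L (lev pl i - 1)) (d i j)" "j \<in> C"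
      using rep X by blast
    have "i \<in> F" using i(1) usable_F by blast
    then have "d i j \<le> 2 ^ T * \<epsilon>" using big[of i j] f_nonneg[of i] i(3) by linarith
    moreover have "0 < 2 ^ T * \<epsilon>" using eps by simp
    moreover have "L (T + 1) = 2 * (2 ^ T * \<epsilon>)" by (simp add: L_def)
    ultimately have "d i j < L (T + 1)" by linarith
    moreover have "L (lev pl i - 1) < L (T + 1)" using lev_le[OF i(1)] by (intro L_strict_mono) simp
    ultimately show ?thesis using i(2) by simp
  qed
  \<comment> \<open>By doubling, a net facility of level \<open>th\<close> has radius above
    \<open>qm\<close> and at most \<open>2 * qm\<close>, and no representative of a client of
    \<open>X\<close> has a higher level.\<close>
  define th where "th = (LEAST t. qm < L t)"
  have th: "qm < L th" "th \<le> T + 1"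
    unfolding th_def by (rule LeastI[of "\<lambda>t. qm < L t", OF \<open>qm < L (T + 1)\<close>])
      (rule Least_le[of "\<lambda>t. qm < L t", OF \<open>qm < L (T + 1)\<close>])
  have th_least: "L t \<le> qm" if "t < th" for t
    using not_less_Least[of t "\<lambda>t. qm < L t"] that by (simp add: th_def)
  have th0: "th \<noteq> 0" using th(1) qm0 by (metis L_0 not_less)
  have high: "L th \<le> 2 * qm" if "i \<in> S" "lev pl i = th" for i
  proof -
    have "i \<in> usable pl g" using that(1) S_usable by blast
    then have "L th = 2 * L (th - 1)" using L_lev that(2) by blast
    moreover have "L (th - 1) \<le> qm" using th0 by (intro th_least) simp
    ultimately show ?thesis by simp
  qed
  have le_th: "t \<le> th" if "L t \<le> 2 * qm" for t
  proof (rule ccontr)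
    assume "\<not> t \<le> th"
    then have "L (Suc th) \<le> L t" by (intro L_mono) simp
    moreover have "L (Suc th) = 2 * L th" using L_pred[of "Suc th"] th0 by simp
    ultimately show False using that th(1) by simp
  qed
  define J where "J v = {j \<in> C. \<exists>i\<in>opened S th v. d i j \<le> 9 * qm}" for v
  have finJ: "finite (J v)" for v using fin by (simp add: J_def)
  \<comment> \<open>All names are below \<open>2 ^ \<beta>\<close>, so this cutoff opens every net
    facility of level up to \<open>th\<close>.\<close>
  have "X \<subseteq> J (2 ^ \<beta>)"
  proof
    fix j assume j: "j \<in> X"
    then obtain i where i: "i \<in> S" "d i j \<le> 9 * \<alpha> j" "L (lev pl i) \<le> 2 * \<alpha> j"
      using repr X by blast
    then have "lev pl i \<le> th" using qm(1)[OF j] by (intro le_th) linarith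
    moreover have "i < 2 ^ \<beta>" using i(1) S_usable usable_F name_less by blast
    ultimately have "i \<in> opened S th (2 ^ \<beta>)" using i by (auto simp: opened_def)
    moreover have "d i j \<le> 9 * qm" using i(2) qm(1)[OF j] by linarith
    ultimately show "j \<in> J (2 ^ \<beta>)" using j X(1) unfolding J_def by blast
  qed
  then have "p \<le> card (J (2 ^ \<beta>))" using X(2) finJ card_mono by blast
  define v where "v = (LEAST v. p \<le> card (J v))"
  have v: "p \<le> card (J v)" "v \<le> 2 ^ \<beta>"
    unfolding v_def by (rule LeastI[of "\<lambda>v. p \<le> card (J v)", OF \<open>p \<le> card (J (2 ^ \<beta>))\<close>])
      (rule Least_le[of "\<lambda>v. p \<le> card (J v)", OF \<open>p \<le> card (J (2 ^ \<beta>))\<close>])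
  have v_least: "card (J w) < p" if "w < v" for w
    using not_less_Least[of w "\<lambda>v. p \<le> card (J v)"] that by (simp add: v_def)
  define low where "low = opened S th 0"
  define H where "H w = {i \<in> S. lev pl i = th \<and> i < w}" for w
  have opened_eq: "opened S th w = low \<union> H w" for w by (auto simp: opened_def low_def H_def)
  have low_sub: "low \<subseteq> S" "\<And>i. i \<in> low \<Longrightarrow> lev pl i < th" by (auto simp: low_def opened_def)
  have H_sub: "H w \<subseteq> S" "\<And>i. i \<in> H w \<Longrightarrow> lev pl i = th" for w by (auto simp: H_def)
  \<comment> \<open>Clients of \<open>X\<close> served at their own price by a facility below level
    \<open>th\<close>; the others have their representative at level \<open>th\<close>.\<close>
  define X1 where "X1 = {j \<in> X. \<exists>i\<in>low. d i j \<le> 9 * \<alpha> j}"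
  have X1: "X1 \<subseteq> X" "finite X1" using finX by (auto simp: X1_def)
  have X1_J: "X1 \<subseteq> J w" for w
  proof
    fix j assume "j \<in> X1"
    then obtain i where "j \<in> X" "i \<in> low" "d i j \<le> 9 * \<alpha> j" by (auto simp: X1_def)
    moreover from this have "d i j \<le> 9 * qm" using qm(1)[of j] by linarith
    ultimately show "j \<in> J w" using X(1) unfolding J_def opened_eq by blast
  qed
  have X_X1: "qm \<le> 2 * \<alpha> j" if "j \<in> X - X1" for j
  proof -
    obtain i where i: "i \<in> S" "d i j \<le> 9 * \<alpha> j" "L (lev pl i) \<le> 2 * \<alpha> j"
      using repr X \<open>j \<in> X - X1\<close> by blast
    then have "i \<notin> low" using \<open>j \<in> X - X1\<close> by (auto simp: X1_def)
    then have "th \<le> lev pl i" using i by (auto simp: low_def opened_def)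
    then show ?thesis using i(3) L_mono[of th "lev pl i"] th(1) by linarith
  qed
  have card_X_X1: "card (X - X1) = p - card X1" using X1 X by (simp add: card_Diff_subset)
  have sum_X: "sum \<alpha> X = sum \<alpha> X1 + sum \<alpha> (X - X1)"
    using X1 finX by (metis sum.subset_diff add.commute)
  have sum_qm: "real (card (X - X1)) * qm \<le> 2 * sum \<alpha> (X - X1)"
    using sum_mono[of "X - X1" "\<lambda>_. qm" "\<lambda>j. 2 * \<alpha> j"] X_X1 by (simp add: sum_distrib_left)
  have low_cost: "sum f low \<le> 9 * sum \<alpha> X"
  proof -
    have "sum f low \<le> (\<Sum>i\<in>low. \<Sum>j\<in>C. share j i)"
      by (rule sum_mono) (use f_le_shares S_usable low_sub in auto)
    \<comment> \<open>A contributor \<open>j\<close> to \<open>i\<close> in \<open>low\<close> has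
      \<open>\<alpha> j < L (lev pl i) \<le> qm\<close> and so belongs to \<open>X\<close>.\<close>
    also have "\<dots> = (\<Sum>i\<in>low. \<Sum>j\<in>X. share j i)"
    proof (rule sum.cong[OF refl], rule sum.mono_neutral_right[OF fin(2) X(1)], rule ballI)
      fix i j assume i: "i \<in> low" and j: "j \<in> C - X"
      show "share j i = 0"
      proof (rule ccontr)
        assume "share j i \<noteq> 0"
        then have "\<alpha> j < L (lev pl i)" using \<alpha>_less share_pos i low_sub S_usable by blast
        then have "\<alpha> j < qm" using th_least[OF low_sub(2)[OF i]] by linarith
        then show False using small_in_X j by blast
      qed
    qed
    also have "\<dots> = (\<Sum>j\<in>X. \<Sum>i\<in>low. share j i)" by (rule sum.swap)
    also have "\<dots> \<le> (\<Sum>j\<in>X. 9 * \<alpha> j)"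
    proof (rule sum_mono)
      fix j assume j: "j \<in> X"
      have "(\<Sum>i\<in>low. share j i) \<le> (\<Sum>i\<in>S. share j i)"
        using fin_S low_sub share_nonneg by (intro sum_mono2) auto
      then show "(\<Sum>i\<in>low. share j i) \<le> 9 * \<alpha> j" using repr[of j] j X(1) by (meson order_trans subsetD)
    qed
    finally show ?thesis by (simp add: sum_distrib_left)
  qed
  have high_cost: "sum f (H w) \<le> 9 * sum \<alpha> X" if w: "w < v" for w
  proof (cases "H w = {}")
    case True
    then show ?thesis using \<alpha>_nonneg by (simp add: sum_nonneg)
  next
    case False
    then have Lth: "L th \<le> 2 * qm" using high H_sub by blast
    have "sum f (H w) \<le> (\<Sum>i\<in>H w. \<Sum>j\<in>C. share j i)"
      by (rule sum_mono) (use f_le_shares S_usable H_sub in blast)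
    \<comment> \<open>Contributors to \<open>H w\<close> lie within \<open>L th \<le> 2 * qm\<close>
      of it and hence in \<open>J w\<close>, which has fewer than \<open>p\<close> members by
      minimality of \<open>v\<close>.\<close>
    also have "\<dots> = (\<Sum>i\<in>H w. \<Sum>j\<in>J w. share j i)"
    proof (rule sum.cong[OF refl], rule sum.mono_neutral_right[OF fin(2)], goal_cases)
      case 1
      show ?case by (auto simp: J_def)
    next
      case (2 i)
      show ?case
      proof
        fix j assume j: "j \<in> C - J w"
        show "share j i = 0"
        proof (rule ccontr)
          assume "share j i \<noteq> 0"
          then have "d i j < L th" using share_pos[of j i] H_sub(2)[OF 2] by simp
          then have "d i j \<le> 9 * qm" using Lth qm0 by linarith
          then have "j \<in> J w" using 2 j unfolding J_def opened_eq by blast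
          then show False using j by blast
        qed
      qed
    qed
    also have "\<dots> = (\<Sum>j\<in>J w. \<Sum>i\<in>H w. share j i)" by (rule sum.swap)
    also have "\<dots> = (\<Sum>j\<in>X1. \<Sum>i\<in>H w. share j i) + (\<Sum>j\<in>J w - X1. \<Sum>i\<in>H w. share j i)"
      using X1_J finJ by (metis sum.subset_diff add.commute)
    also have "(\<Sum>j\<in>X1. \<Sum>i\<in>H w. share j i) \<le> (\<Sum>j\<in>X1. 9 * \<alpha> j)"
    proof (rule sum_mono)
      fix j assume j: "j \<in> X1"
      have "(\<Sum>i\<in>H w. share j i) \<le> (\<Sum>i\<in>S. share j i)"
        using fin_S H_sub share_nonneg by (intro sum_mono2) auto
      then show "(\<Sum>i\<in>H w. share j i) \<le> 9 * \<alpha> j" using repr[of j] j X(1) X1(1) by (meson order_trans subsetD)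
    qed
    also have "(\<Sum>j\<in>J w - X1. \<Sum>i\<in>H w. share j i) \<le> (\<Sum>j\<in>J w - X1. 2 * qm)"
    proof (rule sum_mono)
      fix j assume j: "j \<in> J w - X1"
      show "(\<Sum>i\<in>H w. share j i) \<le> 2 * qm"
      proof (rule sum_share_le)
        fix i assume "i \<in> H w"
        then show "share j i \<le> 2 * qm"
          using H_sub(2)[of i w] Lth share_le(1)[of j i] by simp
      qed (use H_sub j qm0 in \<open>auto simp: J_def\<close>)
    qed
    also have "(\<Sum>j\<in>J w - X1. 2 * qm) = 2 * (real (card (J w - X1)) * qm)" by simp
    also have "\<dots> \<le> 2 * (real (card (X - X1)) * qm)"
    proof -
      have "card (J w - X1) \<le> card (X - X1)"
        using v_least[OF w] X1_J[of w] X1 by (simp add: card_X_X1 card_Diff_subset)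
      then show ?thesis using qm0 by (intro mult_left_mono mult_right_mono) auto
    qed
    also have "\<dots> \<le> 4 * sum \<alpha> (X - X1)" using sum_qm by linarith
    finally have "sum f (H w) \<le> 9 * sum \<alpha> X1 + 4 * sum \<alpha> (X - X1)" by (simp add: sum_distrib_left)
    also have "\<dots> \<le> 9 * sum \<alpha> X" unfolding sum_X using \<alpha>_nonneg by (simp add: sum_nonneg)
    finally show ?thesis .
  qed
  have fac_cost: "sum f (opened S th v) \<le> 18 * sum \<alpha> X + 2 * W"
  proof (cases v)
    case 0
    then have "sum f (opened S th v) = sum f low" by (simp add: low_def)
    moreover have "0 \<le> sum \<alpha> X" using \<alpha>_nonneg by (simp add: sum_nonneg)
    ultimately show ?thesis using low_cost W(2) L_nonneg[of g] by linarith
  next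
    case (Suc w)
    note fins = finite_subset[OF low_sub(1) fin_S] finite_subset[OF H_sub(1)[of w] fin_S]
    have f0: "0 \<le> f i" if "i \<in> S" for i
      using f_nonneg[of i] subsetD[OF S_usable that] subsetD[OF usable_F] by blast
    \<comment> \<open>With \<open>v = Suc w\<close> only the facility named \<open>w\<close> escapes
      \<open>low_cost\<close> and \<open>high_cost\<close>; its cost is bounded by the
      guess.\<close>
    let ?w = "if w \<in> S then {w} else {}"
    have "opened S th v \<subseteq> low \<union> H w \<union> ?w"
      by (auto simp: opened_eq Suc H_def less_Suc_eq)
    moreover have "low \<union> H w \<union> ?w \<subseteq> S" using low_sub(1) H_sub(1)[of w] by auto
    ultimately have "sum f (opened S th v) \<le> sum f (low \<union> H w \<union> ?w)"
      using fins f0 by (intro sum_mono2) auto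
    also have "\<dots> \<le> sum f (low \<union> H w) + sum f ?w"
      by (rule sum_Un_le) (use fins f0 low_sub(1) H_sub(1)[of w] in auto)
    also have "sum f (low \<union> H w) \<le> sum f low + sum f (H w)"
      by (rule sum_Un_le) (use fins f0 low_sub(1) in auto)
    also have "sum f ?w \<le> L g"
    proof (cases "w \<in> S")
      case True
      then have "w \<in> usable pl g" using S_usable by blast
      then show ?thesis using True by (simp add: usable_def)
    qed simp
    finally have "sum f (opened S th v) \<le> sum f low + sum f (H w) + L g" by simp
    moreover have "sum f (H w) \<le> 9 * sum \<alpha> X" by (rule high_cost) (simp add: Suc)
    ultimately show ?thesis using low_cost W(2) by linarith
  qed
  have "card X1 \<le> p" using X1 X finX card_mono by blast
  then obtain C' where C': "X1 \<subseteq> C'" "C' \<subseteq> J v" "card C' = p"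
    using ex_subset_between[OF finJ X1_J _ v(1)] by blast
  define u where "u j = (if j \<in> X1 then 9 * \<alpha> j else 9 * qm)" for j
  have "finite C'" using C' finJ finite_subset by blast
  then have "sum u C' = sum u X1 + sum u (C' - X1)" using C' by (metis sum.subset_diff add.commute)
  also have "sum u X1 = 9 * sum \<alpha> X1" by (simp add: u_def sum_distrib_left)
  also have "sum u (C' - X1) = (\<Sum>j\<in>C' - X1. 9 * qm)" by (intro sum.cong) (auto simp: u_def)
  also have "\<dots> = 9 * (real (card (X - X1)) * qm)"
    using C' X1 by (simp add: card_Diff_subset card_X_X1)
  also have "\<dots> \<le> 18 * sum \<alpha> (X - X1)" using sum_qm by linarith
  finally have "sum u C' \<le> 9 * sum \<alpha> X1 + 18 * sum \<alpha> (X - X1)" by simp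
  also have "\<dots> \<le> 18 * sum \<alpha> X" unfolding sum_X using \<alpha>_nonneg by (simp add: sum_nonneg)
  finally have "sum f (opened S th v) + sum u C' \<le> 36 * sum \<alpha> X + 2 * W" using fac_cost by linarith
  also have "\<dots> \<le> 38 * W" using sumX by linarith
  finally have cost: "sum f (opened S th v) + sum u C' \<le> 38 * W" .
  have "\<exists>i\<in>opened S th v. d i j \<le> u j" if "j \<in> C'" for j
  proof (cases "j \<in> X1")
    case True
    then show ?thesis unfolding opened_eq by (auto simp: X1_def u_def)
  next
    case False
    then show ?thesis using C'(2) that by (auto simp: J_def u_def)
  qed
  moreover have "C' \<subseteq> C" using C'(2) by (auto simp: J_def)
  ultimately show ?thesis using th(2) v(2) C'(3) cost by blast
qed

end

end

end

section \<open>The two protocols\<close>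

text \<open>
  The first component consists of the rounded opening costs, the second of the clients. For each guess
  \<open>g\<close> of the largest opening cost there is a family of sets \<open>Op t v\<close> of facilities together with the pairs
  of a client and an upper bound (a level) on its distance to \<open>Op t v\<close>.
\<close>

type_synonym robust_table =
  "(nat \<times> nat) set \<times> nat set \<times> ((nat \<Rightarrow> nat \<Rightarrow> nat set) \<times> (nat \<Rightarrow> nat \<Rightarrow> (nat \<times> nat) set)) list"

context params
begin

definition opened_of :: "(nat \<times> nat) set \<Rightarrow> nat set \<Rightarrow> nat \<Rightarrow> nat \<Rightarrow> nat set" where
  "opened_of levs S t v = {i \<in> S. \<exists>t'. (i, t') \<in> levs \<and> (t' < t \<or> t' = t \<and> i < v)}"

definition served_by :: "(nat \<rightharpoonup> real) \<Rightarrow> nat set \<Rightarrow> nat \<Rightarrow> bool" where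
  "served_by \<delta> S w \<longleftrightarrow> (\<exists>i\<in>S \<inter> dom \<delta>. the (\<delta> i) \<le> L w)"

text \<open>The sets \<open>opened_of levs S t v\<close> grow with \<open>v\<close>, so for each
  threshold \<open>t\<close> and distance level \<open>w\<close> the least \<open>v\<close> that
  serves the client encodes the table for all \<open>v\<close>. This needs polylogarithmically many
  messages per client instead of one for each cutoff.\<close>

definition robust_guess ::
  "nat \<Rightarrow> (node, (nat \<Rightarrow> nat \<Rightarrow> nat set) \<times> (nat \<Rightarrow> nat \<Rightarrow> (nat \<times> nat) set)) prot"
where
  "robust_guess g = bind_prot (build_net (\<lambda>_. T) g) (\<lambda>(levs, S). Bcast
     (cli_says (\<lambda>j \<delta> u. {[t, w, LEAST v. served_by \<delta> (opened_of levs S t v) w, j] | t w.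
        t \<le> T + 1 \<and> w \<le> T \<and> (\<exists>v. served_by \<delta> (opened_of levs S t v) w)}))
     (\<lambda>P. Ret (opened_of levs S, \<lambda>t v. {(j, w). \<exists>v'\<le>v. [t, w, v', j] \<in> P})))"

definition robust_prot :: "(node, robust_table) prot" where
  "robust_prot = Bcast (fac_says (\<lambda>i a \<delta>. {[i, round_up a]})) (\<lambda>P1.
     Bcast (cli_says (\<lambda>j \<delta> u. {[j]})) (\<lambda>P2.
     bind_prot (loop_prot (\<lambda>g Os. bind_prot (robust_guess g) (\<lambda>Op. Ret (Os @ [Op]))) (T + 1) [])
       (\<lambda>Os. Ret ({(i, t). [i, t] \<in> P1}, {j. [j] \<in> P2}, Os))))"

definition robust_rounds :: nat where
  "robust_rounds = (T + 1) * (net_rounds + 2) + 2"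

text \<open>Searching all client sets is admissible because local computation is free. The bound
  \<open>b\<close> on the cutoffs keeps the set finite, so that a cheapest candidate exists.\<close>

definition candidates :: "nat \<Rightarrow> nat \<Rightarrow> robust_table \<Rightarrow> (nat \<times> nat \<times> nat \<times> nat set) set" where
  "candidates b p = (\<lambda>(fl, cl, Os). {(g, t, v, C'). g \<le> T \<and> t \<le> T + 1 \<and> v \<le> b \<and> C' \<subseteq> cl \<and>
     card C' = p \<and> (\<forall>j\<in>C'. \<exists>w. (j, w) \<in> snd (Os ! g) t v)})"

definition candidate_cost :: "robust_table \<Rightarrow> nat \<times> nat \<times> nat \<times> nat set \<Rightarrow> real" where
  "candidate_cost = (\<lambda>(fl, cl, Os) (g, t, v, C').
     (\<Sum>(i, s)\<in>{x \<in> fl. fst x \<in> fst (Os ! g) t v}. L s) +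
     (\<Sum>j\<in>C'. L (LEAST w. (j, w) \<in> snd (Os ! g) t v)))"

definition robust_choice :: "nat \<Rightarrow> nat \<Rightarrow> robust_table \<Rightarrow> solution" where
  "robust_choice b p a = (case (SOME x. x \<in> candidates b p a \<and>
       (\<forall>y\<in>candidates b p a. candidate_cost a x \<le> candidate_cost a y)) of
     (g, t, v, C') \<Rightarrow> (fst (snd (snd a) ! g) t v, C'))"

definition penalty_prot :: "(node, solution) prot" where
  "penalty_prot = Bcast (cli_says (\<lambda>j \<delta> u. {[j, round_up u]})) (\<lambda>P.
     bind_prot (build_net (\<lambda>j. if \<exists>t. [j, t] \<in> P then THE t. [j, t] \<in> P else 0) T) (\<lambda>(levs, S).
     Bcast (cli_says (\<lambda>j \<delta> u. if served_by \<delta> S (round_up u) then {[j]} else {}))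
       (\<lambda>P. Ret (S, {j. [j] \<in> P}))))"

definition penalty_rounds :: nat where
  "penalty_rounds = net_rounds + 3"

end

section \<open>Correctness of the robust protocol\<close>

context fl_nodes
begin

definition dist_table :: "(nat \<Rightarrow> nat \<Rightarrow> nat set) \<Rightarrow> nat \<Rightarrow> nat \<Rightarrow> (nat \<times> nat) set" where
  "dist_table Op = (\<lambda>t v. {(j, w). j \<in> C \<and> t \<le> T + 1 \<and> w \<le> T \<and> (\<exists>i\<in>Op t v. d i j \<le> L w)})"

definition guess_ok :: "nat \<Rightarrow> (nat \<Rightarrow> nat \<Rightarrow> nat set) \<times> (nat \<Rightarrow> nat \<Rightarrow> (nat \<times> nat) set) \<Rightarrow> bool" where
  "guess_ok g Op \<longleftrightarrow> (\<exists>S. net (usable (\<lambda>_. T) g) (lev (\<lambda>_. T)) S \<and>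
     Op = (opened (\<lambda>_. T) S, dist_table (opened (\<lambda>_. T) S)))"

lemma opened_mono: "v \<le> v' \<Longrightarrow> opened pl S t v \<subseteq> opened pl S t v'"
  by (auto simp: opened_def)

lemma net_F: "net (usable pl g) h S \<Longrightarrow> S \<subseteq> F"
  using usable_F unfolding net_def by blast

lemma robust_guess_holds: "protocol_holds (robust_guess g) (net_rounds + 2) (guess_ok g)"
proof -
  let ?pl = "\<lambda>_::nat. T"
  have "protocol_holds ((\<lambda>(levs, S). Bcast
     (cli_says (\<lambda>j \<delta> u. {[t, w, LEAST v. served_by \<delta> (opened_of levs S t v) w, j] | t w.
        t \<le> T + 1 \<and> w \<le> T \<and> (\<exists>v. served_by \<delta> (opened_of levs S t v) w)}))
     (\<lambda>P. Ret (opened_of levs S, \<lambda>t v. {(j, w). \<exists>v'\<le>v. [t, w, v', j] \<in> P}))) x) (Suc 0) (guess_ok g)"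
    if "case x of (levs, S) \<Rightarrow>
      levs = (\<lambda>i. (i, lev ?pl i)) ` usable ?pl g \<and> net (usable ?pl g) (lev ?pl) S" for x
  proof -
    obtain levs S where x: "x = (levs, S)" by (cases x)
    then have levs: "levs = (\<lambda>i. (i, lev ?pl i)) ` usable ?pl g" and net: "net (usable ?pl g) (lev ?pl) S"
      using that by auto
    have SU: "S \<subseteq> usable ?pl g" using net by (simp add: net_def)
    then have SF: "S \<subseteq> F" using usable_F by blast
    have opened: "opened_of levs S = opened ?pl S"
      using SU unfolding levs by (auto simp: opened_of_def opened_def fun_eq_iff)
    let ?W = "\<lambda>j w t v. \<exists>i\<in>opened ?pl S t v. d i j \<le> L w"
    have W: "served_by ((\<lambda>i. Some (d i j)) |` F) (opened_of levs S t v) w = ?W j w t v" for j t v w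
      using SF by (auto simp: opened served_by_def opened_def)
    have W_mono: "?W j w t v'" if "?W j w t v" "v \<le> v'" for j w t v v'
      using that opened_mono by blast
    have least: "(LEAST v. ?W j w t v) < 2 ^ \<beta>" if ex: "?W j w t v" for j w t v
    proof -
      obtain i where i: "i \<in> opened ?pl S t v" "d i j \<le> L w" using ex by blast
      \<comment> \<open>The facility \<open>i\<close> counts as opened once the cutoff passes its
        name.\<close>
      then have "?W j w t (Suc i)" by (auto simp: opened_def)
      then have "(LEAST v. ?W j w t v) \<le> Suc i" by (rule Least_le)
      moreover have "i \<in> F" using i SF by (auto simp: opened_def)
      ultimately show ?thesis using names[of i] by simp
    qed
    let ?E = "\<lambda>j. {[t, w, LEAST v. ?W j w t v, j] | t w. t \<le> T + 1 \<and> w \<le> T \<and> (\<exists>v. ?W j w t v)}"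
    have "protocol_holds (Bcast
     (cli_says (\<lambda>j \<delta> u. {[t, w, LEAST v. served_by \<delta> (opened_of levs S t v) w, j] | t w.
        t \<le> T + 1 \<and> w \<le> T \<and> (\<exists>v. served_by \<delta> (opened_of levs S t v) w)}))
     (\<lambda>P. Ret (opened_of levs S, \<lambda>t v. {(j, w). \<exists>v'\<le>v. [t, w, v', j] \<in> P}))) (Suc 0) (guess_ok g)"
    proof (rule holds_cli_says, goal_cases)
      case (1 j)
      have sub: "?E j \<subseteq> (\<lambda>(t, w). [t, w, LEAST v. ?W j w t v, j]) ` ({..T + 1} \<times> {..T})" by auto
      then have fin: "finite (?E j)" by (rule finite_subset) auto
      have "card (?E j) \<le> card ((\<lambda>(t, w). [t, w, LEAST v. ?W j w t v, j]) ` ({..T + 1} \<times> {..T}))"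
        using sub by (rule card_mono[rotated]) auto
      also have "\<dots> \<le> card ({..T + 1} \<times> {..T})" by (rule card_image_le) auto
      also have "\<dots> \<le> \<kappa>" using \<kappa>(3) by simp
      finally have "card (?E j) \<le> \<kappa>" .
      moreover have "?E j \<subseteq> Msgs \<beta>"
      proof
        fix x assume "x \<in> ?E j"
        then obtain t w v where x: "x = [t, w, LEAST v. ?W j w t v, j]" "t \<le> T + 1" "w \<le> T" "?W j w t v"
          by blast
        then show "x \<in> Msgs \<beta>" using least[OF x(4)] T(2) name_less[of j] 1 by (simp add: Msgs_def)
      qed
      ultimately show ?case unfolding W using fin by blast
    next
      case 2
      let ?P = "\<Union>j\<in>C. ?E j"
      have "(\<exists>v'\<le>v. [t, w, v', j] \<in> ?P) \<longleftrightarrow> j \<in> C \<and> t \<le> T + 1 \<and> w \<le> T \<and> ?W j w t v" for t w v j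
      proof
        assume "\<exists>v'\<le>v. [t, w, v', j] \<in> ?P"
        then have *: "(LEAST v. ?W j w t v) \<le> v" "j \<in> C" "t \<le> T + 1" "w \<le> T" "\<exists>v. ?W j w t v" by auto
        then show "j \<in> C \<and> t \<le> T + 1 \<and> w \<le> T \<and> ?W j w t v"
          using W_mono[OF LeastI_ex[OF *(5)] *(1)] by blast
      next
        assume *: "j \<in> C \<and> t \<le> T + 1 \<and> w \<le> T \<and> ?W j w t v"
        then have "(LEAST v. ?W j w t v) \<le> v" by (auto intro: Least_le)
        then show "\<exists>v'\<le>v. [t, w, v', j] \<in> ?P"
          using * by (intro exI[of _ "LEAST v. ?W j w t v"]) auto
      qed
      then have "(\<lambda>t v. {(j, w). \<exists>v'\<le>v. [t, w, v', j] \<in> ?P}) = dist_table (opened ?pl S)"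
        unfolding dist_table_def by presburger
      then show ?case unfolding W unfolding opened using net by (auto simp: guess_ok_def)
    qed
    then show ?thesis by (simp add: x)
  qed
  then have "protocol_holds (robust_guess g) (Suc net_rounds + Suc 0) (guess_ok g)"
    unfolding robust_guess_def by (rule hoare_bind[OF build_net_holds])
  then show ?thesis by simp
qed

definition robust_ok :: "robust_table \<Rightarrow> bool" where
  "robust_ok = (\<lambda>(fl, cl, Os). fl = (\<lambda>i. (i, round_up (f i))) ` F \<and> cl = C \<and>
     (\<forall>g\<le>T. guess_ok g (Os ! g)))"

lemma f_round:
  assumes "i \<in> F"
  shows "f i \<le> L (round_up (f i))" "L (round_up (f i)) \<le> 2 * f i" "round_up (f i) \<le> T"
proof -
  have "C \<noteq> {}" using card_FC n by auto
  then obtain j where "j \<in> C" by blast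
  then have "f i \<le> 2 ^ T * \<epsilon>" using big[OF assms, of j] nonneg[of i j] by linarith
  moreover have "f i = 0 \<or> 2 * \<epsilon> \<le> f i"
  proof (cases "f i = 0")
    case False
    then have *: "2 * \<epsilon> * real n < f i" using small(1) f_nonneg assms by force
    have "2 * \<epsilon> * 1 \<le> 2 * \<epsilon> * real n" using eps n by (intro mult_left_mono) auto
    then show ?thesis using * by simp
  qed simp
  ultimately show "f i \<le> L (round_up (f i))" "L (round_up (f i)) \<le> 2 * f i" "round_up (f i) \<le> T"
    by (rule round_up[rotated])+
qed

lemma d_round:
  assumes "i \<in> F" "j \<in> C"
  shows "d i j \<le> L (round_up (d i j))" "L (round_up (d i j)) \<le> 2 * d i j" "round_up (d i j) \<le> T"
proof -
  have "d i j \<le> 2 ^ T * \<epsilon>" using big[OF assms] f_nonneg assms by force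
  moreover have "d i j = 0 \<or> 2 * \<epsilon> \<le> d i j"
    using small(2) assms nonneg[of i j] by force
  ultimately show "d i j \<le> L (round_up (d i j))" "L (round_up (d i j)) \<le> 2 * d i j" "round_up (d i j) \<le> T"
    by (rule round_up[rotated])+
qed

lemma robust_holds: "protocol_holds robust_prot robust_rounds robust_ok"
proof -
  let ?Inv = "\<lambda>k Os. length Os = k \<and> (\<forall>g<k. guess_ok g (Os ! g))"
  have step: "protocol_holds (bind_prot (robust_guess g) (\<lambda>Op. Ret (Os @ [Op]))) (net_rounds + 2 + 0)
      (?Inv (Suc g))" if "?Inv g Os" for g Os
    by (rule hoare_bind[OF robust_guess_holds]) (use that in \<open>auto simp: nth_append less_Suc_eq\<close>)
  have "protocol_holds (loop_prot (\<lambda>g Os. bind_prot (robust_guess g) (\<lambda>Op. Ret (Os @ [Op]))) (T + 1) [])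
      ((T + 1) * (net_rounds + 2 + 0)) (?Inv (T + 1))"
    by (rule hoare_loop) (simp, rule step)
  then have loop: "protocol_holds (bind_prot
      (loop_prot (\<lambda>g Os. bind_prot (robust_guess g) (\<lambda>Op. Ret (Os @ [Op]))) (T + 1) [])
      (\<lambda>Os. Ret ((\<lambda>i. (i, round_up (f i))) ` F, C, Os))) ((T + 1) * (net_rounds + 2 + 0) + 0) robust_ok"
    by (rule hoare_bind) (auto simp: robust_ok_def less_Suc_eq_le)
  have "protocol_holds robust_prot (Suc (Suc ((T + 1) * (net_rounds + 2 + 0) + 0))) robust_ok"
    unfolding robust_prot_def
  proof (rule holds_fac_says, goal_cases)
    case (1 i)
    then show ?case using f_round(3)[OF 1] T name_less \<kappa> by (auto simp: Msgs_def)
  next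
    case 2
    have e1: "{(i, t). [i, t] \<in> (\<Union>i\<in>F. {[i, round_up (f i)]})} = (\<lambda>i. (i, round_up (f i))) ` F" by auto
    have e2: "{j. [j] \<in> (\<Union>j\<in>C. {[j]})} = C" by auto
    show ?case
      unfolding e1
    proof (rule holds_cli_says, goal_cases)
      case (1 j)
      then show ?case using name_less \<kappa> by (auto simp: Msgs_def)
    next
      case 2
      show ?case unfolding e2 by (rule loop)
    qed
  qed
  then show ?thesis by (simp add: robust_rounds_def)
qed

text \<open>The guess that matters is the rounded largest opening cost in \<open>F'\<close>: then
  all of \<open>F'\<close> is usable and weak duality applies. Announced opening costs and distances
  are rounded up by a factor of at most 2, hence 76 = 2 * 38.\<close>

lemma robust_candidate:
  assumes a: "robust_ok a" and F': "F' \<subseteq> F" and D: "D \<subseteq> C" "p \<le> card D" "\<And>j. j \<in> D \<Longrightarrow> \<sigma> j \<in> F'"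
  shows "\<exists>x\<in>candidates (2 ^ \<beta>) p a. candidate_cost a x \<le> 76 * (sum f F' + (\<Sum>j\<in>D. d (\<sigma> j) j))"
proof -
  let ?pl = "\<lambda>_::nat. T"
  define W where "W = sum f F' + (\<Sum>j\<in>D. d (\<sigma> j) j)"
  have finF: "finite F'" using F' fin finite_subset by blast
  have sumf: "0 \<le> sum f F'" using F' f_nonneg by (auto intro!: sum_nonneg)
  have sumd: "0 \<le> (\<Sum>j\<in>D. d (\<sigma> j) j)" by (intro sum_nonneg) simp
  obtain Os where Os: "a = ((\<lambda>i. (i, round_up (f i))) ` F, C, Os)" "\<And>g. g \<le> T \<Longrightarrow> guess_ok g (Os ! g)"
    using a by (cases a) (auto simp: robust_ok_def)
  have "\<exists>g\<le>T. \<exists>S t v C' u. Os ! g = (opened ?pl S, dist_table (opened ?pl S)) \<and> S \<subseteq> F \<and>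
      t \<le> T + 1 \<and> v \<le> 2 ^ \<beta> \<and> C' \<subseteq> C \<and> card C' = p \<and>
      (\<forall>j\<in>C'. \<exists>i\<in>opened ?pl S t v. d i j \<le> u j) \<and> sum f (opened ?pl S t v) + sum u C' \<le> 38 * W"
  proof (cases "p = 0")
    \<comment> \<open>For \<open>p = 0\<close> the set \<open>F'\<close> may be empty and yield no
      guess; opening nothing is then a candidate of cost 0.\<close>
    case True
    obtain S where S: "Os ! 0 = (opened ?pl S, dist_table (opened ?pl S))"
        "net (usable ?pl 0) (lev ?pl) S"
      using Os(2)[of 0] by (auto simp: guess_ok_def)
    have e: "opened ?pl S 0 0 = {}" by (simp add: opened_def)
    show ?thesis
      by (rule exI[of _ 0], intro conjI exI[of _ S] exI[of _ "0::nat"] exI[of _ "{}::nat set"]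
          exI[of _ "\<lambda>_. 0"]) (use S True net_F e sumf sumd in \<open>auto simp: W_def\<close>)
  next
    case False
    then obtain j0 where "j0 \<in> D" using D by fastforce
    then have ne: "F' \<noteq> {}" using D by blast
    then have "Max (f ` F') \<in> f ` F'" using finF by (intro Max_in) auto
    then obtain i1 where "i1 \<in> F'" "Max (f ` F') = f i1" by blast
    then have i1: "i1 \<in> F'" "\<And>i. i \<in> F' \<Longrightarrow> f i \<le> f i1"
      using Max_ge[of "f ` F'"] finF by auto
    have i1F: "i1 \<in> F" using i1 F' by blast
    define g where "g = round_up (f i1)"
    have g: "g \<le> T" using f_round[OF i1F] by (simp add: g_def)
    have "f i1 \<le> sum f F'" using i1 F' f_nonneg finF by (intro member_le_sum) auto
    then have Lg: "L g \<le> 2 * W" using f_round(2)[OF i1F] sumd by (simp add: g_def W_def)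
    have LT: "L T = 2 ^ T * \<epsilon>" using T by (simp add: L_def)
    have usable: "F' \<subseteq> usable ?pl g"
    proof
      fix i assume i: "i \<in> F'"
      then have iF: "i \<in> F" and j0: "j0 \<in> C" using F' D \<open>j0 \<in> D\<close> by blast+
      \<comment> \<open>By \<open>big\<close>, the single client \<open>j0\<close> pays for
        \<open>i\<close> at radius \<open>L T\<close>.\<close>
      have "f i \<le> max 0 (min (L T) (L T) - d i j0)" using big[OF iF j0] LT by simp
      also have "\<dots> \<le> (\<Sum>j\<in>C. max 0 (min (L T) (L T) - d i j))"
        using j0 fin by (intro member_le_sum) auto
      finally have "reach ?pl i T" by (simp add: reach_def)
      moreover have "f i \<le> L g" using i1(2)[OF i] f_round(1)[OF i1F] by (simp add: g_def)
      ultimately show "i \<in> usable ?pl g" using iF by (auto simp: usable_def)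
    qed
    obtain S where S: "Os ! g = (opened ?pl S, dist_table (opened ?pl S))"
        "net (usable ?pl g) (lev ?pl) S"
      using Os(2)[OF g] by (auto simp: guess_ok_def)
    \<comment> \<open>The artificial price \<open>L T\<close> never undercuts the usable facilities,
      so the dual solution leaves no client out.\<close>
    have rep: "\<exists>i\<in>usable ?pl g. \<alpha> ?pl g j = max (L (lev ?pl i - 1)) (d i j)" if j: "j \<in> C" for j
    proof (cases j rule: \<alpha>_cases[of ?pl g])
      case 1
      have i: "i1 \<in> usable ?pl g" using usable i1 by blast
      have "d i1 j \<le> L T" using big[OF i1F j] f_nonneg[OF i1F] LT by linarith
      moreover have "L (lev ?pl i1 - 1) \<le> L T" using lev_le[OF i] by (intro L_mono) simp
      ultimately have "max (L (lev ?pl i1 - 1)) (d i1 j) \<le> \<alpha> ?pl g j" using 1 by simp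
      then show ?thesis using \<alpha>_le(2)[OF i, of j] i by force
    qed blast
    have "sum (\<alpha> ?pl g) D \<le> W"
      unfolding W_def using weak_duality[of F' D \<sigma> ?pl g] F' D \<alpha>_dual_usable usable by blast
    from robust_bound[OF S(2) rep D(1,2) _ this Lg] False
    obtain t v C' u where "t \<le> T + 1 \<and> v \<le> 2 ^ \<beta> \<and> C' \<subseteq> C \<and> card C' = p \<and>
      (\<forall>j\<in>C'. \<exists>i\<in>opened ?pl S t v. d i j \<le> u j) \<and> sum f (opened ?pl S t v) + sum u C' \<le> 38 * W"
      by auto
    then show ?thesis using g S(1) net_F[OF S(2)] by blast
  qed
  then obtain g S t v C' u where g: "g \<le> T"
    and Og: "Os ! g = (opened ?pl S, dist_table (opened ?pl S))" and SF: "S \<subseteq> F"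
    and tv: "t \<le> T + 1" "v \<le> 2 ^ \<beta>" and C': "C' \<subseteq> C" "card C' = p"
    and u: "\<And>j. j \<in> C' \<Longrightarrow> \<exists>i\<in>opened ?pl S t v. d i j \<le> u j"
    and cost: "sum f (opened ?pl S t v) + sum u C' \<le> 38 * W"
    by blast
  let ?Op = "opened ?pl S t v"
  have OF: "?Op \<subseteq> F" using SF by (auto simp: opened_def)
  have lvl: "\<exists>w. (j, w) \<in> dist_table (opened ?pl S) t v \<and> L w \<le> 2 * u j" if j: "j \<in> C'" for j
  proof -
    obtain i where i: "i \<in> ?Op" "d i j \<le> u j" using u[OF j] by blast
    have iF: "i \<in> F" and jC: "j \<in> C" using i OF j C' by blast+
    have "(j, round_up (d i j)) \<in> dist_table (opened ?pl S) t v"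
      using d_round[OF iF jC] jC tv i by (auto simp: dist_table_def)
    moreover have "L (round_up (d i j)) \<le> 2 * u j" using d_round(2)[OF iF jC] i(2) by linarith
    ultimately show ?thesis by blast
  qed
  have least: "L (LEAST w. (j, w) \<in> dist_table (opened ?pl S) t v) \<le> 2 * u j" if j: "j \<in> C'" for j
  proof -
    obtain w where w: "(j, w) \<in> dist_table (opened ?pl S) t v" "L w \<le> 2 * u j" using lvl[OF j] by blast
    have "(LEAST w. (j, w) \<in> dist_table (opened ?pl S) t v) \<le> w" using w(1) by (rule Least_le)
    then show ?thesis using L_mono w(2) order_trans by blast
  qed
  have cand: "(g, t, v, C') \<in> candidates (2 ^ \<beta>) p a"
    using g tv C' lvl by (auto simp: candidates_def Os(1) Og)
  have inj: "inj_on (\<lambda>i. (i, round_up (f i))) ?Op" by (auto simp: inj_on_def)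
  have fl: "{x \<in> (\<lambda>i. (i, round_up (f i))) ` F. fst x \<in> ?Op} = (\<lambda>i. (i, round_up (f i))) ` ?Op"
    using OF by auto
  have "candidate_cost a (g, t, v, C') =
      (\<Sum>i\<in>?Op. L (round_up (f i))) + (\<Sum>j\<in>C'. L (LEAST w. (j, w) \<in> dist_table (opened ?pl S) t v))"
    by (simp add: candidate_cost_def Os(1) Og fl sum.reindex[OF inj])
  also have "\<dots> \<le> (\<Sum>i\<in>?Op. 2 * f i) + (\<Sum>j\<in>C'. 2 * u j)"
    by (intro add_mono sum_mono) (use f_round OF least in auto)
  also have "\<dots> \<le> 76 * W" using cost by (simp add: sum_distrib_left[symmetric])
  finally show ?thesis using cand unfolding W_def by blast
qed

lemma finite_candidates: "robust_ok a \<Longrightarrow> finite (candidates b p a)"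
  by (rule finite_subset[of _ "{..T} \<times> {..T + 1} \<times> {..b} \<times> Pow C"])
     (use fin in \<open>auto simp: robust_ok_def candidates_def\<close>)

text \<open>The announced levels supply \<open>u\<close>: they bound the true distances from above,
  and the least announced cost is at most that of the candidate from
  \<open>robust_candidate\<close>. Competitors are given with an assignment \<open>\<sigma>\<close>,
  which keeps all costs in the reals.\<close>

lemma robust_choice:
  assumes a: "robust_ok a" and p: "p \<le> card C" and choice: "robust_choice (2 ^ \<beta>) p a = (Op, C')"
  shows "Op \<subseteq> F" "C' \<subseteq> C" "card C' = p"
    and "\<exists>u. (\<forall>j\<in>C'. \<exists>i\<in>Op. d i j \<le> u j) \<and> (\<forall>F' D \<sigma>. F' \<subseteq> F \<longrightarrow> D \<subseteq> C \<longrightarrow> p \<le> card D \<longrightarrow>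
      (\<forall>j\<in>D. \<sigma> j \<in> F') \<longrightarrow> sum f Op + sum u C' \<le> 76 * (sum f F' + (\<Sum>j\<in>D. d (\<sigma> j) j)))"
proof -
  let ?pl = "\<lambda>_::nat. T" and ?Cand = "candidates (2 ^ \<beta>) p a"
  obtain Os where Os: "a = ((\<lambda>i. (i, round_up (f i))) ` F, C, Os)" "\<And>g. g \<le> T \<Longrightarrow> guess_ok g (Os ! g)"
    using a by (cases a) (auto simp: robust_ok_def)
  obtain i0 where "i0 \<in> F" using card_FC n by fastforce
  then have ne: "?Cand \<noteq> {}" using robust_candidate[OF a order.refl order.refl p, of "\<lambda>_. i0"] by blast
  define x where "x = (SOME x. x \<in> ?Cand \<and> (\<forall>y\<in>?Cand. candidate_cost a x \<le> candidate_cost a y))"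
  have "\<exists>x. x \<in> ?Cand \<and> (\<forall>y\<in>?Cand. candidate_cost a x \<le> candidate_cost a y)"
  proof -
    obtain x where "is_arg_min (candidate_cost a) (\<lambda>x. x \<in> ?Cand) x"
      using ex_is_arg_min_if_finite[OF finite_candidates[OF a] ne] by blast
    then have "x \<in> ?Cand \<and> (\<forall>y\<in>?Cand. candidate_cost a x \<le> candidate_cost a y)"
      unfolding is_arg_min_linorder by blast
    then show ?thesis by blast
  qed
  from someI_ex[OF this, folded x_def]
  have x: "x \<in> ?Cand" "\<And>y. y \<in> ?Cand \<Longrightarrow> candidate_cost a x \<le> candidate_cost a y" by blast+
  obtain g t v C1 where xe: "x = (g, t, v, C1)" by (cases x)
  then have OC: "Op = fst (Os ! g) t v" "C' = C1"
    using choice unfolding robust_choice_def x_def[symmetric] by (auto simp: Os(1))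
  have g: "g \<le> T" and C': "C' \<subseteq> C" "card C' = p" "\<forall>j\<in>C'. \<exists>w. (j, w) \<in> snd (Os ! g) t v"
    using x(1) by (auto simp: xe OC(2) candidates_def Os(1))
  obtain S where S: "Os ! g = (opened ?pl S, dist_table (opened ?pl S))"
      "net (usable ?pl g) (lev ?pl) S"
    using Os(2)[OF g] by (auto simp: guess_ok_def)
  have Op: "Op = opened ?pl S t v" by (simp add: OC S)
  then show OF: "Op \<subseteq> F" using net_F[OF S(2)] by (auto simp: opened_def)
  show "C' \<subseteq> C" "card C' = p" by (rule C')+
  define u where "u j = L (LEAST w. (j, w) \<in> dist_table (opened ?pl S) t v)" for j
  have inj: "inj_on (\<lambda>i. (i, round_up (f i))) Op" by (auto simp: inj_on_def)
  have fl: "{x \<in> (\<lambda>i. (i, round_up (f i))) ` F. fst x \<in> Op} = (\<lambda>i. (i, round_up (f i))) ` Op"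
    using OF by auto
  have cost: "candidate_cost a x = (\<Sum>i\<in>Op. L (round_up (f i))) + sum u C'"
    using Op by (simp add: xe candidate_cost_def Os(1) S(1) OC(2) fl[unfolded Op] sum.reindex[OF inj[unfolded Op]] u_def)
  have "(\<Sum>i\<in>Op. f i) \<le> (\<Sum>i\<in>Op. L (round_up (f i)))"
    by (rule sum_mono) (use f_round OF in auto)
  then have le: "sum f Op + sum u C' \<le> candidate_cost a x" unfolding cost by simp
  have "\<exists>i\<in>Op. d i j \<le> u j" if "j \<in> C'" for j
  proof -
    have "\<exists>w. (j, w) \<in> dist_table (opened ?pl S) t v" using C'(3) that by (simp add: S)
    then have "(j, LEAST w. (j, w) \<in> dist_table (opened ?pl S) t v) \<in> dist_table (opened ?pl S) t v"
      by (rule LeastI_ex)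
    then show ?thesis unfolding u_def Op dist_table_def by blast
  qed
  moreover have "sum f Op + sum u C' \<le> 76 * (sum f F' + (\<Sum>j\<in>D. d (\<sigma> j) j))"
    if opt: "F' \<subseteq> F" "D \<subseteq> C" "p \<le> card D" "\<forall>j\<in>D. \<sigma> j \<in> F'" for F' D \<sigma>
  proof -
    obtain y where "y \<in> ?Cand" "candidate_cost a y \<le> 76 * (sum f F' + (\<Sum>j\<in>D. d (\<sigma> j) j))"
      using robust_candidate[OF a opt(1-3), of \<sigma>] opt(4) by blast
    then show ?thesis using x(2)[of y] le by linarith
  qed
  ultimately show "\<exists>u. (\<forall>j\<in>C'. \<exists>i\<in>Op. d i j \<le> u j) \<and> (\<forall>F' D \<sigma>. F' \<subseteq> F \<longrightarrow> D \<subseteq> C \<longrightarrow> p \<le> card D \<longrightarrow>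
      (\<forall>j\<in>D. \<sigma> j \<in> F') \<longrightarrow> sum f Op + sum u C' \<le> 76 * (sum f F' + (\<Sum>j\<in>D. d (\<sigma> j) j)))"
    by blast
qed

section \<open>Correctness of the penalty protocol\<close>

definition pen_level :: "nat \<Rightarrow> nat" where
  "pen_level j = (if j \<in> C then round_up (pen j) else 0)"

definition penalty_ok :: "solution \<Rightarrow> bool" where
  "penalty_ok = (\<lambda>(S, C'). net (usable pen_level T) (lev pen_level) S \<and>
     C' = {j \<in> C. \<exists>i\<in>S. d i j \<le> L (pen_level j)})"

lemma pen_round:
  assumes "j \<in> C"
  shows "pen j \<le> L (round_up (pen j))" "L (round_up (pen j)) \<le> 2 * pen j" "round_up (pen j) \<le> T"
  using round_up[of "pen j"] pen assms by auto

lemma penalty_holds: "protocol_holds penalty_prot penalty_rounds penalty_ok"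
proof -
  have final: "protocol_holds ((\<lambda>(levs, S).
     Bcast (cli_says (\<lambda>j \<delta> u. if served_by \<delta> S (round_up u) then {[j]} else {}))
       (\<lambda>P. Ret (S, {j. [j] \<in> P}))) x) (Suc 0) penalty_ok"
    if "case x of (levs, S) \<Rightarrow> levs = (\<lambda>i. (i, lev pen_level i)) ` usable pen_level T \<and>
      net (usable pen_level T) (lev pen_level) S" for x
  proof -
    obtain levs S where x: "x = (levs, S)" by (cases x)
    then have net: "net (usable pen_level T) (lev pen_level) S" using that by auto
    then have SF: "S \<subseteq> F" by (rule net_F)
    have "protocol_holds (Bcast (cli_says (\<lambda>j \<delta> u. if served_by \<delta> S (round_up u) then {[j]} else {}))
       (\<lambda>P. Ret (S, {j. [j] \<in> P}))) (Suc 0) penalty_ok"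
    proof (rule holds_cli_says, goal_cases)
      case (1 j)
      then show ?case using name_less \<kappa> by (auto simp: Msgs_def)
    next
      case 2
      have "{j. [j] \<in> (\<Union>j\<in>C. if served_by ((\<lambda>i. Some (d i j)) |` F) S (round_up (pen j)) then {[j]} else {})} =
          {j \<in> C. \<exists>i\<in>S. d i j \<le> L (pen_level j)}"
        using SF by (auto simp: served_by_def pen_level_def split: if_splits)
      then show ?case using net by (simp add: penalty_ok_def)
    qed
    then show ?thesis by (simp add: x)
  qed
  have "protocol_holds penalty_prot (Suc (Suc net_rounds + Suc 0)) penalty_ok"
    unfolding penalty_prot_def
  proof (rule holds_cli_says, goal_cases)
    case (1 j)
    then show ?case using pen_round(3)[OF 1] T name_less \<kappa> by (auto simp: Msgs_def)
  next
    case 2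
    \<comment> \<open>The default 0 outside \<open>C\<close> makes the two functions equal
      everywhere, so that \<open>build_net_holds\<close> applies to
      \<open>pen_level\<close>.\<close>
    have "(\<lambda>j. if \<exists>t. [j, t] \<in> (\<Union>j\<in>C. {[j, round_up (pen j)]})
        then THE t. [j, t] \<in> (\<Union>j\<in>C. {[j, round_up (pen j)]}) else 0) = pen_level"
      by (auto simp: pen_level_def fun_eq_iff)
    then show ?case using hoare_bind[OF build_net_holds final] by simp
  qed
  then show ?thesis by (rule hoare_mono) (auto simp: penalty_rounds_def)
qed

text \<open>A client outside \<open>D\<close> has \<open>\<alpha>\<close> at most its rounded
  penalty, so at most twice the penalty, which turns 18 into 36. Unreached facilities satisfy their
  dual constraint as well, so every \<open>F'\<close> can be compared.\<close>

lemma penalty_bound_opt: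
  assumes ok: "penalty_ok (S, C')" and F': "F' \<subseteq> F" and D: "D \<subseteq> C" "\<And>j. j \<in> D \<Longrightarrow> \<sigma> j \<in> F'"
  shows "S \<subseteq> F" "C' \<subseteq> C" "\<And>j. j \<in> C' \<Longrightarrow> S \<noteq> {}"
    and "sum f S + (\<Sum>j\<in>C'. Min ((\<lambda>i. d i j) ` S)) + sum pen (C - C')
      \<le> 36 * (sum f F' + (\<Sum>j\<in>D. d (\<sigma> j) j) + sum pen (C - D))"
proof -
  let ?pl = pen_level
  have net: "net (usable ?pl T) (lev ?pl) S" and C': "C' = {j \<in> C. \<exists>i\<in>S. d i j \<le> L (?pl j)}"
    using ok by (auto simp: penalty_ok_def)
  show "S \<subseteq> F" by (rule net_F[OF net])
  show "C' \<subseteq> C" "\<And>j. j \<in> C' \<Longrightarrow> S \<noteq> {}" by (auto simp: C')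
  have pl: "pen j \<le> L (?pl j)" "L (?pl j) \<le> 2 * pen j" if "j \<in> C" for j
    using pen_round[OF that] that by (auto simp: pen_level_def)
  have plT: "?pl j \<le> T" for j using pen_round(3) by (auto simp: pen_level_def)
  have pen0: "0 \<le> pen j" if "j \<in> C" for j using pl(2)[OF that] L_nonneg[of "?pl j"] by linarith
  let ?m = "\<lambda>j. if \<exists>i\<in>S. d i j \<le> L (?pl j) then Min ((\<lambda>i. d i j) ` S) else L (?pl j)"
  have "sum ?m C = sum ?m C' + sum ?m (C - C')"
    using fin C' by (metis (no_types, lifting) sum.subset_diff add.commute \<open>C' \<subseteq> C\<close>)
  moreover have "sum ?m C' = (\<Sum>j\<in>C'. Min ((\<lambda>i. d i j) ` S))"
    by (rule sum.cong) (auto simp: C')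
  moreover have "sum pen (C - C') \<le> sum ?m (C - C')"
    by (rule sum_mono) (use pl in \<open>auto simp: C'\<close>)
  ultimately have le: "sum f S + (\<Sum>j\<in>C'. Min ((\<lambda>i. d i j) ` S)) + sum pen (C - C') \<le> 18 * sum (\<alpha> ?pl T) C"
    using penalty_bound[OF net] by linarith
  have "sum (\<alpha> ?pl T) C \<le> sum f F' + (\<Sum>j\<in>D. d (\<sigma> j) j) + 2 * sum pen (C - D)"
  proof -
    have dual: "(\<Sum>j\<in>C. max 0 (\<alpha> ?pl T j - d i j)) \<le> f i" if "i \<in> F" for i
    proof (cases "reach ?pl i T")
      case True
      have "f i \<le> L T" using f_round(1,3)[OF that] L_mono[of "round_up (f i)" T] by linarith
      then show ?thesis using \<alpha>_dual_usable[of i ?pl T] True that by (auto simp: usable_def)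
    next
      case False
      then show ?thesis using \<alpha>_dual_unreached that plT by blast
    qed
    have "sum (\<alpha> ?pl T) C = sum (\<alpha> ?pl T) D + sum (\<alpha> ?pl T) (C - D)"
      using fin D by (metis sum.subset_diff add.commute)
    also have "sum (\<alpha> ?pl T) D \<le> sum f F' + (\<Sum>j\<in>D. d (\<sigma> j) j)"
      by (rule weak_duality[OF F' D]) (use dual F' in auto)
    also have "sum (\<alpha> ?pl T) (C - D) \<le> (\<Sum>j\<in>C - D. 2 * pen j)"
    proof (rule sum_mono)
      fix j assume "j \<in> C - D"
      then show "\<alpha> ?pl T j \<le> 2 * pen j" using \<alpha>_le(1)[of ?pl T j] pl(2)[of j] by auto
    qed
    finally show ?thesis by (simp add: sum_distrib_left)
  qed
  moreover have "0 \<le> sum f F'" "0 \<le> (\<Sum>j\<in>D. d (\<sigma> j) j)"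
    using F' f_nonneg by (auto intro!: sum_nonneg)
  then have "18 * sum (\<alpha> ?pl T) C \<le> 36 * (sum f F' + (\<Sum>j\<in>D. d (\<sigma> j) j) + sum pen (C - D))"
  proof -
    have "18 * x \<le> 36 * (y + z + w)" if "x \<le> y + z + 2 * w" "0 \<le> y" "0 \<le> z" for x y z w :: real
    proof -
      have "18 * x \<le> 18 * (y + z + 2 * w)" using that(1) by (rule mult_left_mono) simp
      also have "\<dots> \<le> 36 * (y + z + w)" using that(2,3) by (simp add: distrib_left)
      finally show ?thesis .
    qed
    then show ?thesis using \<open>sum (\<alpha> ?pl T) C \<le> _\<close> \<open>0 \<le> sum f F'\<close> \<open>0 \<le> (\<Sum>j\<in>D. d (\<sigma> j) j)\<close> by blast
  qed
  then show "sum f S + (\<Sum>j\<in>C'. Min ((\<lambda>i. d i j) ` S)) + sum pen (C - C')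
      \<le> 36 * (sum f F' + (\<Sum>j\<in>D. d (\<sigma> j) j) + sum pen (C - D))" using le by (rule order_trans[rotated])
qed

end

section \<open>The algorithms\<close>

subsection \<open>Parameters\<close>

definition lg :: "nat \<Rightarrow> nat" where
  "lg n = (LEAST l. n \<le> 2 ^ l)"

text \<open>Makes \<open>unit_length\<close> at most \<open>1 / (4 * n ^ (c + 1))\<close>, so that
  \<open>2 * \<epsilon> * n\<close> stays below \<open>1 / n ^ c\<close>, a lower bound for every
  positive number in the input.\<close>

definition unit_bits :: "nat \<Rightarrow> nat \<Rightarrow> nat" where
  "unit_bits c n = (c + 1) * lg n + 2"

definition unit_length :: "nat \<Rightarrow> nat \<Rightarrow> real" where
  "unit_length c n = 1 / 2 ^ unit_bits c n"

text \<open>Chosen such that \<open>2 ^ T * \<epsilon>\<close> is at least \<open>2 * n ^ c\<close>,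
  enough for an opening cost plus a distance.\<close>

definition top_level :: "nat \<Rightarrow> nat \<Rightarrow> nat" where
  "top_level c n = unit_bits c n + c * lg n + 1"

definition hits :: "nat \<Rightarrow> nat" where
  "hits n = 5 * (lg n + 4)"

definition seed_bits :: "nat \<Rightarrow> nat \<Rightarrow> nat" where
  "seed_bits c n = (c + 4) * lg n"

text \<open>One family serves all sets of names up to \<open>n ^ c\<close>, hence every instance;
  determined by \<open>c\<close>, \<open>n\<close> and \<open>s\<close>, it is known to all machines
  without communication.\<close>

definition sample :: "nat \<Rightarrow> nat \<Rightarrow> nat \<Rightarrow> nat \<Rightarrow> nat set" where
  "sample c n s = (SOME D. \<forall>N \<subseteq> {..n ^ c}. card N \<le> 2 ^ s \<longrightarrow>
     card {\<sigma>. \<sigma> < 2 ^ seed_bits c n \<and> bad_sample (hits n) s N (D \<sigma>)} * n < 2 ^ seed_bits c n)"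

definition entry_bits :: "nat \<Rightarrow> nat \<Rightarrow> nat" where
  "entry_bits c n = (2 * c + 8) * lg n + 8"

definition per_node :: "nat \<Rightarrow> nat \<Rightarrow> nat" where
  "per_node c n = (top_level c n + 2) * (top_level c n + 1) + hits n"

text \<open>About twice the mean plus \<open>(e + 2) * lg n\<close>: a single overload then has
  probability at most \<open>1 / n ^ (e + 2)\<close>, and there are at most
  \<open>2 * n \<le> n ^ 2\<close> possible overloads.\<close>

definition load :: "nat \<Rightarrow> nat \<Rightarrow> nat \<Rightarrow> nat" where
  "load e n k = 2 * (n div k + 1) + (e + 2) * lg n"

text \<open>A machine may host \<open>load\<close> facilities and as many clients. The
  \<open>+ 1\<close> makes it evident that a block is nonempty.\<close>

definition block_length :: "nat \<Rightarrow> nat \<Rightarrow> nat \<Rightarrow> nat \<Rightarrow> nat" where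
  "block_length c e n k = 2 * load e n k * per_node c n + 1"

text \<open>There are at most \<open>6 * 2 ^ (5 * \<beta>)\<close> messages, hence 3 bits beyond
  \<open>5 * \<beta>\<close>. All code words have the same positive length, which excludes
  \<open>[]\<close>.\<close>

definition encoding :: "nat \<Rightarrow> nat list \<Rightarrow> bool list" where
  "encoding \<beta> = (SOME h. inj_on h (Msgs \<beta>) \<and> h ` Msgs \<beta> \<subseteq> {bs. length bs = 5 * \<beta> + 3})"

section \<open>Bounds for the parameters\<close>

lemma le_lg: "n \<le> 2 ^ lg n"
  unfolding lg_def by (rule LeastI[of _ n]) (simp add: less_imp_le)

lemma lg_pos: "2 \<le> n \<Longrightarrow> 1 \<le> lg n"
  using le_lg[of n] by (cases "lg n") auto

lemma lg_le: "2 \<le> n \<Longrightarrow> real (lg n) \<le> 2 * log 2 (real n)"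
proof -
  assume n: "2 \<le> n"
  have "\<not> n \<le> 2 ^ (lg n - 1)"
    unfolding lg_def by (rule not_less_Least) (use lg_pos[OF n] in \<open>simp add: lg_def\<close>)
  then have "2 ^ (lg n - 1) \<le> real n" by simp
  then have "real (lg n - 1) \<le> log 2 (real n)" using n by (simp add: le_log_iff powr_realpow)
  moreover have "1 \<le> log 2 (real n)" using n by (simp add: le_log_iff)
  ultimately show ?thesis using lg_pos[OF n] by simp
qed

lemma encoding:
  "inj_on (encoding \<beta>) (Msgs \<beta>)" "x \<in> Msgs \<beta> \<Longrightarrow> length (encoding \<beta> x) = 5 * \<beta> + 3"
proof -
  have fin: "finite (Msgs \<beta>)" unfolding Msgs_def by (rule finite_lists_length_le) simp
  have "card (Msgs \<beta>) = (\<Sum>i\<le>5. (2 ^ \<beta>) ^ i)"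
    unfolding Msgs_def by (subst card_lists_length_le) simp_all
  also have "\<dots> \<le> (\<Sum>i\<le>(5::nat). (2 ^ \<beta>) ^ 5)" by (intro sum_mono power_increasing) auto
  also have "\<dots> = 6 * (2 ^ \<beta>) ^ 5" by simp
  also have "\<dots> \<le> 2 ^ 3 * 2 ^ (5 * \<beta>)" by (simp add: power_mult[symmetric] mult.commute)
  also have "\<dots> = 2 ^ (5 * \<beta> + 3)" by (simp add: power_add)
  also have "\<dots> = card {bs :: bool list. length bs = 5 * \<beta> + 3}"
    using card_lists_length_eq[of "UNIV :: bool set"] by simp
  finally have le: "card (Msgs \<beta>) \<le> card {bs :: bool list. length bs = 5 * \<beta> + 3}" .
  have "finite {bs :: bool list. length bs = 5 * \<beta> + 3}"
    using finite_lists_length_eq[of "UNIV :: bool set"] by simp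
  then have "\<exists>h. h ` Msgs \<beta> \<subseteq> {bs :: bool list. length bs = 5 * \<beta> + 3} \<and> inj_on h (Msgs \<beta>)"
    using card_le_inj[OF fin _ le] by blast
  then have "\<exists>h. inj_on h (Msgs \<beta>) \<and> h ` Msgs \<beta> \<subseteq> {bs :: bool list. length bs = 5 * \<beta> + 3}" by blast
  from someI_ex[OF this, folded encoding_def]
  show "inj_on (encoding \<beta>) (Msgs \<beta>)" "x \<in> Msgs \<beta> \<Longrightarrow> length (encoding \<beta> x) = 5 * \<beta> + 3" by auto
qed

lemma sample:
  assumes n: "2 \<le> n" and N: "N \<subseteq> {..n ^ c}" "card N \<le> 2 ^ s"
  shows "card {\<sigma>. \<sigma> < 2 ^ seed_bits c n \<and> bad_sample (hits n) s N (sample c n s \<sigma>)} * n < 2 ^ seed_bits c n"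
proof -
  have "1 \<le> n ^ c" using n by simp
  moreover have "n ^ c * (2 * 2) \<le> n ^ c * (n * n)" using n by (intro mult_left_mono mult_mono) auto
  moreover have "n ^ (c + 2) = n ^ c * (n * n)" by (simp add: power_add power2_eq_square)
  moreover have "card {..n ^ c} = n ^ c + 1" by simp
  ultimately have "card {..n ^ c} + 1 \<le> n ^ (c + 2)" by linarith
  then have "\<exists>D :: nat \<Rightarrow> nat set. \<forall>N \<subseteq> {..n ^ c}. card N \<le> 2 ^ s \<longrightarrow>
     card {\<sigma>. \<sigma> < 2 ^ seed_bits c n \<and> bad_sample (hits n) s N (D \<sigma>)} * n < 2 ^ seed_bits c n"
    by (rule sample_family_exists[rotated, OF _ n le_lg]) (auto simp: hits_def seed_bits_def)
  from someI_ex[OF this, folded sample_def] show ?thesis using N by blast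
qed

lemma short_number_bounds:
  assumes "short_number c n x" "2 \<le> n"
  shows "0 \<le> x" "x \<le> real (n ^ c)" "x \<noteq> 0 \<Longrightarrow> 1 / real (n ^ c) \<le> x"
proof -
  obtain a b :: nat where ab: "x = real a / real b" "a \<le> n ^ c" "0 < b" "b \<le> n ^ c"
    using assms(1) by (auto simp: short_number_def)
  show "0 \<le> x" using ab by simp
  have "x \<le> real a" using ab by (simp add: divide_le_eq mult_le_cancel_left1)
  then show "x \<le> real (n ^ c)" using ab(2) by (meson of_nat_le_iff order_trans)
  show "1 / real (n ^ c) \<le> x" if "x \<noteq> 0"
  proof -
    have "1 \<le> a" using that ab by (cases a) auto
    have "1 / real (n ^ c) \<le> 1 / real b"
    proof (rule divide_left_mono)
      show "real b \<le> real (n ^ c)" using ab(4) by (simp only: of_nat_le_iff)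
      show "0 < real (n ^ c) * real b" using ab(3) assms(2) by simp
    qed simp
    also have "\<dots> \<le> real a / real b" using \<open>1 \<le> a\<close> ab(3) by (intro divide_right_mono) auto
    finally show ?thesis by (simp add: ab(1))
  qed
qed

lemma unit_length_bounds:
  assumes "2 \<le> n"
  shows "0 < unit_length c n" "2 * unit_length c n * real n < 1 / real (n ^ c)"
    "2 * unit_length c n \<le> 1 / real (n ^ c)" "2 * real (n ^ c) \<le> 2 ^ top_level c n * unit_length c n"
proof -
  show "0 < unit_length c n" by (simp add: unit_length_def)
  have nl: "real n \<le> 2 ^ lg n" using le_lg by simp
  have n0: "0 < real n" using assms by simp
  have "real n ^ (c + 1) \<le> (2 ^ lg n) ^ (c + 1)" using nl n0 by (intro power_mono) auto
  also have "\<dots> = 2 ^ ((c + 1) * lg n)" by (simp only: power_mult[symmetric] mult.commute)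
  finally have le: "4 * (real n ^ c * real n) \<le> 2 ^ unit_bits c n"
    by (simp add: unit_bits_def power_add mult.commute)
  have "0 < real n ^ c * real n" using n0 by simp
  then show A: "2 * unit_length c n * real n < 1 / real (n ^ c)"
  proof -
    have "2 * (real n ^ c * real n) < 2 ^ unit_bits c n"
      using le \<open>0 < real n ^ c * real n\<close> by linarith
    then show ?thesis using n0 unfolding unit_length_def by (simp add: field_simps)
  qed
  have "2 * unit_length c n * 1 \<le> 2 * unit_length c n * real n"
    using assms by (intro mult_left_mono) (auto simp: unit_length_def)
  then show "2 * unit_length c n \<le> 1 / real (n ^ c)" using A by simp
  have "real n ^ c \<le> (2 ^ lg n) ^ c" using nl n0 by (intro power_mono) auto
  also have "\<dots> = 2 ^ (c * lg n)" by (simp only: power_mult[symmetric] mult.commute)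
  finally show "2 * real (n ^ c) \<le> 2 ^ top_level c n * unit_length c n"
    by (simp add: top_level_def unit_length_def power_add)
qed

lemma fl_nodes_instance:
  assumes I: "valid_instance c n I" and n: "2 \<le> n"
    and pen: "\<And>j. j \<in> clients I \<Longrightarrow> short_number c n (pen j)"
  shows "fl_nodes (unit_length c n) (top_level c n) (lg n) (hits n) (seed_bits c n) (sample c n)
    (facilities I) (clients I) (metric I) (open_cost I) pen n (entry_bits c n) (per_node c n)"
proof -
  let ?F = "facilities I" and ?C = "clients I"
  interpret Metric_space "?F \<union> ?C" "metric I" using I by (simp add: valid_instance_def)
  have fc: "short_number c n (open_cost I i)" if "i \<in> ?F" for i
    using I that by (simp add: valid_instance_def)
  have dc: "short_number c n (metric I i j)" if "i \<in> ?F" "j \<in> ?C" for i j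
    using I that by (simp add: valid_instance_def)
  note u = unit_length_bounds[OF n, of c]
  have T: "top_level c n + 1 < 2 ^ entry_bits c n"
  proof -
    have "top_level c n + 1 \<le> entry_bits c n"
      by (simp add: top_level_def unit_bits_def entry_bits_def algebra_simps)
    also have "\<dots> < 2 ^ entry_bits c n" by simp
    finally show ?thesis .
  qed
  show ?thesis
  proof unfold_locales
    show "finite ?F" "finite ?C" "card ?F = n" "card ?C = n"
      using I by (auto simp: valid_instance_def)
    show "2 \<le> n" by fact
    show "n \<le> 2 ^ lg n" by (rule le_lg)
    show "Suc v < 2 ^ entry_bits c n" if "v \<in> ?F \<union> ?C" for v
    proof -
      have "v \<le> n ^ c" using I that unfolding valid_instance_def by blast
      also have "\<dots> \<le> (2 ^ lg n) ^ c" by (intro power_mono le_lg) simp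
      also have "\<dots> = 2 ^ (c * lg n)" by (simp only: power_mult[symmetric] mult.commute)
      finally have "Suc v \<le> 2 ^ (c * lg n) + 1" by simp
      also have "\<dots> < 2 ^ (c * lg n + 2)"
      proof -
        have "(1::nat) \<le> 2 ^ (c * lg n)" "(2::nat) ^ (c * lg n + 2) = 4 * 2 ^ (c * lg n)"
          by (simp_all add: power_add)
        then show ?thesis by linarith
      qed
      also have "\<dots> \<le> 2 ^ entry_bits c n"
        by (intro power_increasing) (auto simp: entry_bits_def algebra_simps)
      finally show ?thesis .
    qed
    show "0 < unit_length c n" by (rule u)
    show "seed_bits c n < entry_bits c n" by (simp add: seed_bits_def entry_bits_def algebra_simps)
    show "0 < top_level c n" by (simp add: top_level_def)
    show "top_level c n + 1 < 2 ^ entry_bits c n" by (rule T)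
    show "1 \<le> per_node c n" "hits n \<le> per_node c n"
      "(top_level c n + 2) * (top_level c n + 1) \<le> per_node c n"
      by (simp_all add: per_node_def)
    show "card {\<sigma>. \<sigma> < 2 ^ seed_bits c n \<and> bad_sample (hits n) s N (sample c n s \<sigma>)} * n < 2 ^ seed_bits c n"
      if "N \<subseteq> ?F" "card N \<le> 2 ^ s" for s N
    proof (rule sample[OF n _ that(2)])
      show "N \<subseteq> {..n ^ c}" using that(1) I unfolding valid_instance_def by auto
    qed
    show "0 \<le> open_cost I i" if "i \<in> ?F" for i using I that by (simp add: valid_instance_def)
    show "2 * unit_length c n * real n < open_cost I i" if "i \<in> ?F" "0 < open_cost I i" for i
      using short_number_bounds(3)[OF fc[OF that(1)] n] that(2) u(2) by linarith
    show "2 * unit_length c n \<le> metric I i j" if "i \<in> ?F" "j \<in> ?C" "0 < metric I i j" for i j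
      using short_number_bounds(3)[OF dc[OF that(1,2)] n] that(3) u(3) by linarith
    show "open_cost I i + metric I i j \<le> 2 ^ top_level c n * unit_length c n"
      if "i \<in> ?F" "j \<in> ?C" for i j
      using short_number_bounds(2)[OF dc[OF that] n] short_number_bounds(2)[OF fc[OF that(1)] n] u(4)
      by linarith
    show "pen j = 0 \<or> 2 * unit_length c n \<le> pen j" if "j \<in> ?C" for j
      using short_number_bounds(3)[OF pen[OF that] n] u(3) by linarith
    show "pen j \<le> 2 ^ top_level c n * unit_length c n" if "j \<in> ?C" for j
      using short_number_bounds(1,2)[OF pen[OF that] n] u(4) by linarith
  qed
qed

subsection \<open>Load balancing\<close>

text \<open>The event \<open>E\<close> is arbitrary except that it contains all balanced placements,
  so the bound serves both problems; what remains is a union bound over the loads of the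
  \<open>k\<close> machines.\<close>

lemma prob_random_choices_ge:
  assumes n: "2 \<le> n" and k: "1 \<le> k" "k \<le> n"
    and FC: "finite (facilities I)" "finite (clients I)" "card (facilities I) = n" "card (clients I) = n"
    and E: "\<And>h g r. \<lbrakk>\<And>i. i \<in> facilities I \<Longrightarrow> h i < k; \<And>j. j \<in> clients I \<Longrightarrow> g j < k;
      \<And>m. m < k \<Longrightarrow> card {i \<in> facilities I. h i = m} \<le> load e n k;
      \<And>m. m < k \<Longrightarrow> card {j \<in> clients I. g j = m} \<le> load e n k\<rbrakk> \<Longrightarrow> (h, g, r) \<in> E"
  shows "1 - 1 / real n ^ e \<le> measure_pmf.prob (random_choices A n k I) E"
proof -
  let ?M = "random_choices A n k I"
  let ?u = "\<lambda>_::nat. pmf_of_set {..<k}"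
  let ?PF = "Pi_pmf (facilities I) 0 ?u" and ?PC = "Pi_pmf (clients I) 0 ?u"
  let ?BF = "\<lambda>m. {h. load e n k \<le> card {i \<in> facilities I. h i = m}}"
  let ?BC = "\<lambda>m. {g. load e n k \<le> card {j \<in> clients I. g j = m}}"
  define s where "s = (e + 2) * lg n"
  have ld: "2 * real n / real k + real s \<le> real (load e n k)"
  proof -
    have "n \<le> (n div k + 1) * k" using dividend_less_div_times[of k n] k by simp
    then have "real n \<le> real (n div k + 1) * real k" by (metis of_nat_le_iff of_nat_mult)
    then have "real n / real k \<le> real (n div k + 1)" using k by (simp add: divide_le_eq)
    then have "2 * real n / real k \<le> 2 * real (n div k + 1)" by simp
    then show ?thesis by (simp add: load_def s_def algebra_simps)
  qed
  have "0 \<in> {..<k}" using k by simp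
  then have kpos: "{..<k} \<noteq> {}" by blast
  have BF: "measure_pmf.prob ?M {(h, g, r). h \<in> ?BF m} \<le> 1 / 2 ^ s" if "m < k" for m
  proof -
    have "measure_pmf.prob ?M {(h, g, r). h \<in> ?BF m} = measure_pmf.prob (map_pmf fst ?M) (?BF m)"
      by (simp add: measure_map_pmf vimage_def case_prod_unfold)
    also have "map_pmf fst ?M = ?PF" by (simp add: random_choices_def map_fst_pair_pmf)
    also have "measure_pmf.prob ?PF (?BF m) \<le> 1 / 2 ^ s"
      by (rule prob_overload_le) (use FC k that ld in auto)
    finally show ?thesis .
  qed
  have BC: "measure_pmf.prob ?M {(h, g, r). g \<in> ?BC m} \<le> 1 / 2 ^ s" if "m < k" for m
  proof -
    have "measure_pmf.prob ?M {(h, g, r). g \<in> ?BC m} =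
        measure_pmf.prob (map_pmf fst (map_pmf snd ?M)) (?BC m)"
      by (simp add: measure_map_pmf vimage_def case_prod_unfold del: map_pmf_comp)
    also have "map_pmf fst (map_pmf snd ?M) = ?PC"
      by (simp add: random_choices_def map_fst_pair_pmf map_snd_pair_pmf del: map_pmf_comp)
    also have "measure_pmf.prob ?PC (?BC m) \<le> 1 / 2 ^ s"
      by (rule prob_overload_le) (use FC k that ld in auto)
    finally show ?thesis .
  qed
  let ?B = "\<lambda>m. {(h, g, r). h \<in> ?BF m} \<union> {(h, g, r). g \<in> ?BC m}"
  have set: "set_pmf ?M \<subseteq> {(h, g, r). (\<forall>i\<in>facilities I. h i < k) \<and> (\<forall>j\<in>clients I. g j < k)}"
    using FC kpos
    by (auto simp: random_choices_def set_Pi_pmf PiE_dflt_def set_pmf_of_set)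
  \<comment> \<open>That all hosts are below \<open>k\<close> is known only on the support.\<close>
  have "measure_pmf.prob ?M (- E) = measure_pmf.prob ?M (- E \<inter> set_pmf ?M)"
    by (simp add: measure_Int_set_pmf)
  also have "\<dots> \<le> measure_pmf.prob ?M (\<Union>m\<in>{..<k}. ?B m)"
  proof (rule measure_pmf.finite_measure_mono)
    show "- E \<inter> set_pmf ?M \<subseteq> (\<Union>m\<in>{..<k}. ?B m)"
    proof
      fix x assume x: "x \<in> - E \<inter> set_pmf ?M"
      obtain h g r where hgr: "x = (h, g, r)" by (cases x)
      have "(h, g, r) \<in> set_pmf ?M" "(h, g, r) \<notin> E" using x hgr by auto
      then obtain m where "m < k" "load e n k < card {i \<in> facilities I. h i = m} \<or>
          load e n k < card {j \<in> clients I. g j = m}"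
        using E[of h g r] set by (fastforce simp: not_le[symmetric])
      then show "x \<in> (\<Union>m\<in>{..<k}. ?B m)" by (intro UN_I[of m]) (auto simp: hgr)
    qed
  qed simp
  also have "\<dots> \<le> (\<Sum>m\<in>{..<k}. measure_pmf.prob ?M (?B m))"
    by (rule measure_pmf.finite_measure_subadditive_finite) auto
  also have "\<dots> \<le> (\<Sum>m\<in>{..<k}. 2 / 2 ^ s)"
  proof (rule sum_mono)
    fix m assume "m \<in> {..<k}"
    then have m: "m < k" by simp
    have "measure_pmf.prob ?M (?B m) \<le>
        measure_pmf.prob ?M {(h, g, r). h \<in> ?BF m} + measure_pmf.prob ?M {(h, g, r). g \<in> ?BC m}"
      by (rule measure_Un_le) auto
    then show "measure_pmf.prob ?M (?B m) \<le> 2 / 2 ^ s" using BF[OF m] BC[OF m] by simp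
  qed
  also have "\<dots> = 2 * real k / 2 ^ s" by simp
  also have "\<dots> \<le> 1 / real n ^ e"
  proof -
    have nl: "real n \<le> 2 ^ lg n" using le_lg by simp
    have "2 * real k \<le> real n * real n" using n k by (intro mult_mono) auto
    then have "2 * real k * real n ^ e \<le> real n * real n * real n ^ e"
      by (rule mult_right_mono) simp
    also have "\<dots> = real n ^ (e + 2)" by simp
    also have "\<dots> \<le> (2 ^ lg n) ^ (e + 2)" using nl by (intro power_mono) auto
    also have "\<dots> = 2 ^ s" unfolding s_def by (simp only: power_mult[symmetric] mult.commute)
    finally show ?thesis using n by (simp add: field_simps)
  qed
  finally have "measure_pmf.prob ?M (- E) \<le> 1 / real n ^ e" .
  moreover have "measure_pmf.prob ?M (- E) = 1 - measure_pmf.prob ?M E"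
    using measure_pmf.prob_compl[of E ?M] by (simp add: Compl_eq_Diff_UNIV)
  ultimately show ?thesis by linarith
qed

subsection \<open>Costs\<close>

lemma approx_solutionI:
  assumes "s \<in> S" "0 < \<alpha>" "\<And>t. t \<in> S \<Longrightarrow> cost s \<le> ereal \<alpha> * cost t"
  shows "approx_solution \<alpha> S cost s"
proof -
  have "cost s / ereal \<alpha> \<le> (INF t\<in>S. cost t)"
    by (rule INF_greatest) (use assms in \<open>simp add: ereal_divide_le_pos\<close>)
  then show ?thesis using assms by (simp add: approx_solution_def ereal_divide_le_pos)
qed

lemma sum_dist_to_empty:
  assumes "finite D" "D \<noteq> {}"
  shows "(\<Sum>j\<in>D. dist_to I j {}) = \<infinity>"
proof -
  have "dist_to I j {} = \<infinity>" for j by (simp add: dist_to_def top_ereal_def)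
  then show ?thesis using assms by (auto simp: sum_Pinfty)
qed

lemma dist_to_attained:
  assumes "finite S" "S \<noteq> {}"
  shows "\<exists>i\<in>S. dist_to I j S = ereal (metric I i j)"
proof -
  have "Inf ((\<lambda>i. ereal (metric I i j)) ` S) = Min ((\<lambda>i. ereal (metric I i j)) ` S)"
    using assms by (intro Min_Inf[symmetric]) auto
  moreover have "Min ((\<lambda>i. ereal (metric I i j)) ` S) \<in> (\<lambda>i. ereal (metric I i j)) ` S"
    using assms by (intro Min_in) auto
  ultimately show ?thesis by (auto simp: dist_to_def)
qed

lemma assignment_exists:
  assumes "finite S" "S \<noteq> {}"
  shows "\<exists>\<sigma>. (\<forall>j. \<sigma> j \<in> S) \<and> (\<forall>D. (\<Sum>j\<in>D. dist_to I j S) = ereal (\<Sum>j\<in>D. metric I (\<sigma> j) j))"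
proof -
  have "\<forall>j. \<exists>i. i \<in> S \<and> dist_to I j S = ereal (metric I i j)" using dist_to_attained[OF assms] by blast
  then obtain \<sigma> where "\<forall>j. \<sigma> j \<in> S \<and> dist_to I j S = ereal (metric I (\<sigma> j) j)" by metis
  then show ?thesis by (intro exI[of _ \<sigma>]) simp
qed

lemma sum_dist_to_le:
  assumes "\<forall>j\<in>D. \<exists>i\<in>S. metric I i j \<le> u j"
  shows "(\<Sum>j\<in>D. dist_to I j S) \<le> ereal (sum u D)"
proof -
  have "(\<Sum>j\<in>D. dist_to I j S) \<le> (\<Sum>j\<in>D. ereal (u j))"
  proof (rule sum_mono)
    fix j assume "j \<in> D"
    then obtain i where "i \<in> S" "metric I i j \<le> u j" using assms by blast
    then show "dist_to I j S \<le> ereal (u j)" unfolding dist_to_def by (intro INF_lower2[of i]) auto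
  qed
  then show ?thesis by simp
qed

text \<open>An assignment into \<open>F'\<close> exists only for nonempty \<open>F'\<close>. With
  \<open>F'\<close> empty the cost is infinite unless \<open>D\<close> is empty too, and then
  \<open>opt\<close> bounds the cost of the output by 0.\<close>

lemma robust_approx:
  assumes fin: "finite (facilities I)" "finite (clients I)"
    and s: "Op \<subseteq> facilities I" "C' \<subseteq> clients I" "p \<le> card C'"
    and u: "\<forall>j\<in>C'. \<exists>i\<in>Op. metric I i j \<le> u j"
    and opt: "\<And>F' D \<sigma>. \<lbrakk>F' \<subseteq> facilities I; D \<subseteq> clients I; p \<le> card D; \<forall>j\<in>D. \<sigma> j \<in> F'\<rbrakk> \<Longrightarrow>
      sum (open_cost I) Op + sum u C' \<le> \<alpha> * (sum (open_cost I) F' + (\<Sum>j\<in>D. metric I (\<sigma> j) j))"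
    and "0 < \<alpha>"
  shows "approx_solution \<alpha> (robust_feasible I p) (robust_cost I) (Op, C')"
proof (rule approx_solutionI)
  show "(Op, C') \<in> robust_feasible I p" using s by (simp add: robust_feasible_def)
  fix x assume "x \<in> robust_feasible I p"
  then obtain F' D where x: "x = (F', D)" "F' \<subseteq> facilities I" "D \<subseteq> clients I" "p \<le> card D"
    by (auto simp: robust_feasible_def)
  have finFD: "finite F'" "finite D" using x fin finite_subset by blast+
  have le: "robust_cost I (Op, C') \<le> ereal (sum (open_cost I) Op + sum u C')"
    using sum_dist_to_le[OF u] by (simp add: robust_cost_def add_left_mono flip: plus_ereal.simps(1))
  show "robust_cost I (Op, C') \<le> ereal \<alpha> * robust_cost I x"
  proof (cases "F' = {}")
    case True
    show ?thesis
    proof (cases "D = {}")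
      case True
      then have "sum (open_cost I) Op + sum u C' \<le> 0" using opt[of F' D id] x \<open>F' = {}\<close> by simp
      then have "robust_cost I (Op, C') \<le> 0" using order_trans[OF le] by (simp add: zero_ereal_def)
      then show ?thesis using True \<open>F' = {}\<close> x by (simp add: robust_cost_def)
    next
      case False
      then have "robust_cost I x = \<infinity>"
        using sum_dist_to_empty[of D I] finFD by (simp add: robust_cost_def x True)
      then show ?thesis using \<open>0 < \<alpha>\<close> by simp
    qed
  next
    case False
    then obtain \<sigma> where \<sigma>: "\<forall>j. \<sigma> j \<in> F'"
        "\<forall>D. (\<Sum>j\<in>D. dist_to I j F') = ereal (\<Sum>j\<in>D. metric I (\<sigma> j) j)"
      using assignment_exists[OF finFD(1), of I] by blast
    then have "robust_cost I x = ereal (sum (open_cost I) F' + (\<Sum>j\<in>D. metric I (\<sigma> j) j))"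
      by (simp add: robust_cost_def x)
    moreover have "sum (open_cost I) Op + sum u C' \<le>
        \<alpha> * (sum (open_cost I) F' + (\<Sum>j\<in>D. metric I (\<sigma> j) j))"
      using opt x \<sigma> by blast
    ultimately show ?thesis using order_trans[OF le] by simp
  qed
qed fact

lemma penalty_approx:
  assumes fin: "finite (facilities I)" "finite (clients I)"
    and s: "S \<subseteq> facilities I" "C' \<subseteq> clients I" "\<And>j. j \<in> C' \<Longrightarrow> S \<noteq> {}"
    and opt: "\<And>F' D \<sigma>. \<lbrakk>F' \<subseteq> facilities I; D \<subseteq> clients I; \<And>j. j \<in> D \<Longrightarrow> \<sigma> j \<in> F'\<rbrakk> \<Longrightarrow>
      sum (open_cost I) S + (\<Sum>j\<in>C'. Min ((\<lambda>i. metric I i j) ` S)) + sum pen (clients I - C') \<le>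
      \<alpha> * (sum (open_cost I) F' + (\<Sum>j\<in>D. metric I (\<sigma> j) j) + sum pen (clients I - D))"
    and "0 < \<alpha>"
  shows "approx_solution \<alpha> (penalty_feasible I) (penalty_cost I pen) (S, C')"
proof (rule approx_solutionI)
  show "(S, C') \<in> penalty_feasible I" using s by (simp add: penalty_feasible_def)
  fix x assume "x \<in> penalty_feasible I"
  then obtain F' D where x: "x = (F', D)" "F' \<subseteq> facilities I" "D \<subseteq> clients I"
    by (auto simp: penalty_feasible_def)
  have finFD: "finite F'" "finite D" using x fin finite_subset by blast+
  let ?u = "\<lambda>j. Min ((\<lambda>i. metric I i j) ` S)"
  have "\<forall>j\<in>C'. \<exists>i\<in>S. metric I i j \<le> ?u j"
  proof
    fix j assume "j \<in> C'"
    then have "?u j \<in> (\<lambda>i. metric I i j) ` S"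
      using s(3)[of j] finite_subset[OF s(1) fin(1)] by (intro Min_in) auto
    then show "\<exists>i\<in>S. metric I i j \<le> ?u j" by force
  qed
  then have "(\<Sum>j\<in>C'. dist_to I j S) \<le> ereal (sum ?u C')" by (rule sum_dist_to_le)
  then have le: "penalty_cost I pen (S, C') \<le>
      ereal (sum (open_cost I) S + sum ?u C' + sum pen (clients I - C'))"
    by (simp add: penalty_cost_def add_mono flip: plus_ereal.simps(1))
  show "penalty_cost I pen (S, C') \<le> ereal \<alpha> * penalty_cost I pen x"
  proof (cases "F' = {}")
    case True
    show ?thesis
    proof (cases "D = {}")
      case True
      then show ?thesis using opt[of F' D id] le x \<open>F' = {}\<close> order_trans[OF le]
        by (simp add: penalty_cost_def)
    next
      case False
      then have "penalty_cost I pen x = \<infinity>"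
        using sum_dist_to_empty[of D I] finFD by (simp add: penalty_cost_def x True)
      then show ?thesis using \<open>0 < \<alpha>\<close> by simp
    qed
  next
    case False
    then obtain \<sigma> where \<sigma>: "\<forall>j. \<sigma> j \<in> F'"
        "\<forall>D. (\<Sum>j\<in>D. dist_to I j F') = ereal (\<Sum>j\<in>D. metric I (\<sigma> j) j)"
      using assignment_exists[OF finFD(1), of I] by blast
    then have "penalty_cost I pen x =
        ereal (sum (open_cost I) F' + (\<Sum>j\<in>D. metric I (\<sigma> j) j) + sum pen (clients I - D))"
      by (simp add: penalty_cost_def x)
    moreover have "sum (open_cost I) S + sum ?u C' + sum pen (clients I - C') \<le>
        \<alpha> * (sum (open_cost I) F' + (\<Sum>j\<in>D. metric I (\<sigma> j) j) + sum pen (clients I - D))"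
      using opt x \<sigma> by blast
    ultimately show ?thesis using order_trans[OF le] by simp
  qed
qed fact

section \<open>Assembly of the two algorithms\<close>

definition facility_nodes :: "facility_view \<Rightarrow> node set" where
  "facility_nodes fv = {Fac i a \<delta> | i a \<delta>. fv i = Some (a, \<delta>)}"

definition client_nodes :: "client_view \<Rightarrow> (nat \<Rightarrow> real) \<Rightarrow> node set" where
  "client_nodes cv pen = {Cli j \<delta> (pen j) | j \<delta>. cv j = Some \<delta>}"

definition robust_sim :: "nat \<Rightarrow> nat \<Rightarrow> (robust_input, node, robust_table) simulation" where
  "robust_sim c e = \<lparr>
     nodes = (\<lambda>(p, fv, cv). facility_nodes fv \<union> client_nodes cv (\<lambda>_. 0)),
     protocol = (\<lambda>n. params.robust_prot (unit_length c n) (top_level c n) (lg n) (hits n) (seed_bits c n)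
       (sample c n)),
     messages = (\<lambda>n. Msgs (entry_bits c n)),
     encode = (\<lambda>n. encoding (entry_bits c n)),
     broadcasts = (\<lambda>n. params.robust_rounds (top_level c n) (lg n) (seed_bits c n)),
     block = block_length c e,
     answer = (\<lambda>n x a. params.robust_choice (unit_length c n) (top_level c n) (2 ^ entry_bits c n) (fst x) a)\<rparr>"

definition penalty_sim :: "nat \<Rightarrow> nat \<Rightarrow> (penalty_input, node, solution) simulation" where
  "penalty_sim c e = \<lparr>
     nodes = (\<lambda>(fv, cv, pv). facility_nodes fv \<union> client_nodes cv (\<lambda>j. the (pv j))),
     protocol = (\<lambda>n. params.penalty_prot (unit_length c n) (top_level c n) (lg n) (hits n) (seed_bits c n)
       (sample c n)),
     messages = (\<lambda>n. Msgs (entry_bits c n)),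
     encode = (\<lambda>n. encoding (entry_bits c n)),
     broadcasts = (\<lambda>n. params.penalty_rounds (top_level c n) (lg n) (seed_bits c n)),
     block = block_length c e,
     answer = (\<lambda>n x a. a)\<rparr>"

context fl_nodes
begin

lemma hosted_nodes:
  fixes I :: fl_instance and h g :: "nat \<Rightarrow> nat" and pen' :: "nat \<Rightarrow> nat \<Rightarrow> real"
  assumes I: "facilities I = F" "clients I = C" "metric I = d" "open_cost I = f"
    and pen': "\<And>m j. j \<in> C \<Longrightarrow> g j = m \<Longrightarrow> pen' m j = pen j"
  defines "N \<equiv> \<lambda>m. facility_nodes (facility_view I h m) \<union> client_nodes (client_view I g m) (pen' m)"
  shows "finite (N m)"
    and "card (N m) \<le> card {i \<in> F. h i = m} + card {j \<in> C. g j = m}"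
    and "(\<And>i. i \<in> F \<Longrightarrow> h i < k) \<Longrightarrow> (\<And>j. j \<in> C \<Longrightarrow> g j < k) \<Longrightarrow> (\<Union>m<k. N m) = V"
proof -
  have N: "N m = fnode ` {i \<in> F. h i = m} \<union> cnode ` {j \<in> C. g j = m}" for m
    using pen' by (auto simp: N_def facility_nodes_def client_nodes_def facility_view_def client_view_def
        restrict_map_def fnode_def cnode_def I image_iff split: if_splits)
  have fin': "finite {i \<in> F. h i = m}" "finite {j \<in> C. g j = m}" using fin by auto
  show "finite (N m)" unfolding N using fin' by simp
  show "card (N m) \<le> card {i \<in> F. h i = m} + card {j \<in> C. g j = m}"
    unfolding N using card_image_le[OF fin'(1), of fnode] card_image_le[OF fin'(2), of cnode]
      card_Un_le[of "fnode ` {i \<in> F. h i = m}" "cnode ` {j \<in> C. g j = m}"] by linarith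
  show "(\<Union>m<k. N m) = V" if "\<And>i. i \<in> F \<Longrightarrow> h i < k" "\<And>j. j \<in> C \<Longrightarrow> g j < k"
    unfolding N V_def using that by blast
qed

end

lemma Nil_notin_encoding: "[] \<notin> encoding \<beta> ` Msgs \<beta>"
  using encoding(2) by fastforce

text \<open>All machines compute the whole solution, so the decisions of the individual hosts
  recombine to it.\<close>

lemma output_solution_const:
  assumes "\<And>m. m < k \<Longrightarrow> machine_result A n k x r m = (S, C')"
    and "\<And>i. i \<in> facilities I \<Longrightarrow> h i < k" "\<And>j. j \<in> clients I \<Longrightarrow> g j < k"
    and "S \<subseteq> facilities I" "C' \<subseteq> clients I"
  shows "output_solution A n k I x h g r = (S, C')"
  unfolding output_solution_def using assms by auto

lemma short_number_0: "2 \<le> n \<Longrightarrow> short_number c n 0"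
  unfolding short_number_def by (intro exI[of _ "0::nat"] exI[of _ "1::nat"]) simp

lemma robust_success:
  assumes n: "2 \<le> n" and k: "1 \<le> k" "k \<le> n" and I: "valid_instance c n I" and p: "p \<le> card (clients I)"
  shows "1 - 1 / real n ^ e \<le> robust_success_prob (sim_algorithm (robust_sim c e)) 76 n k I p"
  unfolding robust_success_prob_def
proof (rule prob_random_choices_ge[OF n k])
  show fin: "finite (facilities I)" "finite (clients I)"
    and "card (facilities I) = n" "card (clients I) = n"
    using I by (auto simp: valid_instance_def)
  fix h g r
  assume hg: "\<And>i. i \<in> facilities I \<Longrightarrow> h i < k" "\<And>j. j \<in> clients I \<Longrightarrow> g j < k"
    and loads: "\<And>m. m < k \<Longrightarrow> card {i \<in> facilities I. h i = m} \<le> load e n k"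
      "\<And>m. m < k \<Longrightarrow> card {j \<in> clients I. g j = m} \<le> load e n k"
  interpret fl_nodes "unit_length c n" "top_level c n" "lg n" "hits n" "seed_bits c n" "sample c n"
    "facilities I" "clients I" "metric I" "open_cost I" "\<lambda>_. 0" n "entry_bits c n" "per_node c n"
    by (rule fl_nodes_instance[OF I n]) (rule short_number_0[OF n])
  let ?\<Sigma> = "robust_sim c e" and ?x = "robust_input I p h g"
  have nodes: "nodes ?\<Sigma> (?x m) =
      facility_nodes (facility_view I h m) \<union> client_nodes (client_view I g m) (\<lambda>_. 0)" for m
    by (simp add: robust_sim_def robust_input_def)
  note hosted = hosted_nodes[where I = I and g = g and h = h and pen' = "\<lambda>_ _. 0", OF refl refl refl refl refl]
  have union: "(\<Union>m<k. nodes ?\<Sigma> (?x m)) = V" unfolding nodes by (rule hosted(3)[OF hg])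
  have "\<exists>a. robust_ok a \<and> (\<forall>m<k. machine_result (sim_algorithm ?\<Sigma>) n k ?x r m = answer ?\<Sigma> n (?x m) a)"
  proof (rule sim_result[where \<kappa> = "per_node c n"])
    show "hoare (\<Union>m<k. nodes ?\<Sigma> (?x m)) (per_node c n) (messages ?\<Sigma> n) (protocol ?\<Sigma> n) (broadcasts ?\<Sigma> n) robust_ok"
      unfolding union using robust_holds by (simp add: robust_sim_def)
    show "inj_on (encode ?\<Sigma> n) (messages ?\<Sigma> n)" "[] \<notin> encode ?\<Sigma> n ` messages ?\<Sigma> n"
      using encoding(1) Nil_notin_encoding by (simp_all add: robust_sim_def)
    show "finite (nodes ?\<Sigma> (?x m))" for m unfolding nodes by (rule hosted(1))
    show "card (nodes ?\<Sigma> (?x m)) * per_node c n \<le> block ?\<Sigma> n k" if "m < k" for m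
    proof -
      have "card (nodes ?\<Sigma> (?x m)) \<le> 2 * load e n k"
        unfolding nodes using hosted(2)[of m] loads[OF that] by force
      then have "card (nodes ?\<Sigma> (?x m)) * per_node c n \<le> 2 * load e n k * per_node c n"
        by (rule mult_right_mono) simp
      moreover have "block ?\<Sigma> n k = 2 * load e n k * per_node c n + 1"
        by (simp add: robust_sim_def block_length_def)
      ultimately show ?thesis by (simp only: trans_le_add1)
    qed
    show "0 < block ?\<Sigma> n k" by (simp add: robust_sim_def block_length_def)
  qed
  then obtain a where a: "robust_ok a"
    "\<And>m. m < k \<Longrightarrow> machine_result (sim_algorithm ?\<Sigma>) n k ?x r m = robust_choice (2 ^ entry_bits c n) p a"
    by (auto simp: robust_sim_def robust_input_def)
  obtain Op C' where OC: "robust_choice (2 ^ entry_bits c n) p a = (Op, C')" by force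
  note choice = robust_choice[OF a(1) p OC]
  obtain u where u: "\<forall>j\<in>C'. \<exists>i\<in>Op. metric I i j \<le> u j"
    and opt: "\<And>F' D \<sigma>. \<lbrakk>F' \<subseteq> facilities I; D \<subseteq> clients I; p \<le> card D; \<forall>j\<in>D. \<sigma> j \<in> F'\<rbrakk> \<Longrightarrow>
      sum (open_cost I) Op + sum u C' \<le> 76 * (sum (open_cost I) F' + (\<Sum>j\<in>D. metric I (\<sigma> j) j))"
    using choice(4) by blast
  have "output_solution (sim_algorithm ?\<Sigma>) n k I ?x h g r = (Op, C')"
    by (rule output_solution_const) (use a(2) OC hg choice in auto)
  moreover have "approx_solution 76 (robust_feasible I p) (robust_cost I) (Op, C')"
    by (rule robust_approx[OF fin choice(1,2) _ u]) (use choice(3) opt in auto)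
  ultimately show "(h, g, r) \<in> {(h, g, r). approx_solution 76 (robust_feasible I p) (robust_cost I)
      (output_solution (sim_algorithm ?\<Sigma>) n k I (robust_input I p h g) h g r)}"
    by simp
qed

lemma penalty_success:
  assumes n: "2 \<le> n" and k: "1 \<le> k" "k \<le> n" and I: "valid_instance c n I" and pen: "valid_penalties c n I pen"
  shows "1 - 1 / real n ^ e \<le> penalty_success_prob (sim_algorithm (penalty_sim c e)) 36 n k I pen"
  unfolding penalty_success_prob_def
proof (rule prob_random_choices_ge[OF n k])
  show fin: "finite (facilities I)" "finite (clients I)"
    and "card (facilities I) = n" "card (clients I) = n"
    using I by (auto simp: valid_instance_def)
  fix h g r
  assume hg: "\<And>i. i \<in> facilities I \<Longrightarrow> h i < k" "\<And>j. j \<in> clients I \<Longrightarrow> g j < k"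
    and loads: "\<And>m. m < k \<Longrightarrow> card {i \<in> facilities I. h i = m} \<le> load e n k"
      "\<And>m. m < k \<Longrightarrow> card {j \<in> clients I. g j = m} \<le> load e n k"
  interpret fl_nodes "unit_length c n" "top_level c n" "lg n" "hits n" "seed_bits c n" "sample c n"
    "facilities I" "clients I" "metric I" "open_cost I" pen n "entry_bits c n" "per_node c n"
    by (rule fl_nodes_instance[OF I n]) (use pen in \<open>auto simp: valid_penalties_def\<close>)
  let ?\<Sigma> = "penalty_sim c e" and ?x = "penalty_input I pen h g"
  let ?p = "\<lambda>m j. the (((\<lambda>j. Some (pen j)) |` {j \<in> clients I. g j = m}) j)"
  have nodes: "nodes ?\<Sigma> (?x m) =
      facility_nodes (facility_view I h m) \<union> client_nodes (client_view I g m) (?p m)" for m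
    by (simp add: penalty_sim_def penalty_input_def)
  have p: "?p m j = pen j" if "j \<in> clients I" "g j = m" for m j using that by simp
  note hosted = hosted_nodes[where I = I and g = g and h = h and pen' = ?p, OF refl refl refl refl p]
  have union: "(\<Union>m<k. nodes ?\<Sigma> (?x m)) = V" unfolding nodes by (rule hosted(3)) (use hg in auto)
  have "\<exists>a. penalty_ok a \<and> (\<forall>m<k. machine_result (sim_algorithm ?\<Sigma>) n k ?x r m = answer ?\<Sigma> n (?x m) a)"
  proof (rule sim_result[where \<kappa> = "per_node c n"])
    show "hoare (\<Union>m<k. nodes ?\<Sigma> (?x m)) (per_node c n) (messages ?\<Sigma> n) (protocol ?\<Sigma> n) (broadcasts ?\<Sigma> n) penalty_ok"
      unfolding union using penalty_holds by (simp add: penalty_sim_def)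
    show "inj_on (encode ?\<Sigma> n) (messages ?\<Sigma> n)" "[] \<notin> encode ?\<Sigma> n ` messages ?\<Sigma> n"
      using encoding(1) Nil_notin_encoding by (simp_all add: penalty_sim_def)
    show "finite (nodes ?\<Sigma> (?x m))" for m unfolding nodes by (rule hosted(1)) auto
    show "card (nodes ?\<Sigma> (?x m)) * per_node c n \<le> block ?\<Sigma> n k" if "m < k" for m
    proof -
      have "card (nodes ?\<Sigma> (?x m)) \<le> 2 * load e n k"
        unfolding nodes using hosted(2)[of m] loads[OF that] by force
      then have "card (nodes ?\<Sigma> (?x m)) * per_node c n \<le> 2 * load e n k * per_node c n"
        by (rule mult_right_mono) simp
      moreover have "block ?\<Sigma> n k = 2 * load e n k * per_node c n + 1"
        by (simp add: penalty_sim_def block_length_def)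
      ultimately show ?thesis by (simp only: trans_le_add1)
    qed
    show "0 < block ?\<Sigma> n k" by (simp add: penalty_sim_def block_length_def)
  qed
  then obtain S C' where a: "penalty_ok (S, C')"
    "\<And>m. m < k \<Longrightarrow> machine_result (sim_algorithm ?\<Sigma>) n k ?x r m = (S, C')"
    by (auto simp: penalty_sim_def)
  note opt = penalty_bound_opt[OF a(1)]
  have S: "S \<subseteq> facilities I" "C' \<subseteq> clients I" "\<And>j. j \<in> C' \<Longrightarrow> S \<noteq> {}"
    using opt(1-3)[of "{}" "{}"] by auto
  have "output_solution (sim_algorithm ?\<Sigma>) n k I ?x h g r = (S, C')"
    by (rule output_solution_const) (use a(2) hg S in auto)
  moreover have "approx_solution 36 (penalty_feasible I) (penalty_cost I pen) (S, C')"
    by (rule penalty_approx[OF fin S opt(4)]) auto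
  ultimately show "(h, g, r) \<in> {(h, g, r). approx_solution 36 (penalty_feasible I) (penalty_cost I pen)
      (output_solution (sim_algorithm ?\<Sigma>) n k I (penalty_input I pen h g) h g r)}"
    by simp
qed

subsection \<open>Running time\<close>

text \<open>The factor \<open>B\<close> lets \<open>z = B * lg n\<close> dominate every parameter
  linear in \<open>lg n\<close>, additive constants included. A block has order
  \<open>z ^ 3 * (n / k)\<close>, from a load of order \<open>z * (n / k)\<close> and
  \<open>z ^ 2\<close> messages per node, and there are order \<open>z ^ 4\<close> broadcasts; the
  constants 5 and 4 give 20. Passing from \<open>lg n\<close> to the logarithm costs the 2 inside
  the power.\<close>

lemma complexity:
  fixes c e :: nat
  defines "B \<equiv> 2 * c + e + 50"
  defines "a \<equiv> 20 * (2 * real B) ^ 7"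
  assumes n: "2 \<le> n" and k: "1 \<le> k" "k \<le> n"
  shows "5 * real (entry_bits c n) + 3 \<le> a * log 2 n ^ 7"
    and "R \<le> 4 * (B * lg n) ^ 4 \<Longrightarrow> real (R * block_length c e n k) \<le> a * log 2 n ^ 7 * (real n / real k)"
proof -
  define z where "z = B * lg n"
  have l: "1 \<le> lg n" by (rule lg_pos[OF n])
  have z50: "50 \<le> z" using mult_le_mono[of 50 B 1 "lg n"] l by (simp add: z_def B_def)
  have "real z \<le> 2 * real B * log 2 n"
    using lg_le[OF n] mult_left_mono[of "real (lg n)" "2 * log 2 (real n)" "real B"] by (simp add: z_def)
  then have "real z ^ 7 \<le> (2 * real B * log 2 n) ^ 7" by (intro power_mono) auto
  then have za: "20 * real z ^ 7 \<le> a * log 2 n ^ 7" by (simp add: a_def power_mult_distrib)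
  have z_ge: "x * lg n + y \<le> z" if "x + y \<le> B" for x y
  proof -
    have "x * lg n + y * 1 \<le> x * lg n + y * lg n" using l by (intro add_left_mono mult_left_mono) auto
    also have "\<dots> \<le> z" using mult_le_mono1[OF that, of "lg n"] by (simp add: z_def add_mult_distrib)
    finally show ?thesis by simp
  qed
  have e: "entry_bits c n \<le> z" using z_ge[of "2 * c + 8" 8] by (simp add: entry_bits_def B_def)
  have z7: "real z \<le> real z ^ 7" using z50 by (intro self_le_power) auto
  have "5 * real (entry_bits c n) + 3 \<le> 20 * real z" using e z50 by linarith
  then show "5 * real (entry_bits c n) + 3 \<le> a * log 2 n ^ 7" using za z7 by linarith
  assume R: "R \<le> 4 * (B * lg n) ^ 4"
  have nk: "1 \<le> real n / real k" using k by (simp add: le_divide_eq)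
  have T: "top_level c n + 2 \<le> z"
    using z_ge[of "2 * c + 1" 5] by (simp add: top_level_def unit_bits_def B_def algebra_simps)
  have "(top_level c n + 2) * (top_level c n + 1) \<le> z * z" using T by (intro mult_le_mono) auto
  moreover have "hits n \<le> z" using z_ge[of 5 20] by (simp add: hits_def B_def)
  moreover have "z \<le> z * z" by (rule le_square)
  ultimately have pn: "per_node c n \<le> 2 * (z * z)" unfolding per_node_def by linarith
  have "real (n div k * k) \<le> real n" by (simp only: of_nat_le_iff div_times_less_eq_dividend)
  then have "real (n div k) \<le> real n / real k" using k by (simp add: le_divide_eq)
  then have "real (load e n k) \<le> 2 * (real n / real k) + 2 + real ((e + 2) * lg n)"
    by (simp add: load_def)
  also have "\<dots> \<le> (real n / real k) * (4 + real ((e + 2) * lg n))"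
  proof -
    \<comment> \<open>Since \<open>n / k\<close> is at least 1, the additive terms of the load may
      be multiplied by it.\<close>
    have "2 * t + 2 + y \<le> t * (4 + y)" if "1 \<le> t" "0 \<le> y" for t y :: real
      using mult_right_mono[of 1 t "2 + y"] that by (simp add: distrib_left)
    from this[OF nk of_nat_0_le_iff] show ?thesis .
  qed
  also have "\<dots> \<le> (real n / real k) * real z"
  proof (rule mult_left_mono)
    have "(e + 2) * lg n + 4 \<le> z" by (rule z_ge) (simp add: B_def)
    then show "4 + real ((e + 2) * lg n) \<le> real z" by linarith
  qed simp
  finally have ld: "real (load e n k) \<le> (real n / real k) * real z" .
  have "real (block_length c e n k) = 2 * real (load e n k) * real (per_node c n) + 1"
    by (simp add: block_length_def)
  also have "\<dots> \<le> 2 * ((real n / real k) * real z) * (2 * (real z * real z)) + 1"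
  proof -
    have "real (per_node c n) \<le> 2 * (real z * real z)"
      using pn by (metis of_nat_le_iff of_nat_mult of_nat_numeral)
    then have "real (load e n k) * real (per_node c n) \<le> ((real n / real k) * real z) * (2 * (real z * real z))"
      using ld by (intro mult_mono) auto
    then show ?thesis by simp
  qed
  also have "\<dots> \<le> 5 * real z ^ 3 * (real n / real k)"
  proof -
    have "1 * 1 \<le> real z ^ 3 * (real n / real k)"
      using nk z50 by (intro mult_mono one_le_power) auto
    moreover have "2 * ((real n / real k) * real z) * (2 * (real z * real z)) = 4 * (real z ^ 3 * (real n / real k))"
      by (simp add: power3_eq_cube)
    ultimately show ?thesis by linarith
  qed
  finally have bl: "real (block_length c e n k) \<le> 5 * real z ^ 3 * (real n / real k)" .
  have "real R \<le> 4 * real z ^ 4"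
    using R unfolding z_def[symmetric] by (metis of_nat_le_iff of_nat_mult of_nat_numeral of_nat_power)
  then have "real R * real (block_length c e n k) \<le> (4 * real z ^ 4) * (5 * real z ^ 3 * (real n / real k))"
    using bl by (intro mult_mono) auto
  also have "\<dots> = 20 * real z ^ 7 * (real n / real k)" by (simp add: eval_nat_numeral)
  also have "\<dots> \<le> a * log 2 n ^ 7 * (real n / real k)" using za by (intro mult_right_mono) auto
  finally show "real (R * block_length c e n k) \<le> a * log 2 n ^ 7 * (real n / real k)" by simp
qed

text \<open>The fourth power counts guesses, levels, phases and search steps, each at most
  \<open>z\<close>; the penalty problem has only the last three.\<close>

lemma broadcasts_le:
  assumes n: "2 \<le> n"
  shows "params.robust_rounds (top_level c n) (lg n) (seed_bits c n) \<le> 4 * ((2 * c + e + 50) * lg n) ^ 4"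
    and "params.penalty_rounds (top_level c n) (lg n) (seed_bits c n) \<le> 4 * ((2 * c + e + 50) * lg n) ^ 4"
proof -
  define z where "z = (2 * c + e + 50) * lg n"
  have l: "1 \<le> lg n" by (rule lg_pos[OF n])
  have z_ge: "x * lg n + y \<le> z" if "x + y \<le> 2 * c + e + 50" for x y
  proof -
    have "x * lg n + y * 1 \<le> x * lg n + y * lg n" using l by (intro add_left_mono mult_left_mono) auto
    also have "\<dots> \<le> z" using mult_le_mono1[OF that, of "lg n"] by (simp add: z_def add_mult_distrib)
    finally show ?thesis by simp
  qed
  have z50: "50 \<le> z" using z_ge[of 0 50] by simp
  have T: "top_level c n + 1 \<le> z"
    using z_ge[of "2 * c + 1" 4] by (simp add: top_level_def unit_bits_def algebra_simps)
  have q: "seed_bits c n + 2 \<le> z" using z_ge[of "c + 4" 2] by (simp add: seed_bits_def)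
  have l': "lg n + 1 \<le> z" using z_ge[of 1 1] by simp
  have zz: "50 * z \<le> z * z" using z50 by (rule mult_le_mono1)
  have "(lg n + 1) * (seed_bits c n + 2) \<le> z * z" using l' q by (rule mult_le_mono)
  then have "(lg n + 1) * (seed_bits c n + 2) + 2 \<le> 2 * (z * z)" using zz z50 by linarith
  then have "params.net_rounds (top_level c n) (lg n) (seed_bits c n) \<le> z * (2 * (z * z))"
    unfolding params.net_rounds_def using T by (rule mult_le_mono[rotated])
  then have net: "params.net_rounds (top_level c n) (lg n) (seed_bits c n) \<le> 2 * (z * (z * z))" by simp
  have z3: "50 * (z * z) \<le> z * (z * z)" using z50 by (rule mult_le_mono1)
  have z4: "50 * (z * (z * z)) \<le> z * (z * (z * z))" using z50 by (rule mult_le_mono1)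
  have p4: "z ^ 4 = z * (z * (z * z))" by (simp add: eval_nat_numeral)
  have "params.net_rounds (top_level c n) (lg n) (seed_bits c n) + 2 \<le> 3 * (z * (z * z))"
    using net zz z3 z50 by linarith
  then have "(top_level c n + 1) * (params.net_rounds (top_level c n) (lg n) (seed_bits c n) + 2) \<le>
      z * (3 * (z * (z * z)))"
    using T by (rule mult_le_mono[rotated])
  note total = this
  show "params.robust_rounds (top_level c n) (lg n) (seed_bits c n) \<le> 4 * ((2 * c + e + 50) * lg n) ^ 4"
  proof -
    have "x + 2 \<le> 4 * y" if "x \<le> 3 * y" "50 \<le> y" for x y :: nat using that by linarith
    moreover have "z * (3 * (z * (z * z))) = 3 * (z * (z * (z * z)))" by simp
    moreover have "50 \<le> z * (z * (z * z))" using zz z3 z4 z50 by linarith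
    ultimately show ?thesis
      using total unfolding params.robust_rounds_def z_def[symmetric] p4 by metis
  qed
  show "params.penalty_rounds (top_level c n) (lg n) (seed_bits c n) \<le> 4 * ((2 * c + e + 50) * lg n) ^ 4"
    unfolding params.penalty_rounds_def z_def[symmetric] p4 using net zz z3 z4 z50 by linarith
qed

lemma algorithm_complexity:
  assumes n: "2 \<le> n" and k: "k \<in> {1..n}"
    and sim: "messages \<Sigma> n = Msgs (entry_bits c n)" "encode \<Sigma> n = encoding (entry_bits c n)"
      "block \<Sigma> n k = block_length c e n k" "broadcasts \<Sigma> n \<le> 4 * ((2 * c + e + 50) * lg n) ^ 4"
  defines "a \<equiv> 20 * (2 * real (2 * c + e + 50)) ^ 7"
  shows "message_length_le (sim_algorithm \<Sigma>) n k (a * log 2 n ^ 7)"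
    and "real (rounds (sim_algorithm \<Sigma>) n k) \<le> a * log 2 n ^ 7 * (real n / real k)"
proof -
  have k': "1 \<le> k" "k \<le> n" using k by auto
  note cx = complexity[OF n k', where c = c and e = e, folded a_def]
  show "message_length_le (sim_algorithm \<Sigma>) n k (a * log 2 n ^ 7)"
  proof (rule message_length_sim)
    show "real (length (encode \<Sigma> n y)) \<le> a * log 2 n ^ 7" if "y \<in> messages \<Sigma> n" for y
      using cx(1) that encoding(2)[of y "entry_bits c n"] by (simp add: sim)
    show "0 \<le> a * log 2 n ^ 7" using cx(1) by linarith
  qed
  show "real (rounds (sim_algorithm \<Sigma>) n k) \<le> a * log 2 n ^ 7 * (real n / real k)"
    using cx(2)[OF sim(4)] by (simp add: sim_algorithm_def sim(3))
qed

theorem mainTheorem13: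
  shows
   "(\<exists>\<alpha>::real. \<alpha> \<ge> 1 \<and>
      (\<forall>c e::nat. \<exists>(A :: robust_input algorithm) (a::real) (b::nat).
        \<forall>n\<ge>2. \<forall>k\<in>{1..n}.
          message_length_le A n k (a * log 2 n ^ b) \<and>
          real (rounds A n k) \<le> a * log 2 n ^ b * (real n / real k) \<and>
          (\<forall>I p. valid_instance c n I \<and> p \<le> card (clients I) \<longrightarrow>
             robust_success_prob A \<alpha> n k I p \<ge> 1 - 1 / real n ^ e)))
    \<and>
    (\<exists>\<alpha>::real. \<alpha> \<ge> 1 \<and>
      (\<forall>c e::nat. \<exists>(A :: penalty_input algorithm) (a::real) (b::nat).
        \<forall>n\<ge>2. \<forall>k\<in>{1..n}.
          message_length_le A n k (a * log 2 n ^ b) \<and>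
          real (rounds A n k) \<le> a * log 2 n ^ b * (real n / real k) \<and>
          (\<forall>I pen. valid_instance c n I \<and> valid_penalties c n I pen \<longrightarrow>
             penalty_success_prob A \<alpha> n k I pen \<ge> 1 - 1 / real n ^ e)))"
proof (rule conjI; rule exI, intro conjI allI)
  fix c e :: nat
  let ?a = "20 * (2 * real (2 * c + e + 50)) ^ 7"
  show "\<exists>(A :: robust_input algorithm) (a::real) (b::nat). \<forall>n\<ge>2. \<forall>k\<in>{1..n}.
      message_length_le A n k (a * log 2 n ^ b) \<and>
      real (rounds A n k) \<le> a * log 2 n ^ b * (real n / real k) \<and>
      (\<forall>I p. valid_instance c n I \<and> p \<le> card (clients I) \<longrightarrow>
         robust_success_prob A 76 n k I p \<ge> 1 - 1 / real n ^ e)"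
  proof (intro exI[of _ "sim_algorithm (robust_sim c e)"] exI[of _ ?a] exI[of _ "7::nat"] allI impI ballI conjI)
    fix n k :: nat assume nk: "2 \<le> n" "k \<in> {1..n}"
    note cx = algorithm_complexity[OF nk, of "robust_sim c e" c e]
    show "message_length_le (sim_algorithm (robust_sim c e)) n k (?a * log 2 n ^ 7)"
      "real (rounds (sim_algorithm (robust_sim c e)) n k) \<le> ?a * log 2 n ^ 7 * (real n / real k)"
      by (rule cx; use broadcasts_le(1)[OF nk(1), of c e] in \<open>simp add: robust_sim_def\<close>)+
    show "robust_success_prob (sim_algorithm (robust_sim c e)) 76 n k I p \<ge> 1 - 1 / real n ^ e"
      if "valid_instance c n I \<and> p \<le> card (clients I)" for I p
      using robust_success nk that by simp
  qed
  show "\<exists>(A :: penalty_input algorithm) (a::real) (b::nat). \<forall>n\<ge>2. \<forall>k\<in>{1..n}.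
      message_length_le A n k (a * log 2 n ^ b) \<and>
      real (rounds A n k) \<le> a * log 2 n ^ b * (real n / real k) \<and>
      (\<forall>I pen. valid_instance c n I \<and> valid_penalties c n I pen \<longrightarrow>
         penalty_success_prob A 36 n k I pen \<ge> 1 - 1 / real n ^ e)"
  proof (intro exI[of _ "sim_algorithm (penalty_sim c e)"] exI[of _ ?a] exI[of _ "7::nat"] allI impI ballI conjI)
    fix n k :: nat assume nk: "2 \<le> n" "k \<in> {1..n}"
    note cx = algorithm_complexity[OF nk, of "penalty_sim c e" c e]
    show "message_length_le (sim_algorithm (penalty_sim c e)) n k (?a * log 2 n ^ 7)"
      "real (rounds (sim_algorithm (penalty_sim c e)) n k) \<le> ?a * log 2 n ^ 7 * (real n / real k)"
      by (rule cx; use broadcasts_le(2)[OF nk(1), of c e] in \<open>simp add: penalty_sim_def\<close>)+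
    show "penalty_success_prob (sim_algorithm (penalty_sim c e)) 36 n k I pen \<ge> 1 - 1 / real n ^ e"
      if "valid_instance c n I \<and> valid_penalties c n I pen" for I pen
      using penalty_success nk that by simp
  qed
qed simp_all

end
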